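(* Let $d\ge2$, $1<p<\infty$, and let $\omega_{\varepsilon,\eta}=\mathbb{R}^d\setminus\bigcup_{k\in\mathbb{Z}^d}\varepsilon(k+\eta T)$ be a periodically perforated domain with hole $T$ having $C^1$ boundary, as in the context, $\varepsilon,\eta\in(0,1]$. Let $$B_p(\varepsilon,\eta)=\sup\|\nabla u\|_{L^p(\omega_{\varepsilon,\eta})},$$ where the supremum is over all weak solutions $u\in W^{1,2}_0(\omega_{\varepsilon,\eta})$ of $-\Delta u=F$ in $\omega_{\varepsilon,\eta}$ with $F\in L^p(\omega_{\varepsilon,\eta})\cap L^2(\omega_{\varepsilon,\eta})$ and $\|F\|_{L^p(\omega_{\varepsilon,\eta})}=1$. Then, for $d\ge3$, $$B_p(\varepsilon,\eta)\ge\begin{cases}c\,\varepsilon\eta^{1-\frac d2}&\text{for }1<p\le2,\\ c\,\varepsilon\eta^{1-d+\frac dp}&\text{for }2<p<\infty,\end{cases}$$ and for $d=2$, $$B_p(\varepsilon,\eta)\ge\begin{cases}c\,\varepsilon|\ln(\eta/2)|^{\frac12}&\text{for }1<p\le2,\\ c\,\varepsilon\eta^{-1+\frac2p}&\text{for }2<p<\infty,\end{cases}$$ where $c>0$ depends only on $d$, $p$ and $T$.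
   Context: $Y=[-1/2,1/2]^d$. The hole $T$ is the closure of a bounded subdomain of $Y$ with $C^1$ boundary such that $Y\setminus T$ is connected, $B(0,c_0)\subset T$ and $\mathrm{dist}(\partial T,\partial Y)\ge c_0$ for some $c_0>0$. $W^{1,2}_0(\Omega)$ is the completion of $C_0^\infty(\Omega)$ with respect to the norm $\|\nabla\psi\|_{L^2(\Omega)}$; a weak solution of $-\Delta u=F$ satisfies $\int\nabla u\cdot\nabla\phi=\int F\phi$ for all $\phi\in C_0^\infty$. *)

theory Defs
  imports "HOL-Analysis.Analysis"
begin

section \<open>Smooth functions\<close>

definition partial_deriv :: "'n \<Rightarrow> (real^'n \<Rightarrow> real) \<Rightarrow> real^'n \<Rightarrow> real" where
  "partial_deriv i f x = frechet_derivative f (at x) (axis i 1)"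

definition grad :: "(real^'n \<Rightarrow> real) \<Rightarrow> real^'n \<Rightarrow> real^'n" where
  "grad f x = (\<chi> i. partial_deriv i f x)"

primrec C_k :: "nat \<Rightarrow> (real^'n \<Rightarrow> real) \<Rightarrow> bool" where
  "C_k 0 f \<longleftrightarrow> continuous_on UNIV f"
| "C_k (Suc k) f \<longleftrightarrow> (\<forall>x. f differentiable (at x)) \<and> (\<forall>i. C_k k (partial_deriv i f))"

definition C0_infinity :: "(real^'n) set \<Rightarrow> (real^'n \<Rightarrow> real) set" where
  "C0_infinity \<Omega> =
     {f. (\<forall>k. C_k k f) \<and> (\<exists>K. compact K \<and> K \<subseteq> \<Omega> \<and> (\<forall>x. x \<notin> K \<longrightarrow> f x = 0))}"

section \<open>Lebesgue and Sobolev spaces\<close>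

text \<open>Functions on \<open>\<Omega>\<close> are total functions of which only the values on \<open>\<Omega>\<close> matter.\<close>

definition Lp_space :: "real \<Rightarrow> (real^'n) set \<Rightarrow> (real^'n \<Rightarrow> 'b::euclidean_space) set" where
  "Lp_space p \<Omega> = {f. set_borel_measurable lebesgue \<Omega> f \<and>
                      set_integrable lebesgue \<Omega> (\<lambda>x. norm (f x) powr p)}"

definition Lp_norm :: "real \<Rightarrow> (real^'n) set \<Rightarrow> (real^'n \<Rightarrow> 'b::euclidean_space) \<Rightarrow> ennreal" where
  "Lp_norm p \<Omega> f =
     (if f \<in> Lp_space p \<Omega>
      then ennreal ((LINT x:\<Omega>|lebesgue. norm (f x) powr p) powr (1 / p)) else \<infinity>)"

definition locally_integrable :: "(real^'n) set \<Rightarrow> (real^'n \<Rightarrow> 'b::euclidean_space) \<Rightarrow> bool" where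
  "locally_integrable \<Omega> f \<longleftrightarrow>
     (\<forall>K. compact K \<and> K \<subseteq> \<Omega> \<longrightarrow> set_integrable lebesgue K f)"

definition weak_gradient ::
    "(real^'n) set \<Rightarrow> (real^'n \<Rightarrow> real) \<Rightarrow> (real^'n \<Rightarrow> real^'n) \<Rightarrow> bool" where
  "weak_gradient \<Omega> u g \<longleftrightarrow> locally_integrable \<Omega> u \<and> locally_integrable \<Omega> g \<and>
     (\<forall>\<phi>\<in>C0_infinity \<Omega>. \<forall>i.
        (LINT x:\<Omega>|lebesgue. u x * partial_deriv i \<phi> x) = - (LINT x:\<Omega>|lebesgue. g x $ i * \<phi> x))"

text \<open>
  The completion of \<open>C0_infinity \<Omega>\<close> for the norm \<open>\<psi> \<mapsto> Lp_norm 2 \<Omega> (grad \<psi>)\<close>, realised as a space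
  of functions: the element given by a Cauchy sequence \<open>\<psi>\<close> is the limit \<open>u\<close> of \<open>\<psi>\<close> in
  \<open>L\<^sup>2\<close> on bounded parts of \<open>\<Omega>\<close>, and its weak gradient is the \<open>L\<^sup>2\<close> limit of \<open>grad (\<psi> n)\<close>.
  This is the whole abstract completion whenever \<open>\<Omega>\<close> admits a Poincare inequality
  \<open>Lp_norm 2 \<Omega> \<psi> \<le> C * Lp_norm 2 \<Omega> (grad \<psi>)\<close> on \<open>C0_infinity \<Omega>\<close>; the periodically perforated
  domains below do, since every period contains a ball of fixed radius outside \<open>\<Omega>\<close>.
\<close>

definition W12_0 :: "(real^'n) set \<Rightarrow> (real^'n \<Rightarrow> real) set" where
  "W12_0 \<Omega> = {u. \<exists>\<psi> :: nat \<Rightarrow> real^'n \<Rightarrow> real.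
     (\<forall>n. \<psi> n \<in> C0_infinity \<Omega>) \<and>
     (\<forall>e>0. \<exists>N. \<forall>m\<ge>N. \<forall>n\<ge>N. Lp_norm 2 \<Omega> (\<lambda>x. grad (\<psi> m) x - grad (\<psi> n) x) < e) \<and>
     (\<forall>R. (\<lambda>n. Lp_norm 2 (\<Omega> \<inter> ball 0 R) (\<lambda>x. \<psi> n x - u x)) \<longlonglongrightarrow> 0)}"

text \<open>
  \<open>u\<close> is a weak solution in \<open>W12_0 \<Omega>\<close> of \<open>-\<Delta>u = F\<close> and \<open>g\<close> is its (a.e. unique) weak gradient.
\<close>

definition weak_solution ::
    "(real^'n) set \<Rightarrow> (real^'n \<Rightarrow> real) \<Rightarrow> (real^'n \<Rightarrow> real) \<Rightarrow> (real^'n \<Rightarrow> real^'n) \<Rightarrow> bool" where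
  "weak_solution \<Omega> F u g \<longleftrightarrow> u \<in> W12_0 \<Omega> \<and> weak_gradient \<Omega> u g \<and>
     (\<forall>\<phi>\<in>C0_infinity \<Omega>.
        (LINT x:\<Omega>|lebesgue. g x \<bullet> grad \<phi> x) = (LINT x:\<Omega>|lebesgue. F x * \<phi> x))"

section \<open>Periodically perforated domains\<close>

text \<open>
  Near each boundary point, \<open>D\<close> is the part above the graph of a \<open>C\<^sup>1\<close> function in a suitable
  orthonormal frame. Here \<open>\<nu>\<close> is the vertical direction of the frame, and a function of the
  \<open>d-1\<close> horizontal variables is a function on the whole space that is constant along \<open>\<nu>\<close>.
\<close>

definition C1_boundary :: "(real^'n) set \<Rightarrow> bool" where
  "C1_boundary D \<longleftrightarrow>
     (\<forall>z\<in>frontier D. \<exists>r>0. \<exists>\<nu> h. norm \<nu> = 1 \<and> C_k 1 h \<and> (\<forall>x t. h (x + t *\<^sub>R \<nu>) = h x) \<and>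
        D \<inter> ball z r = {x \<in> ball z r. h x < x \<bullet> \<nu>})"

definition unit_cell :: "(real^'n) set" where
  "unit_cell = {x. \<forall>i. - 1/2 \<le> x $ i \<and> x $ i \<le> 1/2}"

definition admissible_hole :: "(real^'n) set \<Rightarrow> bool" where
  "admissible_hole T \<longleftrightarrow>
     (\<exists>D. open D \<and> connected D \<and> D \<noteq> {} \<and> bounded D \<and> D \<subseteq> unit_cell \<and> C1_boundary D \<and>
        T = closure D) \<and>
     connected (unit_cell - T) \<and>
     (\<exists>c0>0. ball 0 c0 \<subseteq> T \<and> setdist (frontier T) (frontier unit_cell) \<ge> c0)"

definition perforated_domain :: "(real^'n) set \<Rightarrow> real \<Rightarrow> real \<Rightarrow> (real^'n) set" where
  "perforated_domain T \<epsilon> \<eta> =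
     UNIV - (\<Union>k\<in>{k. \<forall>i. k $ i \<in> \<int>}. (\<lambda>y. \<epsilon> *\<^sub>R (k + \<eta> *\<^sub>R y)) ` T)"

definition B_const :: "real \<Rightarrow> (real^'n) set \<Rightarrow> real \<Rightarrow> real \<Rightarrow> ennreal" where
  "B_const p T \<epsilon> \<eta> =
     (let \<Omega> = perforated_domain T \<epsilon> \<eta> in
      Sup {Lp_norm p \<Omega> g | F u g.
             F \<in> Lp_space p \<Omega> \<and> F \<in> Lp_space 2 \<Omega> \<and> Lp_norm p \<Omega> F = 1 \<and> weak_solution \<Omega> F u g})"

end

theory Submission
  imports Defs
begin

text \<open>
  For \<open>F = \<partial>\<^sub>i h\<close> with \<open>h\<close> smooth and compactly supported, let \<open>g\<close> be the gradient of the solution. Its energy is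
  \<open>\<integral> |g|\<^sup>2 = - \<integral> h g\<^sub>i\<close>, hence at most \<open>|h|\<^sub>q |g|\<^sub>p\<close> for conjugate \<open>p, q\<close>. Testing the equation with a single
  \<open>\<phi>\<close> and using either Hoelder's inequality or the Cauchy-Schwarz inequality gives
  \<open>|g|\<^sub>p \<ge> \<integral> F \<phi> / |\<nabla>\<phi>|\<^sub>q\<close> and \<open>|g|\<^sub>p \<ge> (\<integral> F \<phi>)\<^sup>2 / (|h|\<^sub>q |\<nabla>\<phi>|\<^sub>2\<^sup>2)\<close>. The first bound is used for \<open>p > 2\<close>,
  the second for \<open>p \<le> 2\<close>. One takes \<open>F\<close> spread over a region of size \<open>L\<close> and \<open>\<phi> = F (1 - b)\<close>, where \<open>b\<close> is a sum of
  bumps which are \<open>1\<close> near the holes; with the capacity of the bumps per cell, \<open>L\<close> is taken to be the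
  screening length (\<open>\<epsilon> \<eta>\<^bsup>1 - d/2\<^esup>\<close>, or \<open>\<epsilon> |ln \<eta>|\<^bsup>1/2\<^esup>\<close> in the plane) for the second bound, and large enough for the first.
  The bumps overlap the cell boundary unless \<open>\<eta>\<close> is small; for the remaining \<open>\<eta>\<close> one bump away from all holes suffices.
\<close>

section \<open>Smooth functions and bump functions\<close>

text \<open>The supremum needs actual solutions, so one is built by the direct method; the Poincare
  constant used there may depend on \<epsilon> and \<eta>, because it does not enter the lower
  bounds. The obstacle for p < 2 is that a large energy gives no lower bound for the L^p norm of the
  gradient. A datum in derivative form removes it: the energy is then a pairing of h with a
  component of g, so a small L^p norm would force a small energy. The sizes come from scaling. On a
  region of size L the integral of |\<nabla>\<phi>|^r per unit volume is about L^(-r) + t_r, where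
  t_r = \<epsilon>^(-r) \<eta>^(d-r) is the r-capacity of the holes per volume. As 1/p + 1/q = 1,
  all volumes cancel, and the two bounds become (L^(-q) + t_q)^(-1/q) and 1 / (L (L^(-2) + t_2)).
  The first saturates at \<epsilon> \<eta>^(1 - d/q), where d/q = d - d/p; the second is largest at
  L = t_2^(-1/2), the screening length. For d = 2 no power of \<eta> is left in t_2, and only
  averaging over scales lowers it, by a factor of order 1/|ln \<eta>|.\<close>

definition smooth :: "(real^'n \<Rightarrow> real) \<Rightarrow> bool" where
  "smooth f \<longleftrightarrow> (\<forall>k. C_k k f)"

lemma partial_deriv_eqI:
  "(f has_derivative f') (at x) \<Longrightarrow> partial_deriv i f x = f' (axis i 1)"
  by (simp add: partial_deriv_def frechet_derivative_at[symmetric])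

lemma has_derivative_grad:
  assumes "f differentiable (at x)"
  shows "(f has_derivative (\<lambda>v. grad f x \<bullet> v)) (at x)"
proof -
  have d: "(f has_derivative frechet_derivative f (at x)) (at x)"
    using assms frechet_derivative_works by blast
  then have lin: "linear (frechet_derivative f (at x))"
    by (rule has_derivative_linear)
  have "frechet_derivative f (at x) v = grad f x \<bullet> v" for v
  proof -
    have "frechet_derivative f (at x) v = frechet_derivative f (at x) (\<Sum>i\<in>UNIV. (v $ i) *\<^sub>R axis i 1)"
      by (simp add: basis_expansion[of v, unfolded scalar_mult_eq_scaleR])
    also have "\<dots> = grad f x \<bullet> v"
      by (simp add: linear_sum[OF lin] linear_cmul[OF lin] grad_def partial_deriv_def inner_vec_def mult.commute)
    finally show ?thesis .
  qed
  then have "frechet_derivative f (at x) = (\<lambda>v. grad f x \<bullet> v)" by blast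
  then show ?thesis using d by simp
qed

text \<open>\<open>C_k (Suc k) f\<close> has no clause \<open>C_k k f\<close>: continuity at the
  bottom level comes from differentiability, the rest from the induction hypothesis for the partial
  derivatives. The product rule relies on this, since its terms mix \<open>f\<close> with
  derivatives of \<open>g\<close>.\<close>

lemma C_k_Suc_imp: "C_k (Suc k) f \<Longrightarrow> C_k k f"
proof (induction k arbitrary: f)
  case 0
  then show ?case
    by (auto simp: continuous_on_eq_continuous_within intro!: differentiable_imp_continuous_within)
next
  case (Suc k)
  then show ?case by auto
qed

lemma smooth_differentiable: "smooth f \<Longrightarrow> f differentiable (at x)"
  using C_k.simps(2) unfolding smooth_def by blast

lemma smooth_partial_deriv: "smooth f \<Longrightarrow> smooth (partial_deriv i f)"
  using C_k.simps(2) unfolding smooth_def by blast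

lemma smooth_continuous: "smooth f \<Longrightarrow> continuous_on UNIV f"
  using C_k.simps(1) unfolding smooth_def by blast

lemma smooth_grad_continuous: "smooth f \<Longrightarrow> continuous_on UNIV (grad f)"
  unfolding grad_def
  by (intro continuous_on_vec_lambda) (auto intro: smooth_continuous smooth_partial_deriv)

lemma C_k_const: "C_k k (\<lambda>x::real^'n. c)"
proof (induction k arbitrary: c)
  case (Suc k)
  have "partial_deriv i (\<lambda>x::real^'n. c) = (\<lambda>x. 0)" for i
    by (simp add: partial_deriv_def fun_eq_iff)
  then show ?case using Suc.IH[of 0] by simp
qed simp

lemma C_k_component: "C_k k (\<lambda>x::real^'n. x $ i)"
proof (cases k)
  case (Suc m)
  have d: "((\<lambda>x::real^'n. x $ i) has_derivative (\<lambda>v. v $ i)) (at x)" for x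
    by (rule bounded_linear_imp_has_derivative) (rule bounded_linear_vec_nth)
  have "partial_deriv j (\<lambda>x::real^'n. x $ i) = (\<lambda>x. axis j 1 $ i)" for j
    using partial_deriv_eqI[OF d] by blast
  then show ?thesis using Suc d C_k_const by (auto simp: differentiable_def)
qed (simp add: continuous_on_component)

lemma partial_deriv_add:
  assumes "f differentiable (at x)" "g differentiable (at x)"
  shows "partial_deriv i (\<lambda>x. f x + g x) x = partial_deriv i f x + partial_deriv i g x"
proof -
  have "((\<lambda>x. f x + g x) has_derivative (\<lambda>v. grad f x \<bullet> v + grad g x \<bullet> v)) (at x)"
    by (intro has_derivative_add has_derivative_grad assms)
  from partial_deriv_eqI[OF this] show ?thesis
    by (simp add: grad_def inner_axis)
qed

lemma partial_deriv_mult: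
  assumes "f differentiable (at x)" "g differentiable (at x)"
  shows "partial_deriv i (\<lambda>x. f x * g x) x = f x * partial_deriv i g x + partial_deriv i f x * g x"
proof -
  have "((\<lambda>x. f x * g x) has_derivative (\<lambda>v. f x * (grad g x \<bullet> v) + (grad f x \<bullet> v) * g x)) (at x)"
    by (intro has_derivative_mult has_derivative_grad assms)
  from partial_deriv_eqI[OF this] show ?thesis
    by (simp add: grad_def inner_axis)
qed

lemma partial_deriv_compose:
  assumes "g differentiable (at x)" "(f has_real_derivative D) (at (g x))"
  shows "partial_deriv i (\<lambda>x. f (g x)) x = D * partial_deriv i g x"
    and "(\<lambda>x. f (g x)) differentiable (at x)"
proof -
  have d: "((\<lambda>x. f (g x)) has_derivative (\<lambda>v. D * (grad g x \<bullet> v))) (at x)"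
    using has_derivative_compose[OF has_derivative_grad[OF assms(1)], of f "\<lambda>v. D * v"] assms(2)
    by (auto simp: has_field_derivative_def)
  from partial_deriv_eqI[OF d] show "partial_deriv i (\<lambda>x. f (g x)) x = D * partial_deriv i g x"
    by (simp add: grad_def inner_axis)
  show "(\<lambda>x. f (g x)) differentiable (at x)" using d by (auto simp: differentiable_def)
qed

lemma C_k_add: "C_k k f \<Longrightarrow> C_k k g \<Longrightarrow> C_k k (\<lambda>x. f x + g x)"
proof (induction k arbitrary: f g)
  case (Suc k)
  then have "partial_deriv i (\<lambda>x. f x + g x) = (\<lambda>x. partial_deriv i f x + partial_deriv i g x)" for i
    by (auto simp: partial_deriv_add)
  then show ?case using Suc by auto
qed (auto intro: continuous_on_add)

lemma C_k_mult: "C_k k f \<Longrightarrow> C_k k g \<Longrightarrow> C_k k (\<lambda>x. f x * g x)"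
proof (induction k arbitrary: f g)
  case (Suc k)
  have "partial_deriv i (\<lambda>x. f x * g x) = (\<lambda>x. f x * partial_deriv i g x + partial_deriv i f x * g x)" for i
    using Suc.prems by (auto simp: partial_deriv_mult)
  then show ?case using Suc C_k_Suc_imp[OF Suc.prems(1)] C_k_Suc_imp[OF Suc.prems(2)]
    by (auto intro!: C_k_add)
qed (auto intro: continuous_on_mult)

lemma C_k_sum: "(\<And>i. i \<in> I \<Longrightarrow> C_k k (f i)) \<Longrightarrow> C_k k (\<lambda>x. \<Sum>i\<in>I. f i x)"
  by (induction I rule: infinite_finite_induct) (auto intro: C_k_add C_k_const)

text \<open>A derivative of \<open>1 / f\<close> is \<open>-(1 / f)\<^sup>2\<close> times a
  derivative of \<open>f\<close>, so the regularity of \<open>1 / f\<close> at level k yields level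
  k + 1.\<close>

lemma smooth_inverse:
  assumes "smooth f" "\<And>x. f x \<noteq> 0"
  shows "smooth (\<lambda>x. inverse (f x))"
  unfolding smooth_def
proof
  fix k show "C_k k (\<lambda>x. inverse (f x))"
  proof (induction k)
    case 0
    then show ?case using assms smooth_continuous by (auto intro!: continuous_on_inverse)
  next
    case (Suc k)
    have d: "(inverse has_real_derivative - (inverse (f x) * inverse (f x))) (at (f x))" for x
      using DERIV_inverse[of "f x"] assms(2) by (simp add: power2_eq_square)
    have "partial_deriv i (\<lambda>x. inverse (f x)) = (\<lambda>x. (- 1) * (inverse (f x) * inverse (f x)) * partial_deriv i f x)" for i
      using partial_deriv_compose(1)[OF smooth_differentiable[OF assms(1)] d] by auto
    moreover have "C_k k (\<lambda>x. (- 1) * (inverse (f x) * inverse (f x)) * partial_deriv i f x)" for i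
      using Suc smooth_partial_deriv[OF assms(1)]
      by (intro C_k_mult C_k_const) (auto simp: smooth_def)
    ultimately show ?case
      using partial_deriv_compose(2)[OF smooth_differentiable[OF assms(1)] d] by auto
  qed
qed

text \<open>The functions \<open>x\<^sup>-\<^sup>m exp (-1/x)\<close>, extended by zero: their span is closed under differentiation.\<close>

definition flat_fun :: "nat \<Rightarrow> real \<Rightarrow> real" where
  "flat_fun m x = (if 0 < x then exp (- inverse x) * inverse x ^ m else 0)"

text \<open>From the right, the substitution \<open>y = 1 / x\<close> turns this into the decay of
  \<open>y ^ m / exp y\<close> at infinity.\<close>

lemma flat_fun_tendsto_0: "(flat_fun m \<longlongrightarrow> 0) (at 0)"
proof -
  have "((\<lambda>y::real. y ^ m / exp y) \<longlongrightarrow> 0) at_top"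
    by (rule tendsto_power_div_exp_0)
  then have "((\<lambda>x. inverse x ^ m / exp (inverse x)) \<longlongrightarrow> (0::real)) (at_right 0)"
    by (rule filterlim_compose) (rule filterlim_inverse_at_top_right)
  then have "(flat_fun m \<longlongrightarrow> 0) (at_right 0)"
    by (rule Lim_transform_eventually)
      (auto simp: eventually_at_right_less flat_fun_def exp_minus field_simps eventually_at intro!: exI[of _ 1])
  moreover have "(flat_fun m \<longlongrightarrow> 0) (at_left 0)"
    by (rule Lim_transform_eventually[of "\<lambda>_. 0"]) (auto simp: flat_fun_def eventually_at intro!: exI[of _ 1])
  ultimately show ?thesis by (simp add: filterlim_split_at)
qed

lemma flat_fun_deriv:
  "(flat_fun m has_real_derivative flat_fun (m + 2) x - m * flat_fun (m + 1) x) (at x)"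
proof -
  consider "x > 0" | "x < 0" | "x = 0" by linarith
  then show ?thesis
  proof cases
    case 1
    have "((\<lambda>x. exp (- inverse x) * inverse x ^ m) has_real_derivative
        flat_fun (m + 2) x - m * flat_fun (m + 1) x) (at x)"
      using 1
      by (auto intro!: derivative_eq_intros simp: flat_fun_def power2_eq_square)
        (cases m; simp add: field_simps power2_eq_square)
    then show ?thesis
      by (rule has_field_derivative_transform_within_open[of _ _ _ "{0<..}"]) (use 1 in \<open>auto simp: flat_fun_def\<close>)
  next
    case 2
    have "((\<lambda>x. 0) has_real_derivative flat_fun (m + 2) x - m * flat_fun (m + 1) x) (at x)"
      using 2 by (simp add: flat_fun_def)
    then show ?thesis
      by (rule has_field_derivative_transform_within_open[of _ _ _ "{..<0}"]) (use 2 in \<open>auto simp: flat_fun_def\<close>)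
  next
    case 3
    \<comment> \<open>At 0 the difference quotient of \<open>flat_fun m\<close> is
      \<open>flat_fun (Suc m)\<close>, whose limit is already known.\<close>
    have "((\<lambda>h. (flat_fun m (0 + h) - flat_fun m 0) / h) \<longlongrightarrow> 0) (at 0)"
      by (rule Lim_transform_eventually[OF flat_fun_tendsto_0[of "Suc m"]])
        (auto simp: flat_fun_def eventually_at field_simps intro!: exI[of _ 1])
    then show ?thesis using 3 by (simp add: DERIV_def flat_fun_def)
  qed
qed

lemma smooth_flat_fun:
  assumes "smooth g"
  shows "smooth (\<lambda>x. flat_fun m (g x))"
  unfolding smooth_def
proof
  fix k show "C_k k (\<lambda>x. flat_fun m (g x))"
  proof (induction k arbitrary: m)
    case 0
    have "isCont (flat_fun m) y" for y using flat_fun_deriv DERIV_isCont by blast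
    then have "continuous_on UNIV (flat_fun m)"
      by (simp add: continuous_on_eq_continuous_within)
    then show ?case
      using continuous_on_compose2[OF _ smooth_continuous[OF assms]] by fastforce
  next
    case (Suc k)
    have "partial_deriv i (\<lambda>x. flat_fun m (g x)) =
        (\<lambda>x. (flat_fun (m + 2) (g x) + (- real m) * flat_fun (m + 1) (g x)) * partial_deriv i g x)" for i
      using partial_deriv_compose(1)[OF smooth_differentiable[OF assms] flat_fun_deriv] by auto
    moreover have "C_k k (\<lambda>x. (flat_fun (m + 2) (g x) + (- real m) * flat_fun (m + 1) (g x)) * partial_deriv i g x)" for i
      using Suc smooth_partial_deriv[OF assms]
      by (intro C_k_mult C_k_add C_k_const) (auto simp: smooth_def)
    ultimately show ?case
      using partial_deriv_compose(2)[OF smooth_differentiable[OF assms] flat_fun_deriv] by auto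
  qed
qed

lemma smooth_const: "smooth (\<lambda>x::real^'n. c)"
  by (simp add: smooth_def C_k_const)

lemma smooth_add: "smooth f \<Longrightarrow> smooth g \<Longrightarrow> smooth (\<lambda>x. f x + g x)"
  by (simp add: smooth_def C_k_add)

lemma smooth_mult: "smooth f \<Longrightarrow> smooth g \<Longrightarrow> smooth (\<lambda>x. f x * g x)"
  by (simp add: smooth_def C_k_mult)

lemma smooth_cmult: "smooth f \<Longrightarrow> smooth (\<lambda>x. c * f x)"
  by (simp add: smooth_def C_k_mult C_k_const)

lemma smooth_diff: "smooth f \<Longrightarrow> smooth g \<Longrightarrow> smooth (\<lambda>x. f x - g x)"
  using smooth_add[of f "\<lambda>x. (-1) * g x"] smooth_cmult[of g "-1"] by simp

lemma smooth_inner_self: "smooth (\<lambda>x::real^'n. x \<bullet> x)"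
  unfolding inner_vec_def smooth_def by (auto intro!: C_k_sum C_k_mult C_k_component)

text \<open>The usual smooth transition quotient, equal to 1 up to norm 1 and to 0 from norm 2 on.
  It is applied to the squared norm, which is smooth at the origin too. The denominator is positive
  because \<open>4 - x \<bullet> x\<close> and \<open>x \<bullet> x - 1\<close> are never both
  nonpositive.\<close>

definition bump :: "real^'n \<Rightarrow> real" where
  "bump x = flat_fun 0 (4 - x \<bullet> x) * inverse (flat_fun 0 (4 - x \<bullet> x) + flat_fun 0 (x \<bullet> x - 1))"

lemma flat_fun_nonneg: "0 \<le> flat_fun m x"
  by (simp add: flat_fun_def)

lemma flat_fun_pos: "0 < x \<Longrightarrow> 0 < flat_fun m x"
  by (simp add: flat_fun_def)

lemma bump_denominator_pos: "0 < flat_fun 0 (4 - x \<bullet> x) + flat_fun 0 (x \<bullet> x - 1)"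
proof (cases "x \<bullet> x < 4")
  case True
  then show ?thesis by (intro add_pos_nonneg flat_fun_nonneg flat_fun_pos) auto
next
  case False
  then show ?thesis by (intro add_nonneg_pos flat_fun_nonneg flat_fun_pos) auto
qed

lemma smooth_bump: "smooth bump"
  unfolding bump_def
  by (intro smooth_mult smooth_inverse smooth_add smooth_flat_fun smooth_diff smooth_const smooth_inner_self)
    (metis less_irrefl bump_denominator_pos)

lemma bump_nonneg: "0 \<le> bump x"
  using bump_denominator_pos[of x] by (simp add: bump_def flat_fun_nonneg)

lemma bump_le_1: "bump x \<le> 1"
  using bump_denominator_pos[of x] flat_fun_nonneg[of 0 "x \<bullet> x - 1"]
  by (simp add: bump_def divide_inverse[symmetric])

lemma bump_eq_1: assumes "norm x \<le> 1" shows "bump x = 1"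
proof -
  have "x \<bullet> x \<le> 1" using assms by (simp add: dot_square_norm abs_square_le_1)
  then show ?thesis using bump_denominator_pos[of x] by (simp add: bump_def flat_fun_def)
qed

lemma bump_eq_0: assumes "2 \<le> norm x" shows "bump x = 0"
proof -
  have "2\<^sup>2 \<le> (norm x)\<^sup>2" using assms by (intro power_mono) auto
  then have "4 \<le> x \<bullet> x" by (simp add: dot_square_norm)
  then show ?thesis by (simp add: bump_def flat_fun_def)
qed

section \<open>Derivatives of rescaled functions and rules for the gradient\<close>

lemma affine_deriv:
  assumes "f differentiable (at (a *\<^sub>R (x - c)))"
  shows "partial_deriv i (\<lambda>x. f (a *\<^sub>R (x - c))) x = a * partial_deriv i f (a *\<^sub>R (x - c))"
    and "(\<lambda>x. f (a *\<^sub>R (x - c))) differentiable (at x)"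
proof -
  have "((\<lambda>x. a *\<^sub>R (x - c)) has_derivative (\<lambda>v. a *\<^sub>R v)) (at x)"
    by (auto intro!: derivative_eq_intros)
  from has_derivative_compose[OF this has_derivative_grad[OF assms]]
  have d: "((\<lambda>x. f (a *\<^sub>R (x - c))) has_derivative
      (\<lambda>v. grad f (a *\<^sub>R (x - c)) \<bullet> (a *\<^sub>R v))) (at x)" .
  from partial_deriv_eqI[OF d]
  show "partial_deriv i (\<lambda>x. f (a *\<^sub>R (x - c))) x = a * partial_deriv i f (a *\<^sub>R (x - c))"
    by (simp add: grad_def inner_axis)
  show "(\<lambda>x. f (a *\<^sub>R (x - c))) differentiable (at x)" using d by (auto simp: differentiable_def)
qed

lemma smooth_affine:
  assumes "smooth f"
  shows "smooth (\<lambda>x. f (a *\<^sub>R (x - c)))"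
proof -
  have "C_k k f \<Longrightarrow> C_k k (\<lambda>x. f (a *\<^sub>R (x - c)))" for k and f :: "real^'a \<Rightarrow> real"
  proof (induction k arbitrary: f)
    case 0
    then show ?case by (auto intro!: continuous_on_compose2[of UNIV f] continuous_intros)
  next
    case (Suc k)
    then have d: "f differentiable (at (a *\<^sub>R (x - c)))" for x by simp
    have "C_k k (\<lambda>x. a * partial_deriv i f (a *\<^sub>R (x - c)))" for i
      using Suc by (intro C_k_mult C_k_const) auto
    moreover have "partial_deriv i (\<lambda>x. f (a *\<^sub>R (x - c))) = (\<lambda>x. a * partial_deriv i f (a *\<^sub>R (x - c)))" for i
      using affine_deriv(1)[OF d] by blast
    ultimately show ?case using affine_deriv(2)[OF d] by simp
  qed
  then show ?thesis using assms by (auto simp: smooth_def)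
qed

lemma grad_affine:
  "smooth f \<Longrightarrow> grad (\<lambda>x. f (a *\<^sub>R (x - c))) x = a *\<^sub>R grad f (a *\<^sub>R (x - c))"
  by (simp add: grad_def vec_eq_iff affine_deriv(1)[of f a _ c, OF smooth_differentiable])

lemma grad_component: "grad f x $ i = partial_deriv i f x"
  by (simp add: grad_def)

lemma grad_add: "smooth f \<Longrightarrow> smooth g \<Longrightarrow> grad (\<lambda>x. f x + g x) x = grad f x + grad g x"
  by (simp add: vec_eq_iff grad_component partial_deriv_add smooth_differentiable)

lemma grad_mult: "smooth f \<Longrightarrow> smooth g \<Longrightarrow> grad (\<lambda>x. f x * g x) x = f x *\<^sub>R grad g x + g x *\<^sub>R grad f x"
  by (simp add: vec_eq_iff grad_component partial_deriv_mult smooth_differentiable)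

lemma grad_const: "grad (\<lambda>x. c) x = 0"
  by (simp add: vec_eq_iff grad_component partial_deriv_def)

lemma grad_cmult: "smooth f \<Longrightarrow> grad (\<lambda>x. c * f x) x = c *\<^sub>R grad f x"
  by (simp add: grad_mult[OF smooth_const] grad_const)

lemma grad_diff: "smooth f \<Longrightarrow> smooth g \<Longrightarrow> grad (\<lambda>x. f x - g x) x = grad f x - grad g x"
  using grad_add[of f "\<lambda>x. (-1) * g x" x] grad_cmult[of g "-1" x] smooth_cmult[of g "-1"] by simp

lemma smooth_sum: "(\<And>i. i \<in> I \<Longrightarrow> smooth (f i)) \<Longrightarrow> smooth (\<lambda>x. \<Sum>i\<in>I. f i x)"
  by (auto simp: smooth_def C_k_sum)

lemma grad_sum:
  "(\<And>i. i \<in> I \<Longrightarrow> smooth (f i)) \<Longrightarrow> grad (\<lambda>x. \<Sum>i\<in>I. f i x) x = (\<Sum>i\<in>I. grad (f i) x)"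
  by (induction I rule: infinite_finite_induct) (auto simp: grad_const grad_add smooth_sum)

lemma grad_eq_0_open:
  assumes "open U" "x \<in> U" "\<And>y. y \<in> U \<Longrightarrow> f y = c"
  shows "grad f x = 0"
proof -
  have "(f has_derivative (\<lambda>v. 0)) (at x)"
    by (rule has_derivative_transform_within_open[of "\<lambda>x. c" _ _ _ U]) (use assms in auto)
  then show ?thesis by (simp add: vec_eq_iff grad_component partial_deriv_eqI)
qed

text \<open>Local constancy settles the open ball and the open exterior, and continuity of the
  gradient adds the two spheres. The gradient thus lives on an open annulus, so that annuli of
  consecutive dyadic radii are disjoint.\<close>

lemma grad_bump_eq_0:
  fixes x :: "real^'n"
  assumes "norm x \<le> 1 \<or> 2 \<le> norm x"
  shows "grad bump x = 0"
proof -
  have cont: "continuous_on UNIV (grad (bump :: real^'n \<Rightarrow> real))"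
    by (rule smooth_grad_continuous[OF smooth_bump])
  have cl: "closed {x::real^'n. grad bump x = 0}"
    using continuous_closed_preimage[OF cont closed_UNIV closed_singleton[of 0]]
    by (simp add: vimage_def)
  have "ball 0 1 \<subseteq> {x::real^'n. grad bump x = 0}"
  proof
    fix y :: "real^'n" assume "y \<in> ball 0 1"
    then show "y \<in> {x. grad bump x = 0}"
      by (intro CollectI grad_eq_0_open[of "ball 0 1" y bump 1]) (auto intro!: bump_eq_1)
  qed
  moreover have "- cball 0 2 \<subseteq> {x::real^'n. grad bump x = 0}"
  proof
    fix y :: "real^'n" assume "y \<in> - cball 0 2"
    then show "y \<in> {x. grad bump x = 0}"
      by (intro CollectI grad_eq_0_open[of "- cball 0 2" y bump 0]) (auto intro!: bump_eq_0)
  qed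
  ultimately have "closure (ball 0 1) \<union> closure (- cball 0 2) \<subseteq> {x::real^'n. grad bump x = 0}"
    using cl by (intro Un_least closure_minimal)
  moreover have "x \<in> cball 0 1 \<union> - ball 0 2"
    using assms by auto
  ultimately show ?thesis
    by (auto simp: closure_complement interior_cball subset_iff)
qed

section \<open>Compactly supported functions\<close>

text \<open>A bounded nonzero set replaces compact support because it passes easily through sums and
  compositions; taking the closure brings compactness back where integrals are needed.\<close>

definition Cc :: "('a::euclidean_space \<Rightarrow> 'b::euclidean_space) set" where
  "Cc = {f. continuous_on UNIV f \<and> bounded {x. f x \<noteq> 0}}"

lemma C0_infinityD:
  assumes "f \<in> C0_infinity \<Omega>"
  shows "smooth f" "f \<in> Cc" "partial_deriv i f \<in> C0_infinity \<Omega>" "x \<notin> \<Omega> \<Longrightarrow> f x = 0"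
    "f \<in> C0_infinity UNIV"
proof -
  obtain K where K: "compact K" "K \<subseteq> \<Omega>" "\<And>x. x \<notin> K \<Longrightarrow> f x = 0" and s: "smooth f"
    using assms by (auto simp: C0_infinity_def smooth_def)
  show "smooth f" by fact
  have "bounded {x. f x \<noteq> 0}"
    by (rule bounded_subset[OF compact_imp_bounded[OF K(1)]]) (use K(3) in auto)
  then show "f \<in> Cc" using smooth_continuous[OF s] by (simp add: Cc_def)
  have "partial_deriv i f x = 0" if "x \<notin> K" for x
    using grad_eq_0_open[of "- K" x f 0] K that compact_imp_closed[OF K(1)]
    by (simp add: grad_component[symmetric] open_Compl)
  then show "partial_deriv i f \<in> C0_infinity \<Omega>"
    using K smooth_partial_deriv[OF s, of i] by (auto simp: C0_infinity_def smooth_def)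
  show "x \<notin> \<Omega> \<Longrightarrow> f x = 0" using K by auto
  show "f \<in> C0_infinity UNIV" using K s by (auto simp: C0_infinity_def smooth_def)
qed

lemma C0_infinityI_closure:
  assumes "smooth f" "bounded {x. f x \<noteq> 0}" "closure {x. f x \<noteq> 0} \<subseteq> \<Omega>"
  shows "f \<in> C0_infinity \<Omega>"
proof -
  have "\<forall>x. x \<notin> closure {x. f x \<noteq> 0} \<longrightarrow> f x = 0"
    using closure_subset[of "{x. f x \<noteq> 0}"] by blast
  then show ?thesis
    using assms unfolding C0_infinity_def smooth_def compact_eq_bounded_closed
    using bounded_closure by blast
qed

lemma C0_infinity_UNIV_iff: "f \<in> C0_infinity UNIV \<longleftrightarrow> smooth f \<and> bounded {x. f x \<noteq> 0}"
  using C0_infinityI_closure[of f UNIV] C0_infinityD[of f UNIV] by (auto simp: Cc_def)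

lemma grad_Cc: "f \<in> C0_infinity \<Omega> \<Longrightarrow> grad f \<in> Cc"
proof -
  assume f: "f \<in> C0_infinity \<Omega>"
  have "bounded (\<Union>i. {x. partial_deriv i f x \<noteq> 0})"
    using C0_infinityD(2)[OF C0_infinityD(3)[OF f]] by (auto simp: Cc_def)
  moreover have "{x. grad f x \<noteq> 0} \<subseteq> (\<Union>i. {x. partial_deriv i f x \<noteq> 0})"
    by (auto simp: vec_eq_iff grad_component)
  ultimately show ?thesis
    using smooth_grad_continuous[OF C0_infinityD(1)[OF f]] by (auto simp: Cc_def intro: bounded_subset)
qed

lemma grad_eq_0_outside: "f \<in> C0_infinity \<Omega> \<Longrightarrow> x \<notin> \<Omega> \<Longrightarrow> grad f x = 0"
  by (auto simp: vec_eq_iff grad_component intro: C0_infinityD(4)[OF C0_infinityD(3)])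

lemma C0_infinity_mult:
  assumes "f \<in> C0_infinity \<Omega>" "smooth g"
  shows "(\<lambda>x. g x * f x) \<in> C0_infinity \<Omega>"
proof -
  obtain K where K: "compact K" "K \<subseteq> \<Omega>" "\<forall>x. x \<notin> K \<longrightarrow> f x = 0"
    using assms unfolding C0_infinity_def by blast
  then have "\<forall>x. x \<notin> K \<longrightarrow> g x * f x = 0" by simp
  then show ?thesis
    using K smooth_mult[OF assms(2) C0_infinityD(1)[OF assms(1)]]
    unfolding C0_infinity_def smooth_def by blast
qed

lemma C0_infinity_cmult: "f \<in> C0_infinity \<Omega> \<Longrightarrow> (\<lambda>x. c * f x) \<in> C0_infinity \<Omega>"
  by (rule C0_infinity_mult[OF _ smooth_const])

lemma C0_infinity_add:
  assumes "f \<in> C0_infinity \<Omega>" "g \<in> C0_infinity \<Omega>"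
  shows "(\<lambda>x. f x + g x) \<in> C0_infinity \<Omega>"
proof -
  obtain K L where "compact K" "K \<subseteq> \<Omega>" "\<forall>x. x \<notin> K \<longrightarrow> f x = 0"
    "compact L" "L \<subseteq> \<Omega>" "\<forall>x. x \<notin> L \<longrightarrow> g x = 0"
    using assms unfolding C0_infinity_def by blast
  then have "compact (K \<union> L)" "K \<union> L \<subseteq> \<Omega>" "\<forall>x. x \<notin> K \<union> L \<longrightarrow> f x + g x = 0" by auto
  then show ?thesis
    using smooth_add[OF C0_infinityD(1)[OF assms(1)] C0_infinityD(1)[OF assms(2)]]
    unfolding C0_infinity_def smooth_def by blast
qed

lemma C0_infinity_diff:
  "f \<in> C0_infinity \<Omega> \<Longrightarrow> g \<in> C0_infinity \<Omega> \<Longrightarrow> (\<lambda>x. f x - g x) \<in> C0_infinity \<Omega>"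
  using C0_infinity_add[of f \<Omega> "\<lambda>x. (-1) * g x"] C0_infinity_cmult[of g \<Omega> "-1"] by simp

lemma Cc_integrable:
  assumes "f \<in> Cc"
  shows "integrable lborel f" "integrable lebesgue f"
proof -
  let ?K = "closure {x. f x \<noteq> 0}"
  have "compact ?K" "continuous_on ?K f"
    using assms by (auto simp: Cc_def compact_closure intro: continuous_on_subset)
  then have "integrable lborel (\<lambda>x. indicator ?K x *\<^sub>R f x)"
    by (rule borel_integrable_compact)
  moreover have "(\<lambda>x. indicator ?K x *\<^sub>R f x) = f"
  proof
    fix x show "indicator ?K x *\<^sub>R f x = f x"
      using closure_subset[of "{x. f x \<noteq> 0}"] by (cases "f x = 0") (auto simp: indicator_def)
  qed
  ultimately show "integrable lborel f" by simp
  then show "integrable lebesgue f" by (simp add: integrable_completion)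
qed

lemma Cc_compose:
  assumes "f \<in> Cc" "continuous_on UNIV g" "g 0 = 0"
  shows "(\<lambda>x. g (f x)) \<in> Cc"
proof -
  have "bounded {x. g (f x) \<noteq> 0}"
    by (rule bounded_subset[of "{x. f x \<noteq> 0}"]) (use assms in \<open>auto simp: Cc_def\<close>)
  then show ?thesis
    using assms by (auto simp: Cc_def intro: continuous_on_compose2[of UNIV g])
qed

lemma Cc_scaleR:
  assumes "f \<in> Cc" "continuous_on UNIV g"
  shows "(\<lambda>x. f x *\<^sub>R g x) \<in> Cc"
proof -
  have "bounded {x. f x *\<^sub>R g x \<noteq> 0}"
    by (rule bounded_subset[of "{x. f x \<noteq> 0}"]) (use assms in \<open>auto simp: Cc_def\<close>)
  then show ?thesis using assms by (auto simp: Cc_def intro!: continuous_intros)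
qed

lemma Cc_bounded:
  assumes "f \<in> Cc"
  obtains M where "0 < M" "\<And>x. norm (f x) \<le> M"
proof -
  let ?K = "closure {x. f x \<noteq> 0}"
  have "compact (f ` ?K)"
    using assms by (auto simp: Cc_def compact_closure intro!: compact_continuous_image intro: continuous_on_subset)
  then obtain M where M: "\<And>y. y \<in> f ` ?K \<Longrightarrow> norm y \<le> M"
    using compact_imp_bounded bounded_iff by metis
  have "norm (f x) \<le> max M 1" for x
    using M[of "f x"] closure_subset[of "{x. f x \<noteq> 0}"] by (cases "f x = 0") auto
  then show thesis using that[of "max M 1"] by auto
qed

lemma Cc_translate:
  assumes "f \<in> Cc"
  shows "(\<lambda>x. f (x + h)) \<in> Cc"
proof -
  have "bounded ((\<lambda>x. - h + x) ` {x. f x \<noteq> 0})"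
    using assms by (intro bounded_translation) (auto simp: Cc_def)
  moreover have "{x. f (x + h) \<noteq> 0} \<subseteq> (\<lambda>x. - h + x) ` {x. f x \<noteq> 0}"
    by (force simp: image_iff)
  ultimately have "bounded {x. f (x + h) \<noteq> 0}" by (rule bounded_subset)
  then show ?thesis
    using assms by (auto simp: Cc_def intro!: continuous_on_compose2[of UNIV f] continuous_intros)
qed

lemma Cc_add:
  assumes "f \<in> Cc" "g \<in> Cc"
  shows "(\<lambda>x. f x + g x) \<in> Cc"
proof -
  have "bounded {x. f x + g x \<noteq> 0}"
    by (rule bounded_subset[of "{x. f x \<noteq> 0} \<union> {x. g x \<noteq> 0}"]) (use assms in \<open>auto simp: Cc_def\<close>)
  then show ?thesis using assms by (auto simp: Cc_def intro!: continuous_intros)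
qed

lemma Cc_minus: "f \<in> Cc \<Longrightarrow> (\<lambda>x. - f x) \<in> Cc"
  by (rule Cc_compose) (auto intro: continuous_intros)

lemma Cc_diff: "f \<in> Cc \<Longrightarrow> g \<in> Cc \<Longrightarrow> (\<lambda>x. f x - g x) \<in> Cc"
  using Cc_add[of f "\<lambda>x. - g x"] Cc_minus[of g] by simp

lemma Cc_norm_power: "f \<in> Cc \<Longrightarrow> 0 < k \<Longrightarrow> (\<lambda>x. norm (f x) ^ k) \<in> Cc"
  by (rule Cc_compose[of f "\<lambda>y. norm y ^ k"]) (auto intro!: continuous_intros)

lemma Cc_norm_powr: "f \<in> Cc \<Longrightarrow> 0 < q \<Longrightarrow> (\<lambda>x. norm (f x) powr q) \<in> Cc"
  by (rule Cc_compose[of f "\<lambda>y. norm y powr q"]) (auto intro!: continuous_intros continuous_on_powr')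

lemma Cc_power2: "(f :: _ \<Rightarrow> real) \<in> Cc \<Longrightarrow> (\<lambda>x. (f x)\<^sup>2) \<in> Cc"
  by (rule Cc_compose[of f "\<lambda>y. y\<^sup>2"]) (auto intro!: continuous_intros)

lemma Cc_borel: "f \<in> Cc \<Longrightarrow> f \<in> borel_measurable borel"
  by (auto simp: Cc_def intro: borel_measurable_continuous_onI)

lemma integral_translate:
  fixes f :: "'a::euclidean_space \<Rightarrow> 'b::euclidean_space"
  assumes "f \<in> Cc"
  shows "(LINT x|lebesgue. f (x + h)) = (LINT x|lebesgue. f x)"
proof -
  have [measurable]: "f \<in> borel_measurable borel" by (rule Cc_borel[OF assms])
  have "(LINT x|lebesgue. f x) = (LINT x|distr lborel borel ((+) h). f x)"
    by (simp add: integral_completion lborel_distr_plus)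
  also have "\<dots> = (LINT x|lborel. f (h + x))"
    by (rule integral_distr) auto
  also have "\<dots> = (LINT x|lebesgue. f (x + h))"
    by (simp add: integral_completion add.commute)
  finally show ?thesis by simp
qed

section \<open>Difference quotients, integration by parts and increments\<close>

lemma directional_quotient_tendsto:
  assumes "f differentiable (at x)"
  shows "(\<lambda>m. real (Suc m) * (f (x + h /\<^sub>R real (Suc m)) - f x)) \<longlonglongrightarrow> grad f x \<bullet> h"
proof -
  have l: "((\<lambda>t. x + t *\<^sub>R h) has_derivative (\<lambda>t. t *\<^sub>R h)) (at (0::real))"
    by (auto intro!: derivative_eq_intros)
  have "((\<lambda>t. f (x + t *\<^sub>R h)) has_derivative (\<lambda>t. grad f x \<bullet> (t *\<^sub>R h))) (at 0)"
    by (rule has_derivative_compose[OF l]) (simp add: has_derivative_grad[OF assms])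
  then have "((\<lambda>t. f (x + t *\<^sub>R h)) has_real_derivative (grad f x \<bullet> h)) (at 0)"
    by (simp add: has_field_derivative_def mult_commute_abs)
  then have "((\<lambda>t. (f (x + t *\<^sub>R h) - f x) / t) \<longlongrightarrow> grad f x \<bullet> h) (at 0)"
    by (simp add: DERIV_def)
  moreover have "filterlim (\<lambda>m. inverse (real (Suc m))) (at 0) sequentially"
    by (rule filterlim_atI[OF LIMSEQ_inverse_real_of_nat]) (auto intro!: always_eventually)
  ultimately have "(\<lambda>m. (f (x + inverse (real (Suc m)) *\<^sub>R h) - f x) / inverse (real (Suc m))) \<longlonglongrightarrow> grad f x \<bullet> h"
    by (rule filterlim_compose)
  then show ?thesis by (simp add: field_simps)
qed

lemma C0_infinity_lipschitz:
  assumes "f \<in> C0_infinity \<Omega>"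
  obtains M where "0 < M" "\<And>x y. \<bar>f x - f y\<bar> \<le> M * norm (x - y)"
proof -
  obtain M where M: "0 < M" "\<And>x. norm (grad f x) \<le> M"
    using Cc_bounded[OF grad_Cc[OF assms]] by metis
  have "norm (f x - f y) \<le> M * norm (x - y)" for x y
  proof (rule differentiable_bound[of UNIV f "\<lambda>x v. grad f x \<bullet> v"])
    fix x show "(f has_derivative (\<lambda>v. grad f x \<bullet> v)) (at x)"
      by (intro has_derivative_grad smooth_differentiable C0_infinityD(1)[OF assms])
    show "onorm (\<lambda>v. grad f x \<bullet> v) \<le> M"
    proof (rule onorm_le)
      fix v show "norm (grad f x \<bullet> v) \<le> M * norm v"
        using Cauchy_Schwarz_ineq2[of "grad f x" v] M(2)[of x] mult_right_mono[of _ M "norm v"]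
        by (metis norm_ge_zero order_trans real_norm_def)
    qed
  qed auto
  then show thesis using that M(1) by auto
qed

text \<open>Dominated convergence: by the Lipschitz bound all quotients stay in one compact
  interval, on which \<open>\<Phi>\<close> is bounded, and their supports stay in one ball. The
  general \<open>\<Phi>\<close> serves twice: the identity leads to integration by parts, the square
  to the increment estimate.\<close>

lemma difference_quotient_integral_tendsto:
  fixes f :: "real^'n \<Rightarrow> real" and \<Phi> :: "real \<Rightarrow> real"
  assumes f: "f \<in> C0_infinity UNIV" and \<Phi>: "continuous_on UNIV \<Phi>" "\<Phi> 0 = 0"
  shows "(\<lambda>m. LINT x|lebesgue. \<Phi> (real (Suc m) * (f (x + h /\<^sub>R real (Suc m)) - f x)))
           \<longlonglongrightarrow> (LINT x|lebesgue. \<Phi> (grad f x \<bullet> h))"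
proof -
  define D where "D = (\<lambda>m x. real (Suc m) * (f (x + h /\<^sub>R real (Suc m)) - f x))"
  obtain M where M: "0 < M" "\<And>x y. \<bar>f x - f y\<bar> \<le> M * norm (x - y)"
    using C0_infinity_lipschitz[OF f] by blast
  have "compact (\<Phi> ` {- (M * norm h)..M * norm h})"
    by (intro compact_continuous_image continuous_on_subset[OF \<Phi>(1)]) auto
  then obtain P where P: "\<And>t. t \<in> {- (M * norm h)..M * norm h} \<Longrightarrow> \<bar>\<Phi> t\<bar> \<le> P"
    using compact_imp_bounded bounded_iff real_norm_def by (metis imageI)
  have fc: "f \<in> Cc" by (rule C0_infinityD(2)[OF f])
  then obtain R where R: "\<And>x. f x \<noteq> 0 \<Longrightarrow> norm x \<le> R"
    by (auto simp: Cc_def bounded_iff)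
  have Dc: "(\<lambda>x. \<Phi> (D m x)) \<in> Cc" for m
    unfolding D_def
    by (intro Cc_compose[OF Cc_compose[OF Cc_diff[OF Cc_translate[OF fc] fc]], of "\<lambda>t. real (Suc m) * t"] \<Phi>)
      (auto intro!: continuous_intros)
  have gc: "(\<lambda>x. \<Phi> (grad f x \<bullet> h)) \<in> Cc"
    by (intro Cc_compose[OF Cc_compose[OF grad_Cc[OF f]], of "\<lambda>y. y \<bullet> h"] \<Phi>) (auto intro!: continuous_intros)
  have bd: "norm (\<Phi> (D m x)) \<le> P * indicator (cball 0 (R + norm h)) x" for m x
  proof (cases "x \<in> cball 0 (R + norm h)")
    case True
    have "\<bar>D m x\<bar> = real (Suc m) * \<bar>f (x + h /\<^sub>R real (Suc m)) - f x\<bar>"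
      by (simp add: D_def abs_mult)
    also have "\<dots> \<le> real (Suc m) * (M * norm (h /\<^sub>R real (Suc m)))"
      using M(2)[of "x + h /\<^sub>R real (Suc m)" x] by (intro mult_left_mono) auto
    also have "\<dots> = M * norm h" by (simp add: field_simps)
    finally show ?thesis using P[of "D m x"] True by (simp add: abs_le_iff)
  next
    case False
    have "norm (h /\<^sub>R real (Suc m)) \<le> norm h"
      by (simp add: divide_simps mult_left_le_one_le) (simp add: mult_le_cancel_left1 algebra_simps)
    moreover have "norm x \<le> norm (x + h /\<^sub>R real (Suc m)) + norm (h /\<^sub>R real (Suc m))"
      using norm_triangle_ineq4[of "x + h /\<^sub>R real (Suc m)" "h /\<^sub>R real (Suc m)"] by simp
    ultimately have "R < norm (x + h /\<^sub>R real (Suc m))" "R < norm x"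
      using False norm_ge_zero[of h] by (auto simp del: norm_ge_zero)
    then have "f (x + h /\<^sub>R real (Suc m)) = 0" "f x = 0" using R by force+
    then show ?thesis using False \<Phi>(2) by (simp add: D_def)
  qed
  have "(\<lambda>m. LINT x|lebesgue. \<Phi> (D m x)) \<longlonglongrightarrow> (LINT x|lebesgue. \<Phi> (grad f x \<bullet> h))"
  proof (rule integral_dominated_convergence[where w = "\<lambda>x. P * indicator (cball 0 (R + norm h)) x"])
    show "(\<lambda>x. \<Phi> (grad f x \<bullet> h)) \<in> borel_measurable lebesgue"
      by (rule borel_measurable_integrable[OF Cc_integrable(2)[OF gc]])
    show "(\<lambda>x. \<Phi> (D m x)) \<in> borel_measurable lebesgue" for m
      by (rule borel_measurable_integrable[OF Cc_integrable(2)[OF Dc]])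
    show "integrable lebesgue (\<lambda>x. P * indicator (cball 0 (R + norm h)) x)"
      using emeasure_lborel_cball_finite[of 0 "R + norm h"]
      by (intro integrable_mult_right integrable_real_indicator) auto
    show "AE x in lebesgue. (\<lambda>m. \<Phi> (D m x)) \<longlonglongrightarrow> \<Phi> (grad f x \<bullet> h)"
    proof (intro AE_I2)
      fix x
      have "isCont \<Phi> (grad f x \<bullet> h)" using \<Phi>(1) by (simp add: continuous_on_eq_continuous_at)
      then show "(\<lambda>m. \<Phi> (D m x)) \<longlonglongrightarrow> \<Phi> (grad f x \<bullet> h)"
        unfolding D_def
        by (rule isCont_tendsto_compose)
          (intro directional_quotient_tendsto smooth_differentiable C0_infinityD(1)[OF f])
    qed
    show "AE x in lebesgue. norm (\<Phi> (D m x)) \<le> P * indicator (cball 0 (R + norm h)) x" for m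
      using bd by blast
  qed
  then show ?thesis by (simp add: D_def)
qed

text \<open>Translation invariance makes the integral of every difference quotient vanish, and this
  passes to the limit.\<close>

lemma integral_partial_deriv:
  assumes f: "f \<in> C0_infinity UNIV"
  shows "(LINT x|lebesgue. partial_deriv i f x) = 0"
proof -
  have fc: "f \<in> Cc" by (rule C0_infinityD(2)[OF f])
  have "(LINT x|lebesgue. real (Suc m) * (f (x + axis i 1 /\<^sub>R real (Suc m)) - f x)) = 0" for m
    using integral_translate[OF fc] Cc_integrable(2)[OF fc] Cc_integrable(2)[OF Cc_translate[OF fc]]
    by (simp del: of_nat_Suc)
  then have "(\<lambda>m. 0) \<longlonglongrightarrow> (LINT x|lebesgue. grad f x \<bullet> axis i 1)"
    using difference_quotient_integral_tendsto[OF f, of "\<lambda>t. t" "axis i 1"] by simp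
  then have "(LINT x|lebesgue. grad f x \<bullet> axis i 1) = 0"
    by (simp add: LIMSEQ_const_iff)
  then show ?thesis by (simp add: inner_axis grad_component)
qed

lemma integration_by_parts:
  assumes f: "f \<in> C0_infinity UNIV" and g: "smooth g"
  shows "(LINT x|lebesgue. g x * partial_deriv i f x) = - (LINT x|lebesgue. partial_deriv i g x * f x)"
proof -
  have i1: "integrable lebesgue (\<lambda>x. g x * partial_deriv i f x)"
    by (rule Cc_integrable(2)[OF C0_infinityD(2)[OF C0_infinity_mult[OF C0_infinityD(3)[OF f] g]]])
  have i2: "integrable lebesgue (\<lambda>x. partial_deriv i g x * f x)"
    by (rule Cc_integrable(2)[OF C0_infinityD(2)[OF C0_infinity_mult[OF f smooth_partial_deriv[OF g]]]])
  have "0 = (LINT x|lebesgue. partial_deriv i (\<lambda>x. g x * f x) x)"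
    by (rule integral_partial_deriv[symmetric, OF C0_infinity_mult[OF f g]])
  also have "\<dots> = (LINT x|lebesgue. g x * partial_deriv i f x + partial_deriv i g x * f x)"
    by (simp add: partial_deriv_mult smooth_differentiable g C0_infinityD(1)[OF f])
  also have "\<dots> = (LINT x|lebesgue. g x * partial_deriv i f x) + (LINT x|lebesgue. partial_deriv i g x * f x)"
    using i1 i2 by simp
  finally show ?thesis by simp
qed

text \<open>The increment along \<open>h\<close> is telescoped into \<open>m\<close> equal steps; as \<open>m \<rightarrow> \<infinity>\<close> this needs neither Fubini nor
  a change of variables.\<close>

lemma increment_L2_bound:
  assumes f: "f \<in> C0_infinity UNIV"
  shows "(LINT x|lebesgue. (f (x + h) - f x)\<^sup>2) \<le> (norm h)\<^sup>2 * (LINT x|lebesgue. (norm (grad f x))\<^sup>2)"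
proof -
  have fc: "f \<in> Cc" by (rule C0_infinityD(2)[OF f])
  have step: "(LINT x|lebesgue. (f (x + h) - f x)\<^sup>2)
      \<le> (LINT x|lebesgue. (real (Suc m) * (f (x + h /\<^sub>R real (Suc m)) - f x))\<^sup>2)" for m
  proof -
    define n where "n = Suc m"
    define e where "e = h /\<^sub>R real n"
    define d where "d = (\<lambda>i x. f (x + real (Suc i) *\<^sub>R e) - f (x + real i *\<^sub>R e))"
    define d0 where "d0 = (\<lambda>x. (f (x + e) - f x)\<^sup>2)"
    have d0: "d0 \<in> Cc"
      unfolding d0_def by (intro Cc_power2 Cc_diff Cc_translate fc)
    have dd: "(d i x)\<^sup>2 = d0 (x + real i *\<^sub>R e)" for i x
      by (simp add: d_def d0_def algebra_simps)
    have di: "integrable lebesgue (\<lambda>x. (d i x)\<^sup>2)" for i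
      unfolding dd by (intro Cc_integrable(2) Cc_translate d0)
    have "f (x + h) - f x = (\<Sum>i<n. d i x)" for x
    proof -
      have "(\<Sum>i<n. d i x) = f (x + real n *\<^sub>R e) - f (x + real 0 *\<^sub>R e)"
        unfolding d_def by (rule sum_lessThan_telescope)
      then show ?thesis by (simp add: e_def n_def)
    qed
    \<comment> \<open>Cauchy-Schwarz for \<open>n\<close> summands costs one factor
      \<open>n\<close>. The summands are translates of one function, so their integrals agree and
      supply a second factor \<open>n\<close>; together they are the squared factor of the
      difference quotient.\<close>
    then have "(f (x + h) - f x)\<^sup>2 \<le> real n * (\<Sum>i<n. (d i x)\<^sup>2)" for x
      using sum_squared_le_sum_of_squares[of "\<lambda>i. d i x" "{..<n}"] by (simp add: mult.commute)
    then have "\<And>x. x \<in> space lebesgue \<Longrightarrow> (f (x + h) - f x)\<^sup>2 \<le> real n * (\<Sum>i<n. (d i x)\<^sup>2)"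
      by blast
    then have "(LINT x|lebesgue. (f (x + h) - f x)\<^sup>2) \<le> (LINT x|lebesgue. real n * (\<Sum>i<n. (d i x)\<^sup>2))"
    proof (intro integral_mono)
      show "integrable lebesgue (\<lambda>x. (f (x + h) - f x)\<^sup>2)"
        by (intro Cc_integrable(2) Cc_power2 Cc_diff Cc_translate fc)
      show "integrable lebesgue (\<lambda>x. real n * (\<Sum>i<n. (d i x)\<^sup>2))"
        using di by (intro integrable_mult_right Bochner_Integration.integrable_sum)
    qed
    also have "\<dots> = real n * (\<Sum>i<n. LINT x|lebesgue. (d i x)\<^sup>2)"
      using di by simp
    also have "\<dots> = (real n)\<^sup>2 * (LINT x|lebesgue. d0 x)"
      unfolding dd by (simp add: integral_translate[OF d0] power2_eq_square)
    also have "\<dots> = (LINT x|lebesgue. (real (Suc m) * (f (x + h /\<^sub>R real (Suc m)) - f x))\<^sup>2)"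
      by (simp add: d0_def n_def e_def power_mult_distrib del: of_nat_Suc)
    finally show ?thesis .
  qed
  have "(LINT x|lebesgue. (f (x + h) - f x)\<^sup>2) \<le> (LINT x|lebesgue. (grad f x \<bullet> h)\<^sup>2)"
    by (rule LIMSEQ_le_const[OF difference_quotient_integral_tendsto[OF f, of "\<lambda>t. t\<^sup>2" h]])
      (use step in \<open>auto intro!: continuous_intros\<close>)
  also have "\<dots> \<le> (LINT x|lebesgue. (norm h)\<^sup>2 * (norm (grad f x))\<^sup>2)"
  proof (rule integral_mono)
    show "integrable lebesgue (\<lambda>x. (grad f x \<bullet> h)\<^sup>2)"
      by (intro Cc_integrable(2) Cc_power2 Cc_compose[OF grad_Cc[OF f], of "\<lambda>y. y \<bullet> h"])
        (auto intro!: continuous_intros)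
    show "integrable lebesgue (\<lambda>x. (norm h)\<^sup>2 * (norm (grad f x))\<^sup>2)"
      by (intro integrable_mult_right Cc_integrable(2) Cc_norm_power grad_Cc[OF f]) auto
    show "(grad f x \<bullet> h)\<^sup>2 \<le> (norm h)\<^sup>2 * (norm (grad f x))\<^sup>2" for x
      using Cauchy_Schwarz_ineq[of "grad f x" h] by (simp add: power2_norm_eq_inner mult.commute)
  qed
  finally show ?thesis by simp
qed

section \<open>Square integrable functions\<close>

text \<open>Young's inequality, used as it stands for integrability and for the functions divided by
  their norms for the estimate. If a norm vanishes, this division is impossible, but then the
  product is zero almost everywhere.\<close>

lemma Holder_inequality:
  fixes f g :: "'a \<Rightarrow> real"
  assumes pq: "1 < p" "1 < q" "1 / p + 1 / q = 1"
    and nn: "\<And>x. 0 \<le> f x" "\<And>x. 0 \<le> g x"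
    and m: "f \<in> borel_measurable M" "g \<in> borel_measurable M"
    and int: "integrable M (\<lambda>x. f x powr p)" "integrable M (\<lambda>x. g x powr q)"
  shows "integrable M (\<lambda>x. f x * g x)"
    and "(LINT x|M. f x * g x) \<le> (LINT x|M. f x powr p) powr (1 / p) * (LINT x|M. g x powr q) powr (1 / q)"
proof -
  note [measurable] = m
  define A where "A = (LINT x|M. f x powr p)"
  define B where "B = (LINT x|M. g x powr q)"
  have A0: "0 \<le> A" and B0: "0 \<le> B" by (auto simp: A_def B_def)
  show i: "integrable M (\<lambda>x. f x * g x)"
  proof (rule Bochner_Integration.integrable_bound)
    show "integrable M (\<lambda>x. f x powr p / p + g x powr q / q)"
      using int by (intro Bochner_Integration.integrable_add integrable_divide)
    show "AE x in M. norm (f x * g x) \<le> norm (f x powr p / p + g x powr q / q)"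
      using Youngs_inequality[OF pq nn] nn pq by (intro AE_I2) (simp add: abs_of_nonneg)
  qed simp
  have zero: "(LINT x|M. f x * g x) = 0" if "A = 0 \<or> B = 0"
  proof -
    have "AE x in M. f x powr p = 0" if "A = 0"
      using that integral_nonneg_eq_0_iff_AE[OF int(1)] by (simp add: A_def)
    moreover have "AE x in M. g x powr q = 0" if "B = 0"
      using that integral_nonneg_eq_0_iff_AE[OF int(2)] by (simp add: B_def)
    ultimately have "AE x in M. f x * g x = 0"
      using that by auto
    then show ?thesis by (rule integral_eq_zero_AE)
  qed
  show "(LINT x|M. f x * g x) \<le> (LINT x|M. f x powr p) powr (1 / p) * (LINT x|M. g x powr q) powr (1 / q)"
  proof (cases "A = 0 \<or> B = 0")
    case True
    then show ?thesis using zero by simp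
  next
    case False
    define a where "a = A powr (1 / p)"
    define b where "b = B powr (1 / q)"
    have ab: "0 < a" "0 < b" using False by (auto simp: a_def b_def)
    have ap: "a powr p = A" "b powr q = B"
      using pq A0 B0 by (auto simp: a_def b_def powr_powr)
    have *: "f x * g x \<le> a * b * (f x powr p / (p * A) + g x powr q / (q * B))" for x
    proof -
      have "(f x / a) * (g x / b) \<le> (f x / a) powr p / p + (g x / b) powr q / q"
        by (rule Youngs_inequality[OF pq]) (use nn ab in auto)
      also have "\<dots> = f x powr p / (p * A) + g x powr q / (q * B)"
        using nn ab by (simp add: powr_divide ap mult.commute)
      finally show ?thesis using ab by (simp add: field_simps)
    qed
    have "(LINT x|M. f x * g x) \<le> (LINT x|M. a * b * (f x powr p / (p * A) + g x powr q / (q * B)))"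
      using int i * by (intro integral_mono integrable_mult_right Bochner_Integration.integrable_add integrable_divide)
    also have "\<dots> = a * b * (A / (p * A) + B / (q * B))"
      using int by (simp add: A_def B_def)
    also have "\<dots> = a * b"
      using False pq by simp
    finally show ?thesis by (simp add: a_def b_def A_def B_def)
  qed
qed

definition L2 :: "(real^'n \<Rightarrow> 'b::euclidean_space) set" where
  "L2 = {f \<in> borel_measurable lebesgue. integrable lebesgue (\<lambda>x. (norm (f x))\<^sup>2)}"

lemma Cc_L2: "f \<in> Cc \<Longrightarrow> f \<in> L2"
  using Cc_integrable(2)[OF Cc_norm_power[of f 2]] Cc_integrable(2)[of f]
  by (auto simp: L2_def)

lemma L2_add:
  assumes "f \<in> L2" "g \<in> L2"
  shows "(\<lambda>x. f x + g x) \<in> L2"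
proof -
  have [measurable]: "f \<in> borel_measurable lebesgue" "g \<in> borel_measurable lebesgue"
    using assms by (auto simp: L2_def)
  have "integrable lebesgue (\<lambda>x. (norm (f x + g x))\<^sup>2)"
  proof (rule Bochner_Integration.integrable_bound)
    show "integrable lebesgue (\<lambda>x. 2 * (norm (f x))\<^sup>2 + 2 * (norm (g x))\<^sup>2)"
      using assms by (auto simp: L2_def)
    have "(norm (f x + g x))\<^sup>2 \<le> 2 * (norm (f x))\<^sup>2 + 2 * (norm (g x))\<^sup>2" for x
    proof -
      have "(norm (f x + g x))\<^sup>2 \<le> (norm (f x) + norm (g x))\<^sup>2"
        by (intro power_mono norm_triangle_ineq) auto
      also have "\<dots> \<le> 2 * (norm (f x))\<^sup>2 + 2 * (norm (g x))\<^sup>2"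
        using sum_squares_bound[of "norm (f x)" "norm (g x)"] by (simp add: power2_sum)
      finally show ?thesis .
    qed
    then show "AE x in lebesgue. norm ((norm (f x + g x))\<^sup>2) \<le> norm (2 * (norm (f x))\<^sup>2 + 2 * (norm (g x))\<^sup>2)"
      by simp
  qed simp
  then show ?thesis by (simp add: L2_def)
qed

lemma L2_uminus: "f \<in> L2 \<Longrightarrow> (\<lambda>x. - f x) \<in> L2"
  by (simp add: L2_def)

lemma L2_diff: "f \<in> L2 \<Longrightarrow> g \<in> L2 \<Longrightarrow> (\<lambda>x. f x - g x) \<in> L2"
  using L2_add[of f "\<lambda>x. - g x"] L2_uminus[of g] by simp

lemma L2_indicator:
  assumes "f \<in> L2" "A \<in> sets lebesgue"
  shows "(\<lambda>x. indicator A x *\<^sub>R f x) \<in> L2"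
proof -
  have [measurable]: "f \<in> borel_measurable lebesgue" "A \<in> sets lebesgue"
    using assms by (auto simp: L2_def)
  have "integrable lebesgue (\<lambda>x. (norm (indicator A x *\<^sub>R f x))\<^sup>2)"
    by (rule Bochner_Integration.integrable_bound[of _ "\<lambda>x. (norm (f x))\<^sup>2"])
      (use assms in \<open>auto simp: L2_def indicator_def\<close>)
  then show ?thesis by (simp add: L2_def)
qed

lemma L2_inner:
  assumes "f \<in> L2" "g \<in> L2"
  shows "integrable lebesgue (\<lambda>x. f x \<bullet> g x)"
    and "\<bar>LINT x|lebesgue. f x \<bullet> g x\<bar>
      \<le> sqrt (LINT x|lebesgue. (norm (f x))\<^sup>2) * sqrt (LINT x|lebesgue. (norm (g x))\<^sup>2)"
proof -
  have m[measurable]: "f \<in> borel_measurable lebesgue" "g \<in> borel_measurable lebesgue"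
    using assms by (auto simp: L2_def)
  have int: "integrable lebesgue (\<lambda>x. (norm (f x))\<^sup>2)" "integrable lebesgue (\<lambda>x. (norm (g x))\<^sup>2)"
    using assms by (auto simp: L2_def)
  have p2: "norm y powr 2 = (norm y)\<^sup>2" for y :: 'b by simp
  have i: "integrable lebesgue (\<lambda>x. norm (f x) * norm (g x))"
    and b: "(LINT x|lebesgue. norm (f x) * norm (g x)) \<le> (LINT x|lebesgue. (norm (f x))\<^sup>2) powr (1 / 2) * (LINT x|lebesgue. (norm (g x))\<^sup>2) powr (1 / 2)"
    using Holder_inequality[of 2 2 "\<lambda>x. norm (f x)" "\<lambda>x. norm (g x)" lebesgue] int
    by (simp_all add: p2)
  show i': "integrable lebesgue (\<lambda>x. f x \<bullet> g x)"
    by (rule Bochner_Integration.integrable_bound[OF i]) (auto simp: Cauchy_Schwarz_ineq2)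
  have "\<bar>LINT x|lebesgue. f x \<bullet> g x\<bar> \<le> (LINT x|lebesgue. norm (f x \<bullet> g x))"
    using integral_norm_bound[of lebesgue "\<lambda>x. f x \<bullet> g x"] by simp
  also have "\<dots> \<le> (LINT x|lebesgue. norm (f x) * norm (g x))"
    using i' i by (intro integral_mono integrable_norm) (auto simp: Cauchy_Schwarz_ineq2)
  finally show "\<bar>LINT x|lebesgue. f x \<bullet> g x\<bar>
      \<le> sqrt (LINT x|lebesgue. (norm (f x))\<^sup>2) * sqrt (LINT x|lebesgue. (norm (g x))\<^sup>2)"
    using b by (simp add: powr_half_sqrt)
qed

lemma L2_limit_inner:
  assumes "\<And>n. s n \<in> L2" "f \<in> L2" "\<phi> \<in> L2"
    and lim: "(\<lambda>n. LINT x|lebesgue. (norm (s n x - f x))\<^sup>2) \<longlonglongrightarrow> 0"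
  shows "(\<lambda>n. LINT x|lebesgue. s n x \<bullet> \<phi> x) \<longlonglongrightarrow> (LINT x|lebesgue. f x \<bullet> \<phi> x)"
proof (rule LIM_zero_cancel, rule Lim_null_comparison)
  show "\<forall>\<^sub>F n in sequentially. norm ((LINT x|lebesgue. s n x \<bullet> \<phi> x) - (LINT x|lebesgue. f x \<bullet> \<phi> x))
      \<le> sqrt (LINT x|lebesgue. (norm (s n x - f x))\<^sup>2) * sqrt (LINT x|lebesgue. (norm (\<phi> x))\<^sup>2)"
  proof (intro always_eventually allI)
    fix n
    have "(LINT x|lebesgue. s n x \<bullet> \<phi> x) - (LINT x|lebesgue. f x \<bullet> \<phi> x) = (LINT x|lebesgue. (s n x - f x) \<bullet> \<phi> x)"
      using assms(1)[of n] assms(2,3) by (simp add: inner_diff_left L2_inner(1))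
    then show "norm ((LINT x|lebesgue. s n x \<bullet> \<phi> x) - (LINT x|lebesgue. f x \<bullet> \<phi> x))
      \<le> sqrt (LINT x|lebesgue. (norm (s n x - f x))\<^sup>2) * sqrt (LINT x|lebesgue. (norm (\<phi> x))\<^sup>2)"
      using L2_inner(2)[OF L2_diff[OF assms(1)[of n] assms(2)] assms(3)] by simp
  qed
  show "(\<lambda>n. sqrt (LINT x|lebesgue. (norm (s n x - f x))\<^sup>2) * sqrt (LINT x|lebesgue. (norm (\<phi> x))\<^sup>2)) \<longlonglongrightarrow> 0"
    using tendsto_mult_left_zero[OF tendsto_real_sqrt[OF lim, simplified]] by simp
qed

text \<open>Sigma-finiteness supplies a strictly positive function of finite integral, and its
  square root is the weight. Positivity at every point allows the weight to be divided out again in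
  \<open>L2_complete\<close>.\<close>

lemma positive_L2_weight:
  obtains w :: "real^'n \<Rightarrow> real" where "\<And>x. 0 < w x" "w \<in> L2"
proof -
  obtain h :: "real^'n \<Rightarrow> ennreal" where h: "h \<in> borel_measurable lborel" "integral\<^sup>N lborel h \<noteq> \<infinity>"
    "\<And>x. 0 < h x \<and> h x < \<infinity>"
    using sigma_finite_measure.Ex_finite_integrable_function[OF sigma_finite_lborel] by auto
  define w where "w x = sqrt (enn2real (h x))" for x
  have m: "h \<in> borel_measurable lebesgue" using h(1) by (simp add: measurable_completion)
  have sq: "(norm (w x))\<^sup>2 = enn2real (h x)" for x by (simp add: w_def)
  have "(\<integral>\<^sup>+x. ennreal (enn2real (h x)) \<partial>lebesgue) = integral\<^sup>N lborel h"
    using h(3) by (simp add: nn_integral_completion)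
  then have "integrable lebesgue (\<lambda>x. (norm (w x))\<^sup>2)"
    unfolding sq using m h(2) by (intro integrableI_nonneg) (auto simp: top.not_eq_extremum)
  moreover have "w \<in> borel_measurable lebesgue" unfolding w_def using m by measurable
  moreover have "0 < w x" for x using h(3)[of x] by (simp add: w_def enn2real_positive_iff)
  ultimately show thesis using that by (auto simp: L2_def)
qed

text \<open>Multiplication by a positive square integrable weight turns a Cauchy sequence of \<open>L\<^sup>2\<close> into one of \<open>L\<^sup>1\<close>,
  which has an almost everywhere convergent subsequence; Fatou's lemma identifies the limit.\<close>

lemma L2_complete:
  fixes s :: "nat \<Rightarrow> real^'n \<Rightarrow> 'b::euclidean_space"
  assumes s: "\<And>n. s n \<in> L2"
    and cauchy: "\<And>e. 0 < e \<Longrightarrow> \<exists>N. \<forall>m\<ge>N. \<forall>n\<ge>N. (LINT x|lebesgue. (norm (s m x - s n x))\<^sup>2) < e"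
  obtains f where "f \<in> L2" "(\<lambda>n. LINT x|lebesgue. (norm (s n x - f x))\<^sup>2) \<longlonglongrightarrow> 0"
proof -
  obtain w :: "real^'n \<Rightarrow> real" where w: "\<And>x. 0 < w x" "w \<in> L2"
    using positive_L2_weight by blast
  have [measurable]: "s n \<in> borel_measurable lebesgue" for n using s by (auto simp: L2_def)
  have [measurable]: "w \<in> borel_measurable lebesgue" using w by (auto simp: L2_def)
  define I where "I = sqrt (LINT x|lebesgue. (norm (w x))\<^sup>2)"
  have I0: "0 \<le> I" by (simp add: I_def)
  have normL2: "(\<lambda>x. norm (f x)) \<in> L2" if "f \<in> L2" for f :: "real^'n \<Rightarrow> 'b"
    using that by (auto simp: L2_def)
  have wint: "integrable lebesgue (\<lambda>x. w x * norm (f x))"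
      "(LINT x|lebesgue. w x * norm (f x)) \<le> I * sqrt (LINT x|lebesgue. (norm (f x))\<^sup>2)"
    if "f \<in> L2" for f :: "real^'n \<Rightarrow> 'b"
    using L2_inner[OF w(2) normL2[OF that]] by (auto simp: I_def)
  have 1: "integrable lebesgue (\<lambda>x. w x *\<^sub>R s n x)" for n
    by (rule Bochner_Integration.integrable_bound[OF wint(1)[OF s[of n]]])
      (use w(1) in \<open>auto simp: less_imp_le\<close>)
  have 2: "\<exists>N. \<forall>i\<ge>N. \<forall>j\<ge>N. (LINT x|lebesgue. norm (w x *\<^sub>R s i x - w x *\<^sub>R s j x)) < e" if "0 < e" for e
  proof -
    \<comment> \<open>The weighted \<open>L^1\<close> distance is at most \<open>I\<close> times the
      \<open>L^2\<close> distance, so this tolerance brings it below \<open>e\<close>; adding 1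
      keeps the divisor positive.\<close>
    obtain N where N: "\<forall>m\<ge>N. \<forall>n\<ge>N. (LINT x|lebesgue. (norm (s m x - s n x))\<^sup>2) < (e / (I + 1))\<^sup>2"
      using cauchy[of "(e / (I + 1))\<^sup>2"] \<open>0 < e\<close> I0 by auto
    have "(LINT x|lebesgue. norm (w x *\<^sub>R s i x - w x *\<^sub>R s j x)) < e" if "i \<ge> N" "j \<ge> N" for i j
    proof -
      have "norm (w x *\<^sub>R s i x - w x *\<^sub>R s j x) = w x * norm (s i x - s j x)" for x
        using w(1)[of x] by (simp add: scaleR_diff_right[symmetric])
      then have "(LINT x|lebesgue. norm (w x *\<^sub>R s i x - w x *\<^sub>R s j x))
          \<le> I * sqrt (LINT x|lebesgue. (norm (s i x - s j x))\<^sup>2)"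
        using wint(2)[OF L2_diff[OF s[of i] s[of j]]] by simp
      also have "\<dots> \<le> I * (e / (I + 1))"
        using N that \<open>0 < e\<close> I0 by (intro mult_left_mono real_le_lsqrt) (auto simp: less_imp_le)
      also have "\<dots> < e" using \<open>0 < e\<close> I0 by (simp add: field_simps)
      finally show ?thesis .
    qed
    then show ?thesis by blast
  qed
  obtain r where r: "strict_mono r" "AE x in lebesgue. Cauchy (\<lambda>i. w x *\<^sub>R s (r i) x)"
    using cauchy_L1_AE_cauchy_subseq[of lebesgue "\<lambda>n x. w x *\<^sub>R s n x", OF 1 2] by blast
  define f where "f x = lim (\<lambda>i. s (r i) x)" for x
  have fm[measurable]: "f \<in> borel_measurable lebesgue" unfolding f_def by measurable
  have conv: "AE x in lebesgue. (\<lambda>i. s (r i) x) \<longlonglongrightarrow> f x"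
    using r(2)
  proof eventually_elim
    case (elim x)
    then obtain l where "(\<lambda>i. w x *\<^sub>R s (r i) x) \<longlonglongrightarrow> l"
      by (auto simp: Cauchy_convergent_iff convergent_def)
    then have "(\<lambda>i. inverse (w x) *\<^sub>R (w x *\<^sub>R s (r i) x)) \<longlonglongrightarrow> inverse (w x) *\<^sub>R l"
      by (intro tendsto_scaleR tendsto_const)
    then have "convergent (\<lambda>i. s (r i) x)"
      using w(1)[of x] by (auto simp: convergent_def)
    then show ?case by (simp add: f_def convergent_LIMSEQ_iff)
  qed
  have key: "\<exists>N. \<forall>n\<ge>N. integrable lebesgue (\<lambda>x. (norm (s n x - f x))\<^sup>2) \<and>
      (LINT x|lebesgue. (norm (s n x - f x))\<^sup>2) \<le> e" if e: "0 < e" for e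
  proof -
    obtain N where N: "\<forall>m\<ge>N. \<forall>n\<ge>N. (LINT x|lebesgue. (norm (s m x - s n x))\<^sup>2) < e"
      using cauchy[OF e] by blast
    have "integrable lebesgue (\<lambda>x. (norm (s n x - f x))\<^sup>2) \<and>
      (LINT x|lebesgue. (norm (s n x - f x))\<^sup>2) \<le> e" if n: "n \<ge> N" for n
    proof -
      have "(\<integral>\<^sup>+x. ennreal ((norm (s n x - f x))\<^sup>2) \<partial>lebesgue)
          = (\<integral>\<^sup>+x. liminf (\<lambda>i. ennreal ((norm (s n x - s (r i) x))\<^sup>2)) \<partial>lebesgue)"
      proof (rule nn_integral_cong_AE, use conv in eventually_elim)
        case (elim x)
        have l: "(\<lambda>i. ennreal ((norm (s n x - s (r i) x))\<^sup>2)) \<longlonglongrightarrow> ennreal ((norm (s n x - f x))\<^sup>2)"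
          by (intro tendsto_ennrealI tendsto_intros elim)
        show ?case by (rule lim_imp_Liminf[OF _ l, symmetric]) simp
      qed
      also have "\<dots> \<le> liminf (\<lambda>i. \<integral>\<^sup>+x. ennreal ((norm (s n x - s (r i) x))\<^sup>2) \<partial>lebesgue)"
        by (rule nn_integral_liminf) measurable
      also have "\<dots> \<le> ennreal e"
      proof (rule Liminf_le)
        have "(\<integral>\<^sup>+x. ennreal ((norm (s n x - s (r i) x))\<^sup>2) \<partial>lebesgue) \<le> ennreal e" if "i \<ge> N" for i
        proof -
          have "r i \<ge> N" using that seq_suble[OF r(1), of i] by simp
          then have "(LINT x|lebesgue. (norm (s n x - s (r i) x))\<^sup>2) \<le> e" using N n by (simp add: less_imp_le)
          moreover have "integrable lebesgue (\<lambda>x. (norm (s n x - s (r i) x))\<^sup>2)"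
            using L2_diff[OF s[of n] s[of "r i"]] by (simp add: L2_def)
          ultimately show ?thesis by (simp add: nn_integral_eq_integral ennreal_leI)
        qed
        then show "\<forall>\<^sub>F i in sequentially. (\<integral>\<^sup>+x. ennreal ((norm (s n x - s (r i) x))\<^sup>2) \<partial>lebesgue) \<le> ennreal e"
          by (auto simp: eventually_sequentially)
      qed simp
      finally have le: "(\<integral>\<^sup>+x. ennreal ((norm (s n x - f x))\<^sup>2) \<partial>lebesgue) \<le> ennreal e" .
      have i: "integrable lebesgue (\<lambda>x. (norm (s n x - f x))\<^sup>2)"
        using le by (intro integrableI_nonneg) (auto intro: le_less_trans)
      then show ?thesis using le e by (simp add: nn_integral_eq_integral)
    qed
    then show ?thesis by blast
  qed
  obtain N where N: "integrable lebesgue (\<lambda>x. (norm (s N x - f x))\<^sup>2)"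
    using key[of 1] by auto
  then have "(\<lambda>x. s N x - f x) \<in> L2" by (simp add: L2_def)
  from L2_diff[OF s[of N] this] have "f \<in> L2" by simp
  moreover have "(\<lambda>n. LINT x|lebesgue. (norm (s n x - f x))\<^sup>2) \<longlonglongrightarrow> 0"
  proof (rule LIMSEQ_I)
    fix e :: real assume "0 < e"
    then obtain N where "\<forall>n\<ge>N. (LINT x|lebesgue. (norm (s n x - f x))\<^sup>2) \<le> e / 2"
      using key[of "e / 2"] by auto
    then show "\<exists>N. \<forall>n\<ge>N. norm ((LINT x|lebesgue. (norm (s n x - f x))\<^sup>2) - 0) < e"
      using \<open>0 < e\<close> by (intro exI[of _ N]) force
  qed
  ultimately show thesis using that by blast
qed

section \<open>Weak solutions and lower bounds by duality\<close>

lemma Lp_norm_L2: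
  fixes f :: "real^'n \<Rightarrow> 'b::euclidean_space"
  assumes "f \<in> L2" "A \<in> sets lebesgue"
  shows "Lp_norm 2 A f \<le> ennreal (sqrt (LINT x|lebesgue. (norm (f x))\<^sup>2))"
proof -
  have [measurable]: "f \<in> borel_measurable lebesgue" "A \<in> sets lebesgue"
    using assms by (auto simp: L2_def)
  have i: "integrable lebesgue (\<lambda>x. (norm (f x))\<^sup>2)" using assms by (simp add: L2_def)
  then have iA: "integrable lebesgue (\<lambda>x. indicator A x *\<^sub>R (norm (f x))\<^sup>2)"
    using integrable_mult_indicator[OF assms(2) i] by simp
  have p2: "norm (f x) powr 2 = (norm (f x))\<^sup>2" for x by simp
  have "f \<in> Lp_space 2 A"
    using iA by (simp add: Lp_space_def set_borel_measurable_def set_integrable_def p2)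
  then have "Lp_norm 2 A f = ennreal (sqrt (LINT x:A|lebesgue. (norm (f x))\<^sup>2))"
    by (simp add: Lp_norm_def p2 powr_half_sqrt set_lebesgue_integral_def)
  also have "(LINT x:A|lebesgue. (norm (f x))\<^sup>2) \<le> (LINT x|lebesgue. (norm (f x))\<^sup>2)"
    unfolding set_lebesgue_integral_def using iA i by (intro integral_mono) (auto simp: indicator_def)
  finally show ?thesis by (simp add: ennreal_leI)
qed

lemma L2_locally_integrable:
  assumes f: "f \<in> L2"
  shows "locally_integrable \<Omega> f"
proof -
  have "set_integrable lebesgue K f" if K: "compact K" for K
  proof -
    have [measurable]: "f \<in> borel_measurable lebesgue" "K \<in> sets lebesgue"
      using f K by (auto simp: L2_def compact_imp_closed borel_closed)
    have i: "integrable lebesgue (\<lambda>x. (norm (f x))\<^sup>2)" using f by (simp add: L2_def)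
    have k: "integrable lebesgue (indicat_real K)"
      using emeasure_compact_finite[OF K] K
      by (intro integrable_real_indicator) (auto simp: compact_imp_closed borel_closed)
    show ?thesis
      unfolding set_integrable_def
    proof (rule Bochner_Integration.integrable_bound)
      show "integrable lebesgue (\<lambda>x. indicator K x + (norm (f x))\<^sup>2)"
        using i k by (intro Bochner_Integration.integrable_add)
      have "norm (f x) \<le> 1 + (norm (f x))\<^sup>2" for x
        using sum_squares_bound[of 1 "norm (f x)"] norm_ge_zero[of "f x"] by (simp del: norm_ge_zero)
      then show "AE x in lebesgue. norm (indicat_real K x *\<^sub>R f x) \<le> norm (indicat_real K x + (norm (f x))\<^sup>2)"
        by (auto simp: indicator_def)
    qed measurable
  qed
  then show ?thesis by (simp add: locally_integrable_def)
qed

lemma LINT_zero_outside: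
  "(\<And>x. x \<notin> A \<Longrightarrow> f x = 0) \<Longrightarrow> (LINT x:A|M. f x) = (LINT x|M. f x)"
  unfolding set_lebesgue_integral_def
  by (intro Bochner_Integration.integral_cong) (auto simp: indicator_def)

text \<open>First-order condition at a minimum. The value at \<open>t = - D / (E + 1)\<close> is
  already negative unless \<open>D = 0\<close>; the added 1 covers \<open>E = 0\<close>.\<close>

lemma real_eq_0_if_quadratic_nonneg:
  fixes D E :: real
  assumes "\<And>t. 0 \<le> 2 * t * D + t\<^sup>2 * E" "0 \<le> E"
  shows "D = 0"
proof (rule ccontr)
  assume "D \<noteq> 0"
  define k where "k = 1 / (E + 1)"
  have k: "0 < k" "k * E = 1 - k" using assms(2) by (auto simp: k_def field_simps)
  have "2 * (- D * k) * D + (- D * k)\<^sup>2 * E = D\<^sup>2 * k * (k * E - 2)"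
    by (simp add: algebra_simps power2_eq_square)
  also have "\<dots> = D\<^sup>2 * k * - (1 + k)" using k(2) by simp
  also have "\<dots> = - (D\<^sup>2 * k * (1 + k))" by (simp only: mult_minus_right)
  also have "\<dots> < 0" using k(1) \<open>D \<noteq> 0\<close> by simp
  finally show False using assms(1)[of "- D * k"] by simp
qed

text \<open>The direct method: a minimising sequence of the Dirichlet energy is Cauchy by the parallelogram law.\<close>

lemma dirichlet_minimizing_sequence:
  fixes \<Omega> :: "(real^'n) set"
  assumes h: "h \<in> C0_infinity UNIV"
  obtains \<psi> g where "\<And>n. \<psi> n \<in> C0_infinity \<Omega>" "g \<in> L2"
    "(\<lambda>n::nat. LINT x|lebesgue. (norm (grad (\<psi> n) x - g x))\<^sup>2) \<longlonglongrightarrow> 0"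
    "\<And>e. 0 < e \<Longrightarrow> \<exists>N. \<forall>m\<ge>N. \<forall>n\<ge>N. (LINT x|lebesgue. (norm (grad (\<psi> m) x - grad (\<psi> n) x))\<^sup>2) < e"
    "\<And>\<phi>. \<phi> \<in> C0_infinity \<Omega> \<Longrightarrow>
      (LINT x|lebesgue. g x \<bullet> grad \<phi> x) = (LINT x|lebesgue. partial_deriv i h x * \<phi> x)"
proof -
  define a where "a = (\<lambda>\<phi> \<psi> :: real^'n \<Rightarrow> real. LINT x|lebesgue. grad \<phi> x \<bullet> grad \<psi> x)"
  define l where "l = (\<lambda>\<phi> :: real^'n \<Rightarrow> real. LINT x|lebesgue. partial_deriv i h x * \<phi> x)"
  define J where "J = (\<lambda>\<phi>. a \<phi> \<phi> - 2 * l \<phi>)"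
  let ?V = "C0_infinity \<Omega>"
  have gL2: "grad \<phi> \<in> L2" if "\<phi> \<in> ?V" for \<phi> by (intro Cc_L2 grad_Cc[OF that])
  have lint: "integrable lebesgue (\<lambda>x. partial_deriv i h x * \<phi> x)" if "\<phi> \<in> ?V" for \<phi>
    by (rule Cc_integrable(2)[OF C0_infinityD(2)[OF C0_infinity_mult[OF that C0_infinityD(1)[OF C0_infinityD(3)[OF h]]]]])
  have aint: "integrable lebesgue (\<lambda>x. grad \<phi> x \<bullet> grad \<psi> x)" if "\<phi> \<in> ?V" "\<psi> \<in> ?V" for \<phi> \<psi>
    using that gL2 L2_inner(1) by blast
  have sm: "smooth \<phi>" if "\<phi> \<in> ?V" for \<phi> by (rule C0_infinityD(1)[OF that])
  have a_comb: "a (\<lambda>x. s * \<phi> x + t * \<psi> x) (\<lambda>x. s * \<phi> x + t * \<psi> x) = s\<^sup>2 * a \<phi> \<phi> + 2 * s * t * a \<phi> \<psi> + t\<^sup>2 * a \<psi> \<psi>"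
    if "\<phi> \<in> ?V" "\<psi> \<in> ?V" for \<phi> \<psi> s t
  proof -
    have "a (\<lambda>x. s * \<phi> x + t * \<psi> x) (\<lambda>x. s * \<phi> x + t * \<psi> x) =
        (LINT x|lebesgue. s\<^sup>2 * (grad \<phi> x \<bullet> grad \<phi> x) + 2 * s * t * (grad \<phi> x \<bullet> grad \<psi> x) + t\<^sup>2 * (grad \<psi> x \<bullet> grad \<psi> x))"
      unfolding a_def using that sm
      by (intro Bochner_Integration.integral_cong)
        (auto simp: grad_add smooth_cmult grad_cmult inner_add inner_commute power2_eq_square algebra_simps)
    then show ?thesis using that aint by (simp add: a_def)
  qed
  have l_comb: "l (\<lambda>x. s * \<phi> x + t * \<psi> x) = s * l \<phi> + t * l \<psi>"
    if "\<phi> \<in> ?V" "\<psi> \<in> ?V" for \<phi> \<psi> s t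
  proof -
    have "l (\<lambda>x. s * \<phi> x + t * \<psi> x) =
        (LINT x|lebesgue. s * (partial_deriv i h x * \<phi> x) + t * (partial_deriv i h x * \<psi> x))"
      unfolding l_def by (intro Bochner_Integration.integral_cong) (auto simp: algebra_simps)
    then show ?thesis using that lint by (simp add: l_def)
  qed
  have V_comb: "(\<lambda>x. s * \<phi> x + t * \<psi> x) \<in> ?V" if "\<phi> \<in> ?V" "\<psi> \<in> ?V" for \<phi> \<psi> s t
    using that by (intro C0_infinity_add C0_infinity_cmult)
  have a_nonneg: "0 \<le> a \<phi> \<phi>" for \<phi> unfolding a_def by (intro integral_nonneg_AE) auto
  have a_norm: "a \<phi> \<phi> = (LINT x|lebesgue. (norm (grad \<phi> x))\<^sup>2)" for \<phi>
    by (simp add: a_def power2_norm_eq_inner)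
  define H where "H = (LINT x|lebesgue. (norm (h x))\<^sup>2)"
  have H0: "0 \<le> H" by (simp add: H_def)
  \<comment> \<open>Moving the derivative from \<open>h\<close> to \<open>\<phi>\<close> bounds
    \<open>l\<close> by the square root of the energy, so \<open>J\<close> is bounded below without
    any Poincare inequality.\<close>
  have J_lower: "- H \<le> J \<phi>" if \<phi>: "\<phi> \<in> ?V" for \<phi>
  proof -
    have pL2: "partial_deriv i \<phi> \<in> L2" by (rule Cc_L2[OF C0_infinityD(2)[OF C0_infinityD(3)[OF \<phi>]]])
    have "l \<phi> = - (LINT x|lebesgue. h x * partial_deriv i \<phi> x)"
      using integration_by_parts[OF C0_infinityD(5)[OF \<phi>] C0_infinityD(1)[OF h], of i] by (simp add: l_def)
    then have "\<bar>l \<phi>\<bar> \<le> sqrt H * sqrt (LINT x|lebesgue. (norm (partial_deriv i \<phi> x))\<^sup>2)"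
      using L2_inner(2)[OF Cc_L2[OF C0_infinityD(2)[OF h]] pL2] by (simp add: H_def)
    also have "\<dots> \<le> sqrt H * sqrt (a \<phi> \<phi>)"
    proof (intro mult_left_mono real_sqrt_le_mono)
      show "(LINT x|lebesgue. (norm (partial_deriv i \<phi> x))\<^sup>2) \<le> a \<phi> \<phi>"
        unfolding a_norm
      proof (intro integral_mono power_mono)
        show "integrable lebesgue (\<lambda>x. (norm (partial_deriv i \<phi> x))\<^sup>2)" "integrable lebesgue (\<lambda>x. (norm (grad \<phi> x))\<^sup>2)"
          using pL2 gL2[OF \<phi>] by (auto simp: L2_def)
        show "norm (partial_deriv i \<phi> x) \<le> norm (grad \<phi> x)" for x
          using component_le_norm_cart[of "grad \<phi> x" i] by (simp add: grad_component)
      qed auto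
    qed (simp add: H0)
    finally have "2 * l \<phi> \<le> 2 * sqrt H * sqrt (a \<phi> \<phi>)" by simp
    also have "\<dots> \<le> H + a \<phi> \<phi>"
      using sum_squares_bound[of "sqrt H" "sqrt (a \<phi> \<phi>)"] H0 a_nonneg[of \<phi>] by simp
    finally show ?thesis by (simp add: J_def)
  qed
  have ne: "J ` ?V \<noteq> {}"
    using compact_empty by (auto simp: C0_infinity_def intro!: exI[of _ "\<lambda>x. 0"] C_k_const)
  have bb: "bdd_below (J ` ?V)" using J_lower by (auto simp: bdd_below_def)
  define m where "m = Inf (J ` ?V)"
  have m_le: "m \<le> J \<phi>" if "\<phi> \<in> ?V" for \<phi> unfolding m_def using that bb by (intro cInf_lower) auto
  have "\<exists>\<psi>. \<psi> \<in> ?V \<and> J \<psi> < m + 1 / real (Suc n)" for n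
    using cInf_lessD[OF ne, of "m + 1 / real (Suc n)"] by (auto simp: m_def)
  then obtain \<psi> where \<psi>: "\<And>n. \<psi> n \<in> ?V" "\<And>n. J (\<psi> n) < m + 1 / real (Suc n)" by metis
  have cauchy: "\<exists>N. \<forall>j\<ge>N. \<forall>k\<ge>N. (LINT x|lebesgue. (norm (grad (\<psi> j) x - grad (\<psi> k) x))\<^sup>2) < e" if e: "0 < e" for e
  proof -
    \<comment> \<open>The squared distance will be at most
      \<open>2 * J (\<psi> j) + 2 * J (\<psi> k) - 4 * m\<close>, so an excess of
      \<open>e / 4\<close> over \<open>m\<close> in each of the two values adds up to
      \<open>e\<close>.\<close>
    obtain N where N: "inverse (real (Suc N)) < e / 4" using reals_Archimedean[of "e / 4"] e by auto
    have "(LINT x|lebesgue. (norm (grad (\<psi> j) x - grad (\<psi> k) x))\<^sup>2) < e" if jk: "j \<ge> N" "k \<ge> N" for j k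
    proof -
      have small: "J (\<psi> j) < m + e / 4" if "j \<ge> N" for j
      proof -
        have "1 / real (Suc j) \<le> 1 / real (Suc N)" using that by (simp add: frac_le)
        then show ?thesis using \<psi>(2)[of j] N by (simp add: inverse_eq_divide)
      qed
      have "(LINT x|lebesgue. (norm (grad (\<psi> j) x - grad (\<psi> k) x))\<^sup>2)
          = a (\<lambda>x. 1 * \<psi> j x + (-1) * \<psi> k x) (\<lambda>x. 1 * \<psi> j x + (-1) * \<psi> k x)"
        unfolding a_norm using sm[OF \<psi>(1)] by (simp add: grad_diff)
      \<comment> \<open>The linear parts cancel, since \<open>l\<close> at the midpoint is the mean
        of its two values.\<close>
      also have "\<dots> = 2 * J (\<psi> j) + 2 * J (\<psi> k) - 4 * J (\<lambda>x. (1/2) * \<psi> j x + (1/2) * \<psi> k x)"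
        unfolding J_def a_comb[OF \<psi>(1) \<psi>(1)] l_comb[OF \<psi>(1) \<psi>(1)]
        by (simp add: algebra_simps power2_eq_square)
      also have "\<dots> < e"
        using small[OF jk(1)] small[OF jk(2)] m_le[OF V_comb[OF \<psi>(1)[of j] \<psi>(1)[of k], of "1/2" "1/2"]] by linarith
      finally show ?thesis .
    qed
    then show ?thesis by blast
  qed
  obtain g where g: "g \<in> L2" "(\<lambda>n. LINT x|lebesgue. (norm (grad (\<psi> n) x - g x))\<^sup>2) \<longlonglongrightarrow> 0"
    using L2_complete[of "\<lambda>n. grad (\<psi> n)", OF gL2[OF \<psi>(1)] cauchy] by blast
  have weak: "(LINT x|lebesgue. g x \<bullet> grad \<phi> x) = l \<phi>" if \<phi>: "\<phi> \<in> ?V" for \<phi>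
  proof -
    let ?D = "(LINT x|lebesgue. g x \<bullet> grad \<phi> x) - l \<phi>"
    have lim: "(\<lambda>n. a (\<psi> n) \<phi>) \<longlonglongrightarrow> (LINT x|lebesgue. g x \<bullet> grad \<phi> x)"
      unfolding a_def by (rule L2_limit_inner[OF gL2[OF \<psi>(1)] g(1) gL2[OF \<phi>] g(2)])
    \<comment> \<open>Each \<open>\<psi> n\<close> misses the infimum by less than
      \<open>1 / (n + 1)\<close>, so perturbing it by \<open>t * \<phi>\<close> lowers
      \<open>J\<close> by no more than that. The slack disappears in the limit, leaving a quadratic
      in \<open>t\<close> that is nowhere negative.\<close>
    have "0 \<le> 2 * t * ?D + t\<^sup>2 * a \<phi> \<phi>" for t
    proof (rule LIMSEQ_le)
      show "(\<lambda>n. - inverse (real (Suc n))) \<longlonglongrightarrow> 0"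
        using tendsto_minus[OF LIMSEQ_inverse_real_of_nat] by simp
      show "(\<lambda>n. 2 * t * (a (\<psi> n) \<phi> - l \<phi>) + t\<^sup>2 * a \<phi> \<phi>) \<longlonglongrightarrow> 2 * t * ?D + t\<^sup>2 * a \<phi> \<phi>"
        by (intro tendsto_intros lim)
      have "- inverse (real (Suc n)) \<le> 2 * t * (a (\<psi> n) \<phi> - l \<phi>) + t\<^sup>2 * a \<phi> \<phi>" for n
      proof -
        have "m \<le> J (\<lambda>x. 1 * \<psi> n x + t * \<phi> x)" by (intro m_le V_comb \<psi>(1) \<phi>)
        also have "\<dots> = J (\<psi> n) + 2 * t * (a (\<psi> n) \<phi> - l \<phi>) + t\<^sup>2 * a \<phi> \<phi>"
          unfolding J_def a_comb[OF \<psi>(1) \<phi>] l_comb[OF \<psi>(1) \<phi>] by (simp add: algebra_simps)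
        finally show ?thesis using \<psi>(2)[of n] by (simp add: inverse_eq_divide)
      qed
      then show "\<exists>N. \<forall>n\<ge>N. - inverse (real (Suc n)) \<le> 2 * t * (a (\<psi> n) \<phi> - l \<phi>) + t\<^sup>2 * a \<phi> \<phi>" by blast
    qed
    then have "?D = 0" by (rule real_eq_0_if_quadratic_nonneg) (rule a_nonneg)
    then show ?thesis by simp
  qed
  show thesis
    by (rule that[OF \<psi>(1) g(1) g(2) cauchy]) (use weak in \<open>auto simp: l_def\<close>)
qed

text \<open>The gradients of the minimising sequence converge by themselves; the Poincare inequality
  makes the functions converge as well, which gives \<open>u\<close>. The last identity is the
  equation tested with the solution: test with \<open>\<psi> n\<close>, move the derivative off
  \<open>h\<close>, and pass to the limit.\<close>

lemma weak_solution_exists: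
  fixes \<Omega> :: "(real^'n) set"
  assumes \<Omega>: "\<Omega> \<in> sets lebesgue"
    and poincare: "\<And>\<psi>. \<psi> \<in> C0_infinity \<Omega> \<Longrightarrow>
      (LINT x|lebesgue. (\<psi> x)\<^sup>2) \<le> C * (LINT x|lebesgue. (norm (grad \<psi> x))\<^sup>2)"
    and h: "h \<in> C0_infinity UNIV"
  obtains u g where "weak_solution \<Omega> (partial_deriv i h) u g" "g \<in> L2" "\<And>x. x \<notin> \<Omega> \<Longrightarrow> g x = 0"
    "(LINT x|lebesgue. (norm (g x))\<^sup>2) = - (LINT x|lebesgue. h x * g x $ i)"
proof -
  obtain \<psi> g0 where \<psi>: "\<And>n. \<psi> n \<in> C0_infinity \<Omega>" and g0: "g0 \<in> L2"
    and lim0: "(\<lambda>n::nat. LINT x|lebesgue. (norm (grad (\<psi> n) x - g0 x))\<^sup>2) \<longlonglongrightarrow> 0"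
    and cauchy: "\<And>e. 0 < e \<Longrightarrow> \<exists>N. \<forall>m\<ge>N. \<forall>n\<ge>N. (LINT x|lebesgue. (norm (grad (\<psi> m) x - grad (\<psi> n) x))\<^sup>2) < e"
    and weak0: "\<And>\<phi>. \<phi> \<in> C0_infinity \<Omega> \<Longrightarrow>
      (LINT x|lebesgue. g0 x \<bullet> grad \<phi> x) = (LINT x|lebesgue. partial_deriv i h x * \<phi> x)"
    using dirichlet_minimizing_sequence[OF h, of \<Omega> i] by blast
  have gL2: "grad (\<psi> n) \<in> L2" for n by (intro Cc_L2 grad_Cc[OF \<psi>])
  have \<psi>L2: "\<psi> n \<in> L2" for n by (intro Cc_L2 C0_infinityD(2)[OF \<psi>])
  \<comment> \<open>The gradients in the sequence all vanish outside \<open>\<Omega>\<close>, so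
    cutting the limit off there only brings it closer to them. Integrals over
    \<open>\<Omega>\<close> may then be replaced by integrals over the whole space.\<close>
  define g where "g x = indicator \<Omega> x *\<^sub>R g0 x" for x
  have g: "g \<in> L2" unfolding g_def by (rule L2_indicator[OF g0 \<Omega>])
  have g_out: "g x = 0" if "x \<notin> \<Omega>" for x using that by (simp add: g_def)
  have lim: "(\<lambda>n. LINT x|lebesgue. (norm (grad (\<psi> n) x - g x))\<^sup>2) \<longlonglongrightarrow> 0"
  proof (rule tendsto_sandwich[OF _ _ tendsto_const lim0])
    show "\<forall>\<^sub>F n in sequentially. (LINT x|lebesgue. (norm (grad (\<psi> n) x - g x))\<^sup>2)
        \<le> (LINT x|lebesgue. (norm (grad (\<psi> n) x - g0 x))\<^sup>2)"
    proof (intro always_eventually allI integral_mono)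
      fix n
      show "integrable lebesgue (\<lambda>x. (norm (grad (\<psi> n) x - g x))\<^sup>2)"
        "integrable lebesgue (\<lambda>x. (norm (grad (\<psi> n) x - g0 x))\<^sup>2)"
        using L2_diff[OF gL2[of n] g] L2_diff[OF gL2[of n] g0] by (auto simp: L2_def)
      show "(norm (grad (\<psi> n) x - g x))\<^sup>2 \<le> (norm (grad (\<psi> n) x - g0 x))\<^sup>2" for x
        using grad_eq_0_outside[OF \<psi>[of n], of x] by (cases "x \<in> \<Omega>") (auto simp: g_def)
    qed
  qed (auto intro!: always_eventually)
  have weak: "(LINT x|lebesgue. g x \<bullet> grad \<phi> x) = (LINT x|lebesgue. partial_deriv i h x * \<phi> x)"
    if "\<phi> \<in> C0_infinity \<Omega>" for \<phi>
  proof -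
    have "g x \<bullet> grad \<phi> x = g0 x \<bullet> grad \<phi> x" for x
      using grad_eq_0_outside[OF that, of x] by (cases "x \<in> \<Omega>") (auto simp: g_def)
    then show ?thesis using weak0[OF that] by simp
  qed
  have cauchy_u: "\<exists>N. \<forall>m\<ge>N. \<forall>n\<ge>N. (LINT x|lebesgue. (norm (\<psi> m x - \<psi> n x))\<^sup>2) < e" if e: "0 < e" for e
  proof -
    obtain N where N: "\<forall>m\<ge>N. \<forall>n\<ge>N. (LINT x|lebesgue. (norm (grad (\<psi> m) x - grad (\<psi> n) x))\<^sup>2) < e / (\<bar>C\<bar> + 1)"
      using cauchy[of "e / (\<bar>C\<bar> + 1)"] e by (auto simp: divide_pos_pos add_nonneg_pos)
    have "(LINT x|lebesgue. (norm (\<psi> m x - \<psi> n x))\<^sup>2) < e" if "m \<ge> N" "n \<ge> N" for m n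
    proof -
      let ?G = "LINT x|lebesgue. (norm (grad (\<psi> m) x - grad (\<psi> n) x))\<^sup>2"
      have "(LINT x|lebesgue. (norm (\<psi> m x - \<psi> n x))\<^sup>2) \<le> C * ?G"
        using poincare[OF C0_infinity_diff[OF \<psi>[of m] \<psi>[of n]]]
        by (simp add: grad_diff C0_infinityD(1)[OF \<psi>])
      also have "\<dots> \<le> (\<bar>C\<bar> + 1) * ?G" by (intro mult_right_mono) auto
      also have "\<dots> < e" using N that by (simp add: field_simps)
      finally show ?thesis .
    qed
    then show ?thesis by blast
  qed
  obtain u where u: "u \<in> L2" "(\<lambda>n. LINT x|lebesgue. (norm (\<psi> n x - u x))\<^sup>2) \<longlonglongrightarrow> 0"
    using L2_complete[of \<psi>, OF \<psi>L2 cauchy_u] by blast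
  have "u \<in> W12_0 \<Omega>"
    unfolding W12_0_def
  proof (intro CollectI exI[of _ \<psi>] conjI allI impI)
    show "\<psi> n \<in> C0_infinity \<Omega>" for n by (rule \<psi>)
  next
    fix e :: ennreal assume "0 < e"
    then obtain e' where e': "0 < e'" "ennreal e' < e"
    proof (cases e)
      case (real r)
      then show thesis using that[of "r / 2"] \<open>0 < e\<close> by (simp add: ennreal_less_iff)
    qed (use that[of 1] in auto)
    obtain N where N: "\<forall>m\<ge>N. \<forall>n\<ge>N. (LINT x|lebesgue. (norm (grad (\<psi> m) x - grad (\<psi> n) x))\<^sup>2) < e'\<^sup>2"
      using cauchy[of "e'\<^sup>2"] e' by auto
    have "Lp_norm 2 \<Omega> (\<lambda>x. grad (\<psi> m) x - grad (\<psi> n) x) < e" if "m \<ge> N" "n \<ge> N" for m n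
    proof -
      have "Lp_norm 2 \<Omega> (\<lambda>x. grad (\<psi> m) x - grad (\<psi> n) x)
          \<le> ennreal (sqrt (LINT x|lebesgue. (norm (grad (\<psi> m) x - grad (\<psi> n) x))\<^sup>2))"
        by (rule Lp_norm_L2[OF L2_diff[OF gL2 gL2] \<Omega>])
      also have "\<dots> \<le> ennreal e'"
        using N that e' by (intro ennreal_leI real_le_lsqrt) (auto simp: less_imp_le)
      finally show ?thesis using e'(2) by simp
    qed
    then show "\<exists>N. \<forall>m\<ge>N. \<forall>n\<ge>N. Lp_norm 2 \<Omega> (\<lambda>x. grad (\<psi> m) x - grad (\<psi> n) x) < e" by blast
  next
    fix R
    have "(\<lambda>n. ennreal (sqrt (LINT x|lebesgue. (norm (\<psi> n x - u x))\<^sup>2))) \<longlonglongrightarrow> ennreal (sqrt 0)"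
      by (intro tendsto_ennrealI tendsto_real_sqrt u(2))
    then have t: "(\<lambda>n. ennreal (sqrt (LINT x|lebesgue. (norm (\<psi> n x - u x))\<^sup>2))) \<longlonglongrightarrow> 0" by simp
    show "(\<lambda>n. Lp_norm 2 (\<Omega> \<inter> ball 0 R) (\<lambda>x. \<psi> n x - u x)) \<longlonglongrightarrow> 0"
    proof (rule tendsto_sandwich[OF _ _ tendsto_const t])
      have "\<Omega> \<inter> ball 0 R \<in> sets lebesgue" using \<Omega> by (intro sets.Int) auto
      then show "\<forall>\<^sub>F n in sequentially. Lp_norm 2 (\<Omega> \<inter> ball 0 R) (\<lambda>x. \<psi> n x - u x)
          \<le> ennreal (sqrt (LINT x|lebesgue. (norm (\<psi> n x - u x))\<^sup>2))"
        by (intro always_eventually allI Lp_norm_L2 L2_diff \<psi>L2 u(1))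
    qed simp
  qed
  moreover have "weak_gradient \<Omega> u g"
    unfolding weak_gradient_def
  proof (intro conjI ballI allI)
    show "locally_integrable \<Omega> u" "locally_integrable \<Omega> g"
      using L2_locally_integrable u(1) g by blast+
    fix \<phi> j assume \<phi>: "\<phi> \<in> C0_infinity \<Omega>"
    have pL2: "partial_deriv j \<phi> \<in> L2" by (rule Cc_L2[OF C0_infinityD(2)[OF C0_infinityD(3)[OF \<phi>]]])
    have "(\<lambda>x. \<phi> x *\<^sub>R axis j (1::real)) \<in> Cc"
      by (rule Cc_scaleR[OF C0_infinityD(2)[OF \<phi>]]) (intro continuous_intros)
    then have \<phi>L2: "(\<lambda>x. \<phi> x *\<^sub>R axis j (1::real)) \<in> L2" by (rule Cc_L2)
    have "(\<lambda>n. LINT x|lebesgue. \<psi> n x \<bullet> partial_deriv j \<phi> x) \<longlonglongrightarrow> (LINT x|lebesgue. u x \<bullet> partial_deriv j \<phi> x)"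
      by (rule L2_limit_inner[OF \<psi>L2 u(1) pL2 u(2)])
    moreover have "(LINT x|lebesgue. \<psi> n x \<bullet> partial_deriv j \<phi> x) = - (LINT x|lebesgue. grad (\<psi> n) x \<bullet> (\<phi> x *\<^sub>R axis j 1))" for n
      using integration_by_parts[OF C0_infinityD(5)[OF \<phi>] C0_infinityD(1)[OF \<psi>[of n]], of j]
      by (simp add: inner_axis grad_component mult.commute)
    moreover have "(\<lambda>n. - (LINT x|lebesgue. grad (\<psi> n) x \<bullet> (\<phi> x *\<^sub>R axis j 1))) \<longlonglongrightarrow> - (LINT x|lebesgue. g x \<bullet> (\<phi> x *\<^sub>R axis j 1))"
      by (intro tendsto_minus L2_limit_inner[OF gL2 g \<phi>L2 lim])
    ultimately have "(LINT x|lebesgue. u x \<bullet> partial_deriv j \<phi> x) = - (LINT x|lebesgue. g x \<bullet> (\<phi> x *\<^sub>R axis j 1))"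
      using LIMSEQ_unique by simp
    then show "(LINT x:\<Omega>|lebesgue. u x * partial_deriv j \<phi> x) = - (LINT x:\<Omega>|lebesgue. g x $ j * \<phi> x)"
      using C0_infinityD(4)[OF \<phi>] C0_infinityD(4)[OF C0_infinityD(3)[OF \<phi>]]
      by (simp add: LINT_zero_outside inner_axis mult.commute)
  qed
  moreover have "(LINT x:\<Omega>|lebesgue. g x \<bullet> grad \<phi> x) = (LINT x:\<Omega>|lebesgue. partial_deriv i h x * \<phi> x)"
    if "\<phi> \<in> C0_infinity \<Omega>" for \<phi>
    using weak[OF that] grad_eq_0_outside[OF that] C0_infinityD(4)[OF that] by (simp add: LINT_zero_outside)
  ultimately have sol: "weak_solution \<Omega> (partial_deriv i h) u g"
    by (simp add: weak_solution_def)
  have "(\<lambda>n. LINT x|lebesgue. grad (\<psi> n) x \<bullet> g x) \<longlonglongrightarrow> (LINT x|lebesgue. g x \<bullet> g x)"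
    by (rule L2_limit_inner[OF gL2 g g lim])
  moreover have "(LINT x|lebesgue. grad (\<psi> n) x \<bullet> g x) = - (LINT x|lebesgue. grad (\<psi> n) x \<bullet> (h x *\<^sub>R axis i 1))" for n
    using weak[OF \<psi>[of n]] integration_by_parts[OF C0_infinityD(5)[OF \<psi>[of n]] C0_infinityD(1)[OF h], of i]
    by (simp add: inner_commute inner_axis inner_axis' grad_component mult.commute)
  moreover have "(\<lambda>n. - (LINT x|lebesgue. grad (\<psi> n) x \<bullet> (h x *\<^sub>R axis i 1))) \<longlonglongrightarrow> - (LINT x|lebesgue. g x \<bullet> (h x *\<^sub>R axis i 1))"
  proof (intro tendsto_minus L2_limit_inner[OF gL2 g _ lim] Cc_L2)
    show "(\<lambda>x. h x *\<^sub>R axis i (1::real)) \<in> Cc"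
      by (rule Cc_scaleR[OF C0_infinityD(2)[OF h]]) (intro continuous_intros)
  qed
  ultimately have "(LINT x|lebesgue. g x \<bullet> g x) = - (LINT x|lebesgue. g x \<bullet> (h x *\<^sub>R axis i 1))"
    using LIMSEQ_unique by simp
  then have "(LINT x|lebesgue. (norm (g x))\<^sup>2) = - (LINT x|lebesgue. h x * g x $ i)"
    by (simp add: power2_norm_eq_inner inner_axis)
  then show thesis using that[OF sol g g_out] by blast
qed

text \<open>Only \<open>g \<in> L2\<close> is known. If \<open>g\<close> is not in the Lebesgue
  space with exponent \<open>p\<close>, its norm is infinite and both bounds are trivial; otherwise
  the equation turns the integral of \<open>F * \<phi>\<close> into a pairing of \<open>g\<close>
  with \<open>grad \<phi>\<close>.\<close>

lemma solution_gradient_lower_bounds: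
  fixes \<Omega> :: "(real^'n) set"
  assumes pq: "1 < p" "1 < q" "1 / p + 1 / q = 1"
    and \<Omega>: "\<Omega> \<in> sets lebesgue"
    and sol: "weak_solution \<Omega> F u g" and g: "g \<in> L2" "\<And>x. x \<notin> \<Omega> \<Longrightarrow> g x = 0"
    and energy: "(LINT x|lebesgue. (norm (g x))\<^sup>2) = - (LINT x|lebesgue. h x * g x $ i)"
    and h: "h \<in> Cc" and \<phi>: "\<phi> \<in> C0_infinity \<Omega>"
  shows "ennreal ((LINT x|lebesgue. F x * \<phi> x) / (LINT x|lebesgue. norm (grad \<phi> x) powr q) powr (1 / q)) \<le> Lp_norm p \<Omega> g"
    and "ennreal ((LINT x|lebesgue. F x * \<phi> x)\<^sup>2 /
        ((LINT x|lebesgue. norm (h x) powr q) powr (1 / q) * (LINT x|lebesgue. (norm (grad \<phi> x))\<^sup>2))) \<le> Lp_norm p \<Omega> g"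
proof -
  define I where "I = (LINT x|lebesgue. F x * \<phi> x)"
  define Gq where "Gq = (LINT x|lebesgue. norm (grad \<phi> x) powr q) powr (1 / q)"
  define Hq where "Hq = (LINT x|lebesgue. norm (h x) powr q) powr (1 / q)"
  define E where "E = (LINT x|lebesgue. (norm (grad \<phi> x))\<^sup>2)"
  have "(LINT x:\<Omega>|lebesgue. g x \<bullet> grad \<phi> x) = (LINT x:\<Omega>|lebesgue. F x * \<phi> x)"
    using sol \<phi> by (simp add: weak_solution_def)
  then have I: "I = (LINT x|lebesgue. g x \<bullet> grad \<phi> x)"
    using LINT_zero_outside[of \<Omega> "\<lambda>x. g x \<bullet> grad \<phi> x" lebesgue] LINT_zero_outside[of \<Omega> "\<lambda>x. F x * \<phi> x" lebesgue]
      grad_eq_0_outside[OF \<phi>] C0_infinityD(4)[OF \<phi>]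
    by (simp add: I_def)
  have gm[measurable]: "g \<in> borel_measurable lebesgue" using g by (simp add: L2_def)
  have gi: "(\<lambda>x. g x $ i) \<in> borel_measurable lebesgue"
    using borel_measurable_inner[OF gm, of "\<lambda>_. axis i 1"] by (simp add: inner_axis)
  show "ennreal ((LINT x|lebesgue. F x * \<phi> x) / (LINT x|lebesgue. norm (grad \<phi> x) powr q) powr (1 / q)) \<le> Lp_norm p \<Omega> g"
    and "ennreal ((LINT x|lebesgue. F x * \<phi> x)\<^sup>2 /
        ((LINT x|lebesgue. norm (h x) powr q) powr (1 / q) * (LINT x|lebesgue. (norm (grad \<phi> x))\<^sup>2))) \<le> Lp_norm p \<Omega> g"
  proof (atomize (full), fold I_def Gq_def Hq_def E_def, cases "g \<in> Lp_space p \<Omega>")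
    case False
    then show "ennreal (I / Gq) \<le> Lp_norm p \<Omega> g \<and> ennreal (I\<^sup>2 / (Hq * E)) \<le> Lp_norm p \<Omega> g"
      by (simp add: Lp_norm_def)
  next
    case True
    define \<gamma> where "\<gamma> = (LINT x|lebesgue. norm (g x) powr p) powr (1 / p)"
    have eq: "indicator \<Omega> x *\<^sub>R norm (g x) powr p = norm (g x) powr p" for x
      using g(2)[of x] by (cases "x \<in> \<Omega>") auto
    have int: "integrable lebesgue (\<lambda>x. norm (g x) powr p)"
      using True by (simp add: Lp_space_def set_integrable_def eq del: real_scaleR_def)
    have \<gamma>: "Lp_norm p \<Omega> g = ennreal \<gamma>"
      using True by (simp add: Lp_norm_def \<gamma>_def set_lebesgue_integral_def eq del: real_scaleR_def)
    \<comment> \<open>Stated for any scalar \<open>b\<close> dominated by the product of norms, so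
      that it covers both the inner product of \<open>g\<close> with \<open>grad \<phi>\<close> and
      the product of \<open>h\<close> with one component of \<open>g\<close>.\<close>
    have dual: "\<bar>LINT x|lebesgue. b x\<bar> \<le> \<gamma> * (LINT x|lebesgue. norm (k x) powr q) powr (1 / q)"
      if k: "k \<in> Cc" and b: "b \<in> borel_measurable lebesgue" "\<And>x. \<bar>b x\<bar> \<le> norm (g x) * norm (k x)"
      for k :: "real^'n \<Rightarrow> 'c::euclidean_space" and b
    proof -
      have qint: "integrable lebesgue (\<lambda>x. norm (k x) powr q)"
        using pq by (intro Cc_integrable(2) Cc_norm_powr[OF k]) auto
      have km: "(\<lambda>x. norm (k x)) \<in> borel_measurable lebesgue"
        using Cc_integrable(2)[OF k] by measurable
      note H = Holder_inequality[OF pq _ _ _ km int qint, simplified]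
      have i1: "integrable lebesgue b"
        by (rule Bochner_Integration.integrable_bound[OF H(1)]) (use b in auto)
      have "\<bar>LINT x|lebesgue. b x\<bar> \<le> (LINT x|lebesgue. norm (g x) * norm (k x))"
        by (rule order_trans[OF integral_abs_bound integral_mono[OF integrable_abs[OF i1] H(1) b(2)]])
      also have "\<dots> \<le> \<gamma> * (LINT x|lebesgue. norm (k x) powr q) powr (1 / q)"
        using H(2) by (simp add: \<gamma>_def)
      finally show ?thesis .
    qed
    have gphi: "(\<lambda>x. g x \<bullet> grad \<phi> x) \<in> borel_measurable lebesgue"
      using L2_inner(1)[OF g(1) Cc_L2[OF grad_Cc[OF \<phi>]]] by simp
    have 1: "I \<le> \<gamma> * Gq"
      using dual[OF grad_Cc[OF \<phi>] gphi] Cauchy_Schwarz_ineq2 by (fastforce simp: I Gq_def)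
    have hm: "(\<lambda>x. h x * g x $ i) \<in> borel_measurable lebesgue"
      using Cc_integrable(2)[OF h] gi by (intro borel_measurable_times) auto
    have "\<bar>h x * g x $ i\<bar> \<le> norm (g x) * norm (h x)" for x
      using component_le_norm_cart[of "g x" i] by (simp add: abs_mult mult.commute mult_left_mono)
    then have 2: "(LINT x|lebesgue. (norm (g x))\<^sup>2) \<le> \<gamma> * Hq"
      using dual[OF h hm] by (simp add: energy Hq_def)
    have "I\<^sup>2 = \<bar>I\<bar>\<^sup>2" by simp
    also have "\<dots> \<le> (sqrt (LINT x|lebesgue. (norm (g x))\<^sup>2) * sqrt E)\<^sup>2"
      using L2_inner(2)[OF g(1) Cc_L2[OF grad_Cc[OF \<phi>]]]
      by (intro power_mono) (auto simp: I E_def)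
    also have "\<dots> = (LINT x|lebesgue. (norm (g x))\<^sup>2) * E"
      by (simp add: power_mult_distrib E_def)
    also have "\<dots> \<le> \<gamma> * Hq * E"
      using 2 by (intro mult_right_mono) (auto simp: E_def)
    finally have 3: "I\<^sup>2 \<le> \<gamma> * (Hq * E)" by (simp add: mult.assoc)
    \<comment> \<open>A zero denominator is harmless: the quotient is then 0 by convention, and
      \<open>\<gamma>\<close> is nonnegative.\<close>
    have div: "x / y \<le> \<gamma>" if "x \<le> \<gamma> * y" "0 \<le> y" for x y
      using that by (cases "y = 0") (auto simp: divide_le_eq \<gamma>_def)
    have "0 \<le> Gq" "0 \<le> Hq * E" by (auto simp: Gq_def Hq_def E_def)
    then show "ennreal (I / Gq) \<le> Lp_norm p \<Omega> g \<and> ennreal (I\<^sup>2 / (Hq * E)) \<le> Lp_norm p \<Omega> g"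
      using div[OF 1] div[OF 3] by (simp add: \<gamma> ennreal_leI)
  qed
qed

text \<open>The datum must have norm 1 on \<open>\<Omega>\<close>, so \<open>h\<close> is divided by
  the norm \<open>N\<close> of its derivative there; afterwards the exact norms are replaced by the
  given upper estimates. Enlarging denominators requires them to be positive, and this follows from
  the positive pairing of the datum with \<open>\<phi>\<close>.\<close>

lemma duality_lower_bounds:
  fixes \<Omega> :: "(real^'n) set"
  assumes pq: "1 < p" "1 < q" "1 / p + 1 / q = 1"
    and \<Omega>: "\<Omega> \<in> sets lebesgue"
    and poincare: "\<And>\<psi>. \<psi> \<in> C0_infinity \<Omega> \<Longrightarrow>
      (LINT x|lebesgue. (\<psi> x)\<^sup>2) \<le> C * (LINT x|lebesgue. (norm (grad \<psi> x))\<^sup>2)"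
    and h: "h \<in> C0_infinity UNIV" and \<phi>: "\<phi> \<in> C0_infinity \<Omega>"
    and I: "0 < I" "I \<le> (LINT x|lebesgue. partial_deriv i h x * \<phi> x)"
    and F: "(LINT x|lebesgue. norm (partial_deriv i h x) powr p) \<le> Fp"
    and G: "(LINT x|lebesgue. norm (grad \<phi> x) powr q) \<le> Gq" "0 < Gq"
    and H: "(LINT x|lebesgue. norm (h x) powr q) \<le> Hq" "0 < Hq"
    and E: "(LINT x|lebesgue. (norm (grad \<phi> x))\<^sup>2) \<le> E2" "0 < E2"
  obtains F u g where "F \<in> Lp_space p \<Omega>" "F \<in> Lp_space 2 \<Omega>" "Lp_norm p \<Omega> F = 1" "weak_solution \<Omega> F u g"
    "ennreal (I / (Fp powr (1 / p) * Gq powr (1 / q))) \<le> Lp_norm p \<Omega> g"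
    "ennreal (I\<^sup>2 / (Fp powr (1 / p) * Hq powr (1 / q) * E2)) \<le> Lp_norm p \<Omega> g"
proof -
  define F0 where "F0 = partial_deriv i h"
  have F0: "F0 \<in> Cc" unfolding F0_def by (rule C0_infinityD(2)[OF C0_infinityD(3)[OF h]])
  have [measurable]: "\<Omega> \<in> sets lebesgue" by (rule \<Omega>)
  define N where "N = (LINT x:\<Omega>|lebesgue. norm (F0 x) powr p) powr (1 / p)"
  have Fr: "(\<lambda>x. indicator \<Omega> x *\<^sub>R norm (F x) powr r) = (\<lambda>x. norm (indicator \<Omega> x *\<^sub>R F x) powr r)"
    for F :: "real^'n \<Rightarrow> real" and r by (auto simp: indicator_def)
  have mem: "F \<in> Lp_space r \<Omega>" if "F \<in> Cc" "0 < r" for F :: "real^'n \<Rightarrow> real" and r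
    using integrable_mult_indicator[OF \<Omega> Cc_integrable(2)[OF Cc_norm_powr[OF that]]]
      borel_measurable_integrable[OF integrable_mult_indicator[OF \<Omega> Cc_integrable(2)[OF that(1)]]]
    by (simp add: Lp_space_def set_integrable_def set_borel_measurable_def)
  have N_le: "N \<le> Fp powr (1 / p)"
    unfolding N_def
  proof (intro powr_mono2)
    have i: "integrable lebesgue (\<lambda>x. norm (F0 x) powr p)"
      using pq by (intro Cc_integrable(2) Cc_norm_powr F0) auto
    have "(LINT x:\<Omega>|lebesgue. norm (F0 x) powr p) \<le> (LINT x|lebesgue. norm (F0 x) powr p)"
      unfolding set_lebesgue_integral_def
      using integrable_mult_indicator[OF \<Omega> i] i by (intro integral_mono) (auto simp: indicator_def)
    then show "(LINT x:\<Omega>|lebesgue. norm (F0 x) powr p) \<le> Fp" using F by (simp add: F0_def)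
  qed (use pq in \<open>auto simp: set_lebesgue_integral_def\<close>)
  have N_pos: "0 < N"
  proof (rule ccontr)
    assume "\<not> 0 < N"
    then have z: "(LINT x:\<Omega>|lebesgue. norm (F0 x) powr p) = 0"
      by (simp add: N_def powr_eq_0_iff not_less)
    have i: "integrable lebesgue (\<lambda>x. indicator \<Omega> x *\<^sub>R norm (F0 x) powr p)"
      using mem[OF F0, of p] pq by (simp add: Lp_space_def set_integrable_def)
    have "AE x in lebesgue. indicator \<Omega> x *\<^sub>R norm (F0 x) powr p = 0"
      using z integral_nonneg_eq_0_iff_AE[OF i] by (simp add: set_lebesgue_integral_def)
    then have "AE x in lebesgue. F0 x * \<phi> x = 0"
      by eventually_elim (use C0_infinityD(4)[OF \<phi>] in \<open>auto simp: indicator_def split: if_splits\<close>)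
    then have "(LINT x|lebesgue. F0 x * \<phi> x) = 0" by (rule integral_eq_zero_AE)
    then show False using I by (simp add: F0_def)
  qed
  define h' where "h' x = inverse N * h x" for x
  have h': "h' \<in> C0_infinity UNIV" unfolding h'_def by (rule C0_infinity_cmult[OF h])
  define F where "F = partial_deriv i h'"
  have F_eq: "F x = inverse N * F0 x" for x
    using grad_cmult[OF C0_infinityD(1)[OF h], of "inverse N" x]
    unfolding F_def F0_def h'_def by (simp add: vec_eq_iff grad_component)
  obtain u g where ug: "weak_solution \<Omega> F u g" "g \<in> L2" "\<And>x. x \<notin> \<Omega> \<Longrightarrow> g x = 0"
    "(LINT x|lebesgue. (norm (g x))\<^sup>2) = - (LINT x|lebesgue. h' x * g x $ i)"
    using weak_solution_exists[OF \<Omega> poincare h', of i] unfolding F_def by blast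
  note lb = solution_gradient_lower_bounds[OF pq \<Omega> ug C0_infinityD(2)[OF h'] \<phi>]
  have Fc: "F \<in> Cc" unfolding F_def by (rule C0_infinityD(2)[OF C0_infinityD(3)[OF h']])
  define J where "J = (LINT x|lebesgue. F0 x * \<phi> x)"
  have IJ: "I \<le> J" using I by (simp add: J_def F0_def)
  have FJ: "(LINT x|lebesgue. F x * \<phi> x) = J / N"
    by (simp add: F_eq J_def mult.assoc divide_inverse mult.commute[of _ "inverse N"])
  have Np: "N powr p = (LINT x:\<Omega>|lebesgue. norm (F0 x) powr p)"
    using pq by (simp add: N_def powr_powr set_lebesgue_integral_def)
  have "(LINT x:\<Omega>|lebesgue. norm (F x) powr p) = inverse N powr p * (LINT x:\<Omega>|lebesgue. norm (F0 x) powr p)"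
    using N_pos by (simp add: F_eq abs_mult powr_mult set_lebesgue_integral_def mult.left_commute)
  also have "\<dots> = (inverse N * N) powr p"
    unfolding Np[symmetric] by (subst powr_mult) (use N_pos in auto)
  also have "\<dots> = 1" using N_pos by simp
  finally have norm1: "Lp_norm p \<Omega> F = 1"
    using mem[OF Fc, of p] pq by (simp add: Lp_norm_def)
  have Hq: "(LINT x|lebesgue. norm (h' x) powr q) powr (1 / q) \<le> Hq powr (1 / q) / N"
  proof -
    have "(LINT x|lebesgue. norm (h' x) powr q) = inverse N powr q * (LINT x|lebesgue. norm (h x) powr q)"
      using N_pos by (simp add: h'_def abs_mult powr_mult)
    also have "\<dots> \<le> inverse N powr q * Hq" using H by (intro mult_left_mono) auto
    finally have "(LINT x|lebesgue. norm (h' x) powr q) powr (1 / q) \<le> (inverse N powr q * Hq) powr (1 / q)"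
      using pq by (intro powr_mono2) auto
    also have "\<dots> = Hq powr (1 / q) / N"
      using N_pos pq H by (simp add: powr_mult powr_powr divide_inverse mult.commute)
    finally show ?thesis .
  qed
  have Jpos: "0 < J" using I(1) IJ by simp
  define Gr where "Gr = (LINT x|lebesgue. norm (grad \<phi> x) powr q) powr (1 / q)"
  define Er where "Er = (LINT x|lebesgue. (norm (grad \<phi> x))\<^sup>2)"
  define Hr where "Hr = (LINT x|lebesgue. norm (h' x) powr q) powr (1 / q)"
  have Gr: "Gr \<le> Gq powr (1 / q)"
    unfolding Gr_def using G pq by (intro powr_mono2) auto
  have grad_int: "integrable lebesgue (\<lambda>x. norm (grad \<phi> x) powr q)" "integrable lebesgue (\<lambda>x. (norm (grad \<phi> x))\<^sup>2)"
    using pq by (auto intro!: Cc_integrable(2) Cc_norm_powr Cc_norm_power grad_Cc[OF \<phi>])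
  \<comment> \<open>By the Poincare inequality a vanishing gradient would annihilate
    \<open>\<phi>\<close> and hence the pairing \<open>J\<close>.\<close>
  have grad_nz: "\<not> (AE x in lebesgue. grad \<phi> x = 0)"
  proof
    assume "AE x in lebesgue. grad \<phi> x = 0"
    then have "Er = 0"
      unfolding Er_def by (intro integral_eq_zero_AE) (auto elim: eventually_mono)
    then have "(LINT x|lebesgue. (norm (\<phi> x))\<^sup>2) = 0"
      using poincare[OF \<phi>] by (simp add: Er_def antisym)
    then have "AE x in lebesgue. \<phi> x = 0"
      using integral_nonneg_eq_0_iff_AE[OF Cc_integrable(2)[OF Cc_norm_power[OF C0_infinityD(2)[OF \<phi>], of 2]]]
      by simp
    then have "J = 0"
      unfolding J_def by (intro integral_eq_zero_AE) (auto elim: eventually_mono)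
    then show False using Jpos by simp
  qed
  have "0 < Gr"
    using integral_nonneg_eq_0_iff_AE[OF grad_int(1)] grad_nz by (auto simp: Gr_def less_le)
  have Erpos: "0 < Er"
    using integral_nonneg_eq_0_iff_AE[OF grad_int(2)] grad_nz by (auto simp: Er_def less_le)
  \<comment> \<open>Integration by parts writes the pairing with \<open>h'\<close> itself as a
    factor, so \<open>h'\<close> cannot vanish almost everywhere.\<close>
  have "0 < Hr"
  proof (rule ccontr)
    assume "\<not> 0 < Hr"
    then have "(LINT x|lebesgue. norm (h' x) powr q) = 0"
      by (simp add: Hr_def not_less)
    then have "AE x in lebesgue. h' x = 0"
      using pq integral_nonneg_eq_0_iff_AE[OF Cc_integrable(2)[OF Cc_norm_powr[OF C0_infinityD(2)[OF h'], of q]]]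
      by simp
    then have "(LINT x|lebesgue. partial_deriv i \<phi> x * h' x) = 0"
      by (intro integral_eq_zero_AE) (auto elim: eventually_mono)
    moreover have "(LINT x|lebesgue. \<phi> x * partial_deriv i h' x) = - (LINT x|lebesgue. partial_deriv i \<phi> x * h' x)"
      by (rule integration_by_parts[OF h' C0_infinityD(1)[OF \<phi>]])
    ultimately have "J / N = 0" using FJ by (simp add: F_def mult.commute)
    then show False using Jpos N_pos by simp
  qed
  have "I / (Fp powr (1 / p) * Gq powr (1 / q)) \<le> J / (N * Gr)"
    using IJ N_le N_pos Gr \<open>0 < Gr\<close> Jpos by (intro frac_le mult_mono) auto
  also have "\<dots> = (J / N) / Gr" by simp
  finally have b1: "I / (Fp powr (1 / p) * Gq powr (1 / q)) \<le> (J / N) / Gr" .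
  have HrN: "Hr \<le> Hq powr (1 / q) / N" using Hq by (simp add: Hr_def)
  have "I\<^sup>2 / (Fp powr (1 / p) * Hq powr (1 / q) * E2) \<le> J\<^sup>2 / (N * Hq powr (1 / q) * Er)"
    using IJ N_le N_pos I(1) E(1) Erpos H(2) by (intro frac_le mult_mono power_mono) (auto simp: Er_def)
  \<comment> \<open>Normalising divides the squared pairing by \<open>N\<^sup>2\<close> and the norm
    of \<open>h\<close> by \<open>N\<close>; a single \<open>N\<close> remains, just as in the first
    bound.\<close>
  also have "\<dots> = (J / N)\<^sup>2 / (Hq powr (1 / q) / N * Er)"
    using N_pos by (simp add: power2_eq_square field_simps)
  also have "\<dots> \<le> (J / N)\<^sup>2 / (Hr * Er)"
    using HrN \<open>0 < Hr\<close> Erpos by (intro divide_left_mono mult_right_mono mult_pos_pos) (auto intro: less_le_trans)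
  finally have b2: "I\<^sup>2 / (Fp powr (1 / p) * Hq powr (1 / q) * E2) \<le> (J / N)\<^sup>2 / (Hr * Er)" .
  show thesis
  proof (rule that[of F u g])
    show "F \<in> Lp_space p \<Omega>" "F \<in> Lp_space 2 \<Omega>" using mem[OF Fc] pq by auto
    show "Lp_norm p \<Omega> F = 1" by (rule norm1)
    show "weak_solution \<Omega> F u g" by (rule ug(1))
    show "ennreal (I / (Fp powr (1 / p) * Gq powr (1 / q))) \<le> Lp_norm p \<Omega> g"
      by (rule order_trans[OF ennreal_leI[OF b1] lb(1)[unfolded FJ, folded Gr_def]])
    show "ennreal (I\<^sup>2 / (Fp powr (1 / p) * Hq powr (1 / q) * E2)) \<le> Lp_norm p \<Omega> g"
      by (rule order_trans[OF ennreal_leI[OF b2] lb(2)[unfolded FJ, folded Hr_def Er_def]])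
  qed
qed

section \<open>Measurability and Poincare inequality of the perforated domain\<close>

lemma lattice_image:
  "{k :: real^'n. \<forall>i. k $ i \<in> S} = vec_lambda ` (PiE UNIV (\<lambda>_. S))"
proof (intro equalityI subsetI)
  fix k :: "real^'n" assume "k \<in> {k. \<forall>i. k $ i \<in> S}"
  then show "k \<in> vec_lambda ` (PiE UNIV (\<lambda>_. S))"
    by (intro image_eqI[of _ _ "vec_nth k"]) (auto simp: vec_nth_inverse)
qed auto

lemma countable_lattice: "countable {k :: real^'n. \<forall>i. k $ i \<in> \<int>}"
  unfolding lattice_image
  by (intro countable_image countable_PiE) (auto simp: Ints_def)

lemma perforated_domain_measurable:
  assumes "compact T"
  shows "perforated_domain T \<epsilon> \<eta> \<in> sets lebesgue"
proof -
  have "(\<lambda>y. \<epsilon> *\<^sub>R (k + \<eta> *\<^sub>R y)) ` T \<in> sets borel" for k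
    by (intro borel_closed compact_imp_closed compact_continuous_image assms continuous_intros)
  then have "(\<Union>k\<in>{k. \<forall>i. k $ i \<in> \<int>}. (\<lambda>y. \<epsilon> *\<^sub>R (k + \<eta> *\<^sub>R y)) ` T) \<in> sets borel"
    by (intro sets.countable_UN' countable_lattice) auto
  then show ?thesis by (simp add: perforated_domain_def)
qed

text \<open>Every point is within \<open>R\<close> of a lattice point
  \<open>\<epsilon> *\<^sub>R k\<close>, around which a ball of radius \<open>r\<close> lies in a
  hole. Finitely many balls of radius \<open>r\<close> cover the ball of radius \<open>R\<close>, so
  one of finitely many shifts \<open>- h\<close> moves the point into the hole, where
  \<open>\<psi>\<close> vanishes. Hence \<open>\<psi>\<close> is controlled by finitely many
  increments, and \<open>increment_L2_bound\<close> applies to each.\<close>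

lemma perforated_domain_poincare:
  fixes T :: "(real^'n) set"
  assumes "0 < c" "ball 0 c \<subseteq> T" "0 < \<epsilon>" "0 < \<eta>"
  obtains C where "\<And>\<psi>. \<psi> \<in> C0_infinity (perforated_domain T \<epsilon> \<eta>) \<Longrightarrow>
      (LINT x|lebesgue. (\<psi> x)\<^sup>2) \<le> C * (LINT x|lebesgue. (norm (grad \<psi> x))\<^sup>2)"
proof -
  define r where "r = \<epsilon> * \<eta> * c"
  have r: "0 < r" using assms by (simp add: r_def)
  \<comment> \<open>A crude radius: rounding is allowed to move each coordinate by
    \<open>\<epsilon>\<close>, and the norm is bounded by the sum over the coordinates.\<close>
  define R where "R = \<epsilon> * real CARD('n)"
  obtain J where J: "finite J" "cball 0 R \<subseteq> (\<Union>h\<in>J. ball (h :: real^'n) r)"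
    by (rule compactE_image[of "cball (0 :: real^'n) R" "cball 0 R" "\<lambda>h. ball h r"]) (use r in auto)
  have "(LINT x|lebesgue. (\<psi> x)\<^sup>2) \<le> (\<Sum>h\<in>J. (norm h)\<^sup>2) * (LINT x|lebesgue. (norm (grad \<psi> x))\<^sup>2)"
    if \<psi>: "\<psi> \<in> C0_infinity (perforated_domain T \<epsilon> \<eta>)" for \<psi>
  proof -
    have \<psi>U: "\<psi> \<in> C0_infinity UNIV" and \<psi>c: "\<psi> \<in> Cc"
      using C0_infinityD[OF \<psi>] by auto
    have hole: "\<psi> x = 0" if "\<forall>i. k $ i \<in> \<int>" "x \<in> ball (\<epsilon> *\<^sub>R k) r" for x k
    proof (rule C0_infinityD(4)[OF \<psi>])
      define y where "y = (1 / (\<epsilon> * \<eta>)) *\<^sub>R (x - \<epsilon> *\<^sub>R k)"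
      have "norm y = norm (x - \<epsilon> *\<^sub>R k) / (\<epsilon> * \<eta>)"
        using assms by (simp add: y_def)
      also have "\<dots> < c"
        using that(2) assms
        by (simp add: r_def dist_norm norm_minus_commute pos_divide_less_eq mult.commute mult.left_commute)
      finally have "norm y < c" .
      then have "y \<in> T" using assms by auto
      moreover have "x = \<epsilon> *\<^sub>R (k + \<eta> *\<^sub>R y)" using assms by (simp add: y_def scaleR_add_right)
      ultimately show "x \<notin> perforated_domain T \<epsilon> \<eta>"
        using that(1) by (auto simp: perforated_domain_def)
    qed
    have pw: "(\<psi> x)\<^sup>2 \<le> (\<Sum>h\<in>J. (\<psi> (x + - h) - \<psi> x)\<^sup>2)" for x
    proof -
      define k :: "real^'n" where "k = (\<chi> i. of_int (round (x $ i / \<epsilon>)))"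
      have "norm (x - \<epsilon> *\<^sub>R k) \<le> (\<Sum>i\<in>UNIV. \<bar>(x - \<epsilon> *\<^sub>R k) $ i\<bar>)" by (rule norm_le_l1_cart)
      also have "\<dots> \<le> (\<Sum>i\<in>(UNIV::'n set). \<epsilon>)"
      proof (rule sum_mono)
        fix i
        have "\<bar>x $ i / \<epsilon> - of_int (round (x $ i / \<epsilon>))\<bar> \<le> 1 / 2"
          using of_int_round_abs_le[of "x $ i / \<epsilon>"] by (simp add: abs_minus_commute)
        then have "\<epsilon> * \<bar>x $ i / \<epsilon> - of_int (round (x $ i / \<epsilon>))\<bar> \<le> \<epsilon>"
          using assms by (simp add: mult_left_le)
        moreover have "(x - \<epsilon> *\<^sub>R k) $ i = \<epsilon> * (x $ i / \<epsilon> - of_int (round (x $ i / \<epsilon>)))"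
          using assms by (simp add: k_def right_diff_distrib)
        then have "\<epsilon> * \<bar>x $ i / \<epsilon> - of_int (round (x $ i / \<epsilon>))\<bar> = \<bar>(x - \<epsilon> *\<^sub>R k) $ i\<bar>"
          using assms by (simp add: abs_mult)
        ultimately show "\<bar>(x - \<epsilon> *\<^sub>R k) $ i\<bar> \<le> \<epsilon>" by simp
      qed
      also have "\<dots> = R" by (simp add: R_def mult.commute)
      finally obtain h where h: "h \<in> J" "x - \<epsilon> *\<^sub>R k \<in> ball h r" using J(2) by auto
      then have "x + - h \<in> ball (\<epsilon> *\<^sub>R k) r"
        by (simp add: dist_norm norm_minus_commute algebra_simps)
      then have "\<psi> (x + - h) = 0" by (rule hole[rotated]) (simp add: k_def)
      then have "(\<psi> x)\<^sup>2 = (\<psi> (x + - h) - \<psi> x)\<^sup>2" by simp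
      also have "\<dots> \<le> (\<Sum>h\<in>J. (\<psi> (x + - h) - \<psi> x)\<^sup>2)"
        by (rule member_le_sum[OF h(1)]) (use J in auto)
      finally show ?thesis .
    qed
    have int: "integrable lebesgue (\<lambda>x. (\<psi> (x + - h) - \<psi> x)\<^sup>2)" for h
      by (intro Cc_integrable(2) Cc_power2 Cc_diff Cc_translate \<psi>c)
    have "(LINT x|lebesgue. (\<psi> x)\<^sup>2) \<le> (LINT x|lebesgue. (\<Sum>h\<in>J. (\<psi> (x + - h) - \<psi> x)\<^sup>2))"
    proof (rule integral_mono)
      show "integrable lebesgue (\<lambda>x. (\<psi> x)\<^sup>2)" by (intro Cc_integrable(2) Cc_power2 \<psi>c)
      show "integrable lebesgue (\<lambda>x. \<Sum>h\<in>J. (\<psi> (x + - h) - \<psi> x)\<^sup>2)"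
        by (intro Bochner_Integration.integrable_sum int)
    qed (rule pw)
    also have "\<dots> = (\<Sum>h\<in>J. LINT x|lebesgue. (\<psi> (x + - h) - \<psi> x)\<^sup>2)"
      by (rule Bochner_Integration.integral_sum) (rule int)
    also have "\<dots> \<le> (\<Sum>h\<in>J. (norm (- h))\<^sup>2 * (LINT x|lebesgue. (norm (grad \<psi> x))\<^sup>2))"
      by (intro sum_mono increment_L2_bound \<psi>U)
    finally show ?thesis by (simp add: sum_distrib_right)
  qed
  then show thesis using that by blast
qed

section \<open>Test functions\<close>

text \<open>A truncated coordinate function: its \<open>i\<close>-th derivative is 1 on the unit
  ball, so it provides a datum in derivative form that does not degenerate on a full ball.\<close>

definition profile :: "'n \<Rightarrow> real^'n \<Rightarrow> real" where
  "profile i x = x $ i * bump x"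

lemma smooth_component: "smooth (\<lambda>x::real^'n. x $ i)"
  by (simp add: smooth_def C_k_component)

lemma profile_C0_infinity: "profile i \<in> C0_infinity UNIV"
proof -
  have "smooth (profile i)"
    unfolding profile_def[abs_def] by (intro smooth_mult smooth_component smooth_bump)
  moreover have "bounded {x. profile i x \<noteq> 0}"
    by (rule bounded_subset[of "ball 0 2"]) (auto simp: profile_def not_less[symmetric] intro: ccontr bump_eq_0)
  ultimately show ?thesis by (simp add: C0_infinity_UNIV_iff)
qed

lemma bump_C0_infinity: "bump \<in> C0_infinity UNIV"
proof -
  have "bounded {x :: real^'a. bump x \<noteq> 0}"
    by (rule bounded_subset[of "ball 0 2"]) (auto simp: not_less[symmetric] intro: ccontr bump_eq_0)
  then show ?thesis by (simp add: C0_infinity_UNIV_iff smooth_bump)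
qed

lemma profile_eq_0: "2 \<le> norm x \<Longrightarrow> profile i x = 0"
  by (simp add: profile_def bump_eq_0)

lemma partial_profile_eq_0:
  assumes "2 < norm x"
  shows "partial_deriv i (profile i) x = 0" "grad (partial_deriv i (profile i)) x = 0"
proof -
  have op: "open (- cball (0 :: real^'a) 2)" by (intro open_Compl closed_cball)
  have 1: "partial_deriv i (profile i) y = 0" if "2 < norm y" for y
    using grad_eq_0_open[OF op, of y "profile i" 0] that
    by (simp add: grad_component[symmetric] profile_eq_0)
  then show "partial_deriv i (profile i) x = 0" using assms by simp
  show "grad (partial_deriv i (profile i)) x = 0"
    using grad_eq_0_open[OF op, of x "partial_deriv i (profile i)" 0] assms 1 by simp
qed

lemma partial_profile_eq_1:
  assumes "norm x < 1"
  shows "partial_deriv i (profile i) x = 1"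
proof -
  have "((\<lambda>x. x $ i) has_derivative (\<lambda>v. v $ i)) (at x)"
    by (rule bounded_linear_imp_has_derivative) (rule bounded_linear_vec_nth)
  then have "(profile i has_derivative (\<lambda>v. v $ i)) (at x)"
    by (rule has_derivative_transform_within_open[of _ _ _ _ "ball 0 1"])
      (use assms in \<open>auto simp: profile_def bump_eq_1\<close>)
  then show ?thesis by (simp add: partial_deriv_eqI)
qed

text \<open>One bound serves all four functions; \<open>1 \<le> A\<close> allows different powers of
  \<open>A\<close> to be merged later.\<close>

lemma profile_bounds:
  obtains A where "1 \<le> A"
    "\<And>x::real^'n. \<bar>profile i x\<bar> \<le> A" "\<And>x::real^'n. \<bar>partial_deriv i (profile i) x\<bar> \<le> A"
    "\<And>x::real^'n. norm (grad (partial_deriv i (profile i)) x) \<le> A" "\<And>x::real^'n. norm (grad bump x) \<le> A"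
proof -
  obtain A1 where A1: "0 < A1" "\<And>x::real^'n. norm (profile i x) \<le> A1"
    using Cc_bounded[OF C0_infinityD(2)[OF profile_C0_infinity]] by metis
  obtain A2 where A2: "0 < A2" "\<And>x::real^'n. norm (partial_deriv i (profile i) x) \<le> A2"
    using Cc_bounded[OF C0_infinityD(2)[OF C0_infinityD(3)[OF profile_C0_infinity]]] by metis
  obtain A3 where A3: "0 < A3" "\<And>x::real^'n. norm (grad (partial_deriv i (profile i)) x) \<le> A3"
    using Cc_bounded[OF grad_Cc[OF C0_infinityD(3)[OF profile_C0_infinity]]] by metis
  obtain A4 where A4: "0 < A4" "\<And>x::real^'n. norm (grad bump x) \<le> A4"
    using Cc_bounded[OF grad_Cc[OF bump_C0_infinity]] by metis
  show thesis
  proof (rule that[of "1 + A1 + A2 + A3 + A4"])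
    fix x :: "real^'n"
    show "\<bar>profile i x\<bar> \<le> 1 + A1 + A2 + A3 + A4" "\<bar>partial_deriv i (profile i) x\<bar> \<le> 1 + A1 + A2 + A3 + A4"
      "norm (grad (partial_deriv i (profile i)) x) \<le> 1 + A1 + A2 + A3 + A4" "norm (grad bump x) \<le> 1 + A1 + A2 + A3 + A4"
      using A1(1) A2(1) A3(1) A4(1) A1(2)[of x] A2(2)[of x] A3(2)[of x] A4(2)[of x] by simp_all
  qed (use A1 A2 A3 A4 in auto)
qed

lemma content_cball_vec:
  "0 \<le> r \<Longrightarrow> measure lborel (cball (c :: real^'n) r) = unit_ball_vol (real CARD('n)) * r ^ CARD('n)"
  using content_cball[of r c] by simp

lemma content_ball_vec:
  "0 \<le> r \<Longrightarrow> measure lborel (ball (c :: real^'n) r) = unit_ball_vol (real CARD('n)) * r ^ CARD('n)"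
  using content_ball[of r c] by simp

lemma integrable_indicator_cball: "integrable lebesgue (\<lambda>x. (a::real) * indicator (cball (c :: real^'n) r) x)"
  using emeasure_lborel_cball_finite[of c r]
  by (intro integrable_mult_right integrable_real_indicator) auto

lemma integrable_indicator_ball: "integrable lebesgue (\<lambda>x. (a::real) * indicator (ball (c :: real^'n) r) x)"
  using emeasure_lborel_ball_finite[of c r]
  by (intro integrable_mult_right integrable_real_indicator) auto

text \<open>At most one summand is nonzero, so the power of the norm is additive without any loss
  from the number of summands. This is applied to bump gradients with disjoint supports.\<close>

lemma norm_sum_powr_single:
  assumes "finite P" "0 < q" "\<And>j k. j \<in> P \<Longrightarrow> k \<in> P \<Longrightarrow> v j \<noteq> 0 \<Longrightarrow> v k \<noteq> 0 \<Longrightarrow> j = k"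
  shows "norm (\<Sum>j\<in>P. v j) powr q = (\<Sum>j\<in>P. norm (v j) powr q)"
proof (cases "\<forall>j\<in>P. v j = 0")
  case True
  then show ?thesis using assms(2) by simp
next
  case False
  then obtain j where j: "j \<in> P" "v j \<noteq> 0" by blast
  then have "v k = 0" if "k \<in> P - {j}" for k using assms(3)[of j k] that by auto
  then have "(\<Sum>k\<in>P - {j}. v k) = 0" "(\<Sum>k\<in>P - {j}. norm (v k) powr q) = 0"
    using assms(2) by simp_all
  then show ?thesis
    using j assms(1) sum.remove[of P j v] sum.remove[of P j "\<lambda>k. norm (v k) powr q"] by simp
qed

lemma powr_add_le:
  fixes a b q :: real
  assumes "0 \<le> a" "0 \<le> b" "0 < q"
  shows "(a + b) powr q \<le> 2 powr q * (a powr q + b powr q)"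
proof -
  have "(a + b) powr q \<le> (2 * max a b) powr q" using assms by (intro powr_mono2) auto
  also have "\<dots> = 2 powr q * max a b powr q" using assms by (simp add: powr_mult)
  also have "max a b powr q \<le> a powr q + b powr q" by (cases "a \<le> b") (auto simp: max_def)
  finally show ?thesis by simp
qed

text \<open>Covers two situations: dyadic bumps at lattice points, and no bumps at all. Bumps may be
  nested; only the open annuli that carry their gradients have to be disjoint. Here \<open>c\<close>
  and \<open>L\<close> are centre and size of the datum, \<open>z j\<close> and \<open>s j\<close>
  those of a bump, and \<open>w\<close> is the common weight of the bumps.\<close>

locale test_function =
  fixes i :: "'n::finite" and A :: real and c :: "real^'n" and L w :: real
    and P :: "'j set" and z :: "'j \<Rightarrow> real^'n" and s :: "'j \<Rightarrow> real" and d :: nat and V :: real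
  assumes d: "d = CARD('n)" and V: "V = unit_ball_vol (real CARD('n))"
    and A: "1 \<le> A" "\<And>x::real^'n. \<bar>profile i x\<bar> \<le> A" "\<And>x::real^'n. \<bar>partial_deriv i (profile i) x\<bar> \<le> A"
    "\<And>x::real^'n. norm (grad (partial_deriv i (profile i)) x) \<le> A" "\<And>x::real^'n. norm (grad bump x) \<le> A"
    and L: "0 < L" and w: "0 < w" and P: "finite P" and s: "\<And>j. j \<in> P \<Longrightarrow> 0 < s j"
    and disj: "\<And>j k x. j \<in> P \<Longrightarrow> k \<in> P \<Longrightarrow> norm (x - z j) \<in> {s j<..<2 * s j} \<Longrightarrow>
      norm (x - z k) \<in> {s k<..<2 * s k} \<Longrightarrow> j = k"
    and le1: "\<And>x. w * (\<Sum>j\<in>P. bump ((1 / s j) *\<^sub>R (x - z j))) \<le> 1"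
begin

text \<open>The factor \<open>L\<close> offsets the rescaling of the argument: the derivative
  \<open>rhs\<close> is of order one, while \<open>datum\<close> itself is of order
  \<open>L\<close>.\<close>

definition datum :: "real^'n \<Rightarrow> real" where
  "datum x = L * profile i ((1 / L) *\<^sub>R (x - c))"

definition rhs :: "real^'n \<Rightarrow> real" where
  "rhs x = partial_deriv i (profile i) ((1 / L) *\<^sub>R (x - c))"

definition cutoff :: "real^'n \<Rightarrow> real" where
  "cutoff x = w * (\<Sum>j\<in>P. bump ((1 / s j) *\<^sub>R (x - z j)))"

text \<open>With \<open>rhs\<close> itself as a factor, the pairing has the integrand
  \<open>rhs\<^sup>2 * (1 - cutoff)\<close>, which is nonnegative everywhere although
  \<open>rhs\<close> changes sign.\<close>

definition test :: "real^'n \<Rightarrow> real" where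
  "test x = rhs x * (1 - cutoff x)"

lemma V_pos: "0 < V" by (simp add: V)

lemma smooth_datum: "smooth datum"
  unfolding datum_def by (intro smooth_cmult smooth_affine C0_infinityD(1)[OF profile_C0_infinity])

lemma smooth_rhs: "smooth rhs"
  unfolding rhs_def by (intro smooth_affine smooth_partial_deriv C0_infinityD(1)[OF profile_C0_infinity])

lemma smooth_cutoff: "smooth cutoff"
  unfolding cutoff_def by (intro smooth_cmult smooth_sum smooth_affine smooth_bump)

lemma smooth_test: "smooth test"
  unfolding test_def by (intro smooth_mult smooth_rhs smooth_diff smooth_const smooth_cutoff)

lemma norm_scaled: "norm ((1 / L) *\<^sub>R (x - c)) = norm (x - c) / L"
  using L by simp

lemma outside:
  assumes "2 * L < norm (x - c)"
  shows "datum x = 0" "rhs x = 0" "grad rhs x = 0"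
proof -
  have "2 < norm ((1 / L) *\<^sub>R (x - c))"
    unfolding norm_scaled using assms L by (simp add: pos_less_divide_eq)
  note o = this
  show "datum x = 0" using profile_eq_0[of "(1 / L) *\<^sub>R (x - c)" i] o by (simp add: datum_def)
  show "rhs x = 0" using partial_profile_eq_0(1)[OF o] by (simp add: rhs_def)
  show "grad rhs x = 0"
    using partial_profile_eq_0(2)[OF o, of i] unfolding rhs_def[abs_def]
    by (subst grad_affine[OF smooth_partial_deriv[OF C0_infinityD(1)[OF profile_C0_infinity]]]) simp
qed

lemma datum_C0_infinity: "datum \<in> C0_infinity UNIV"
proof -
  have "bounded {x. datum x \<noteq> 0}"
    by (rule bounded_subset[of "cball c (2 * L)"])
      (auto simp: dist_norm norm_minus_commute not_less[symmetric] dest: outside)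
  then show ?thesis by (simp add: C0_infinity_UNIV_iff smooth_datum)
qed

lemma partial_datum: "partial_deriv i datum = rhs"
proof
  fix x
  have "grad datum x = L *\<^sub>R grad (\<lambda>x. profile i ((1 / L) *\<^sub>R (x - c))) x"
    unfolding datum_def[abs_def]
    by (rule grad_cmult[OF smooth_affine[OF C0_infinityD(1)[OF profile_C0_infinity]]])
  also have "\<dots> = grad (profile i) ((1 / L) *\<^sub>R (x - c))"
    using L by (subst grad_affine[OF C0_infinityD(1)[OF profile_C0_infinity]]) simp
  finally show "partial_deriv i datum x = rhs x"
    by (simp add: grad_component[symmetric] rhs_def)
qed

lemma test_bounded_support: "bounded {x. test x \<noteq> 0}"
  by (rule bounded_subset[of "cball c (2 * L)"])
    (auto simp: test_def dist_norm norm_minus_commute not_less[symmetric] dest: outside)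

lemma test_Cc: "test \<in> C0_infinity UNIV"
  by (simp add: C0_infinity_UNIV_iff smooth_test test_bounded_support)

lemma cutoff_range: "0 \<le> cutoff x" "cutoff x \<le> 1"
  using le1[of x] w by (auto simp: cutoff_def intro!: mult_nonneg_nonneg sum_nonneg bump_nonneg)

lemma rhs_le: "\<bar>rhs x\<bar> \<le> A * indicator (cball c (2 * L)) x"
  using A(3) outside(2)[of x] by (auto simp: rhs_def indicator_def dist_norm norm_minus_commute not_le)

lemma datum_le: "\<bar>datum x\<bar> \<le> L * A * indicator (cball c (2 * L)) x"
  using A(2) L outside(1)[of x]
  by (auto simp: datum_def indicator_def dist_norm norm_minus_commute not_le abs_mult)

lemma grad_rhs_le: "norm (grad rhs x) \<le> A / L * indicator (cball c (2 * L)) x"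
proof -
  have "grad rhs x = (1 / L) *\<^sub>R grad (partial_deriv i (profile i)) ((1 / L) *\<^sub>R (x - c))"
    unfolding rhs_def[abs_def]
    by (rule grad_affine[OF smooth_partial_deriv[OF C0_infinityD(1)[OF profile_C0_infinity]]])
  then have "norm (grad rhs x) \<le> A / L"
    using A(4)[of "(1 / L) *\<^sub>R (x - c)"] L by (simp add: divide_right_mono)
  then show ?thesis
    using outside(3)[of x] by (auto simp: indicator_def dist_norm norm_minus_commute not_le)
qed

text \<open>On the ball of radius \<open>L\<close> the function \<open>rhs\<close> is 1, and the
  loss caused by the cutoff is at most \<open>A\<^sup>2 * w\<close> times the total volume of the
  bump supports. The hypothesis limits this loss to half the volume of the ball.\<close>

lemma pairing_lower_bound:
  assumes small: "A\<^sup>2 * w * (\<Sum>j\<in>P. (2 * s j) ^ d) \<le> L ^ d / 2"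
  shows "V * L ^ d / 2 \<le> (LINT x|lebesgue. rhs x * test x)"
proof -
  define R where "R x = indicator (ball c L) x - A\<^sup>2 * w * (\<Sum>j\<in>P. indicator (cball (z j) (2 * s j)) x)" for x
  have i1: "integrable lebesgue (\<lambda>x. indicat_real (ball c L) x)"
    using integrable_indicator_ball[of 1] by simp
  have i2: "integrable lebesgue (\<lambda>x. indicat_real (cball (z j) (2 * s j)) x)" for j
    using integrable_indicator_cball[of 1] by simp
  have Ri: "integrable lebesgue R"
    unfolding R_def
    by (intro Bochner_Integration.integrable_diff i1 integrable_mult_right Bochner_Integration.integrable_sum i2)
  have "V * L ^ d / 2 \<le> V * L ^ d - A\<^sup>2 * w * (\<Sum>j\<in>P. V * (2 * s j) ^ d)"
    using mult_left_mono[OF small, of V] V_pos by (simp add: sum_distrib_left mult.commute mult.left_commute)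
  also have "\<dots> = (LINT x|lebesgue. R x)"
  proof -
    have "(LINT x|lebesgue. R x) = (LINT x|lebesgue. indicator (ball c L) x)
        - A\<^sup>2 * w * (LINT x|lebesgue. (\<Sum>j\<in>P. indicator (cball (z j) (2 * s j)) x))"
      unfolding R_def integral_mult_right_zero[symmetric]
      by (intro Bochner_Integration.integral_diff i1 integrable_mult_right Bochner_Integration.integrable_sum i2)
    also have "(LINT x|lebesgue. (\<Sum>j\<in>P. indicat_real (cball (z j) (2 * s j)) x))
        = (\<Sum>j\<in>P. LINT x|lebesgue. indicat_real (cball (z j) (2 * s j)) x)"
      by (intro Bochner_Integration.integral_sum i2)
    also have "(LINT x|lebesgue. indicator (ball c L) x)
        - A\<^sup>2 * w * (\<Sum>j\<in>P. LINT x|lebesgue. indicat_real (cball (z j) (2 * s j)) x)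
        = V * L ^ d - A\<^sup>2 * w * (\<Sum>j\<in>P. V * (2 * s j) ^ d)"
      using L s by (simp add: content_ball_vec d V content_cball_vec d V less_imp_le)
    finally show ?thesis by simp
  qed
  also have "\<dots> \<le> (LINT x|lebesgue. rhs x * test x)"
  proof (rule integral_mono[OF Ri])
    show "integrable lebesgue (\<lambda>x. rhs x * test x)"
      by (rule Cc_integrable(2)[OF C0_infinityD(2)[OF C0_infinity_mult[OF test_Cc smooth_rhs]]])
    fix x
    have "(rhs x)\<^sup>2 \<le> A\<^sup>2"
      using A(3) A(1) by (intro abs_le_square_iff[THEN iffD1]) (simp add: rhs_def)
    then have "(rhs x)\<^sup>2 * cutoff x \<le> A\<^sup>2 * cutoff x"
      using cutoff_range by (intro mult_right_mono)
    also have "\<dots> \<le> A\<^sup>2 * w * (\<Sum>j\<in>P. indicator (cball (z j) (2 * s j)) x)"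
    proof -
      have "bump ((1 / s j) *\<^sub>R (x - z j)) \<le> indicator (cball (z j) (2 * s j)) x" if "j \<in> P" for j
        using bump_le_1[of "(1 / s j) *\<^sub>R (x - z j)"] bump_eq_0[of "(1 / s j) *\<^sub>R (x - z j)"] s[OF that]
        by (auto simp: indicator_def dist_norm norm_minus_commute pos_le_divide_eq)
      then show ?thesis
        using w by (simp add: cutoff_def mult.assoc sum_mono mult_left_mono)
    qed
    finally have "(rhs x)\<^sup>2 * cutoff x \<le> A\<^sup>2 * w * (\<Sum>j\<in>P. indicator (cball (z j) (2 * s j)) x)" .
    moreover have "indicator (ball c L) x \<le> (rhs x)\<^sup>2"
    proof (cases "x \<in> ball c L")
      case True
      then have "norm ((1 / L) *\<^sub>R (x - c)) < 1"
        unfolding norm_scaled using L by (simp add: dist_norm norm_minus_commute)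
      then show ?thesis by (simp add: rhs_def partial_profile_eq_1 indicator_def)
    qed simp
    ultimately show "R x \<le> rhs x * test x"
      by (simp add: R_def test_def power2_eq_square algebra_simps)
  qed
  finally show ?thesis .
qed

lemma integral_powr_le:
  fixes f :: "real^'n \<Rightarrow> 'b::euclidean_space"
  assumes f: "f \<in> Cc" and b: "\<And>x. norm (f x) \<le> b * indicator (cball y r) x" and "0 \<le> b" "0 \<le> r" "0 < q"
  shows "(LINT x|lebesgue. norm (f x) powr q) \<le> b powr q * (V * r ^ d)"
proof -
  have "(LINT x|lebesgue. norm (f x) powr q) \<le> (LINT x|lebesgue. b powr q * indicator (cball y r) x)"
  proof (rule integral_mono)
    show "integrable lebesgue (\<lambda>x. norm (f x) powr q)"
      using assms by (intro Cc_integrable(2) Cc_norm_powr)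
    show "norm (f x) powr q \<le> b powr q * indicator (cball y r) x" for x
      using b[of x] assms(3-5) by (cases "x \<in> cball y r") (auto intro: powr_mono2)
  qed (rule integrable_indicator_cball)
  then show ?thesis using assms by (simp add: content_cball_vec d V)
qed

lemma rhs_norm: "0 < p \<Longrightarrow> (LINT x|lebesgue. norm (rhs x) powr p) \<le> A powr p * (V * (2 * L) ^ d)"
  using C0_infinityD(2)[OF C0_infinityD(3)[OF datum_C0_infinity, of i]] rhs_le A L
  by (intro integral_powr_le[where y = c]) (auto simp: partial_datum)

lemma datum_norm: "0 < q \<Longrightarrow> (LINT x|lebesgue. norm (datum x) powr q) \<le> (L * A) powr q * (V * (2 * L) ^ d)"
  using C0_infinityD(2)[OF datum_C0_infinity] datum_le A L
  by (intro integral_powr_le[where y = c]) auto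

text \<open>The gradient of \<open>rhs\<close> is of order \<open>1 / L\<close> on a ball of radius
  \<open>2 * L\<close>, that of the cutoff of order \<open>w / s j\<close> on the annulus of bump
  \<open>j\<close>. Integrating the powers gives one term for the datum and one for the
  \<open>q\<close>-energy of the cutoff.\<close>

lemma grad_test_norm:
  assumes q: "0 < q"
  shows "(LINT x|lebesgue. norm (grad test x) powr q)
    \<le> 2 powr q * A powr (2 * q) * (V * 2 ^ d) * (L powr - q * L ^ d + w powr q * (\<Sum>j\<in>P. s j powr - q * s j ^ d))"
proof -
  define gj where "gj j x = grad bump ((1 / s j) *\<^sub>R (x - z j))" for j x
  have gcut: "grad cutoff x = w *\<^sub>R (\<Sum>j\<in>P. (1 / s j) *\<^sub>R gj j x)" for x
    unfolding cutoff_def[abs_def] gj_def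
    by (simp add: grad_cmult grad_sum smooth_sum smooth_affine smooth_bump grad_affine)
  have gj_in: "norm (x - z j) \<in> {s j<..<2 * s j}" if "j \<in> P" "(1 / s j) *\<^sub>R gj j x \<noteq> 0" for j x
  proof -
    have "\<not> (norm ((1 / s j) *\<^sub>R (x - z j)) \<le> 1 \<or> 2 \<le> norm ((1 / s j) *\<^sub>R (x - z j)))"
      using that(2) grad_bump_eq_0[of "(1 / s j) *\<^sub>R (x - z j)"] by (auto simp: gj_def)
    then show ?thesis using s[OF that(1)] by (auto simp: pos_divide_le_eq pos_le_divide_eq)
  qed
  \<comment> \<open>Disjoint annuli: at each point at most one bump has a nonzero gradient. This is
    what makes averaging over scales profitable.\<close>
  have sing: "norm (\<Sum>j\<in>P. (1 / s j) *\<^sub>R gj j x) powr q = (\<Sum>j\<in>P. norm ((1 / s j) *\<^sub>R gj j x) powr q)" for x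
    using gj_in disj by (intro norm_sum_powr_single P q) blast
  have gj_le: "norm ((1 / s j) *\<^sub>R gj j x) powr q \<le> A powr q * s j powr - q * indicator (cball (z j) (2 * s j)) x"
    if "j \<in> P" for j x
  proof (cases "(1 / s j) *\<^sub>R gj j x = 0")
    case True
    then show ?thesis using q A by (simp only: norm_zero) (simp add: indicator_def)
  next
    case False
    have "norm ((1 / s j) *\<^sub>R gj j x) \<le> A / s j"
      using A(5) s[OF that] by (simp add: gj_def divide_right_mono)
    then have "norm ((1 / s j) *\<^sub>R gj j x) powr q \<le> (A / s j) powr q"
      using q by (intro powr_mono2) auto
    also have "\<dots> = A powr q * s j powr - q"
      using A s[OF that] by (simp add: powr_divide powr_minus_divide)
    finally show ?thesis
      using gj_in[OF that False] by (simp add: indicator_def dist_norm norm_minus_commute)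
  qed
  define R where "R x = 2 powr q * (A powr (2 * q) * L powr - q * indicator (cball c (2 * L)) x
      + (\<Sum>j\<in>P. A powr (2 * q) * w powr q * s j powr - q * indicator (cball (z j) (2 * s j)) x))" for x
  have Ri: "integrable lebesgue R"
    unfolding R_def
    by (intro Bochner_Integration.integrable_add integrable_mult_right
        Bochner_Integration.integrable_sum integrable_indicator_cball)
  have A2q: "A powr (2 * q) = A powr q * A powr q" by (simp add: powr_add[symmetric])
  have A1q: "1 \<le> A powr q" using A(1) q by (simp add: ge_one_powr_ge_zero)
  have pw: "norm (grad test x) powr q \<le> R x" for x
  proof -
    have "grad test x = rhs x *\<^sub>R grad (\<lambda>x. 1 - cutoff x) x + (1 - cutoff x) *\<^sub>R grad rhs x"
      unfolding test_def[abs_def] by (intro grad_mult smooth_rhs smooth_diff smooth_const smooth_cutoff)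
    also have "grad (\<lambda>x. 1 - cutoff x) x = - grad cutoff x"
      by (simp add: grad_diff smooth_const smooth_cutoff grad_const)
    finally have "norm (grad test x) \<le> \<bar>rhs x\<bar> * norm (grad cutoff x) + \<bar>1 - cutoff x\<bar> * norm (grad rhs x)"
      using norm_triangle_ineq[of "rhs x *\<^sub>R - grad cutoff x" "(1 - cutoff x) *\<^sub>R grad rhs x"] by simp
    also have "\<dots> \<le> A * norm (grad cutoff x) + 1 * (A / L * indicator (cball c (2 * L)) x)"
    proof (intro add_mono mult_mono grad_rhs_le)
      show "\<bar>rhs x\<bar> \<le> A" using A(3) by (simp add: rhs_def)
    qed (use cutoff_range[of x] A(1) in auto)
    finally have "norm (grad test x) \<le> A / L * indicator (cball c (2 * L)) x + A * norm (grad cutoff x)" by simp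
    then have "norm (grad test x) powr q \<le> (A / L * indicator (cball c (2 * L)) x + A * norm (grad cutoff x)) powr q"
      using q by (intro powr_mono2) auto
    also have "\<dots> \<le> 2 powr q * ((A / L * indicator (cball c (2 * L)) x) powr q + (A * norm (grad cutoff x)) powr q)"
      using A(1) L q by (intro powr_add_le) auto
    also have "\<dots> \<le> R x"
      unfolding R_def
    proof (intro mult_left_mono add_mono)
      have "(A / L * indicator (cball c (2 * L)) x) powr q = A powr q * L powr - q * indicator (cball c (2 * L)) x"
        using A(1) L q by (auto simp: indicator_def powr_divide powr_minus_divide)
      also have "\<dots> \<le> A powr (2 * q) * L powr - q * indicator (cball c (2 * L)) x"
        unfolding A2q using A1q by (intro mult_right_mono) (auto simp: mult_le_cancel_right1)
      finally show "(A / L * indicator (cball c (2 * L)) x) powr q \<le> A powr (2 * q) * L powr - q * indicator (cball c (2 * L)) x" .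
      have "(A * norm (grad cutoff x)) powr q = A powr q * w powr q * (\<Sum>j\<in>P. norm ((1 / s j) *\<^sub>R gj j x) powr q)"
        unfolding gcut sing[symmetric] using A(1) w by (simp add: powr_mult)
      also have "\<dots> \<le> A powr q * w powr q * (\<Sum>j\<in>P. A powr q * s j powr - q * indicator (cball (z j) (2 * s j)) x)"
        by (intro mult_left_mono sum_mono gj_le) auto
      also have "\<dots> = (\<Sum>j\<in>P. A powr (2 * q) * w powr q * s j powr - q * indicator (cball (z j) (2 * s j)) x)"
        unfolding A2q sum_distrib_left by (simp add: ac_simps)
      finally show "(A * norm (grad cutoff x)) powr q
          \<le> (\<Sum>j\<in>P. A powr (2 * q) * w powr q * s j powr - q * indicator (cball (z j) (2 * s j)) x)" .
    qed simp
    finally show ?thesis .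
  qed
  have "(LINT x|lebesgue. norm (grad test x) powr q) \<le> (LINT x|lebesgue. R x)"
    using q by (intro integral_mono Ri pw Cc_integrable(2) Cc_norm_powr grad_Cc[OF test_Cc])
  also have "\<dots> = 2 powr q * (A powr (2 * q) * L powr - q * (V * (2 * L) ^ d)
      + (\<Sum>j\<in>P. A powr (2 * q) * w powr q * s j powr - q * (V * (2 * s j) ^ d)))"
  proof -
    have "(LINT x|lebesgue. R x) = 2 powr q * ((LINT x|lebesgue. A powr (2 * q) * L powr - q * indicator (cball c (2 * L)) x)
      + (\<Sum>j\<in>P. LINT x|lebesgue. A powr (2 * q) * w powr q * s j powr - q * indicator (cball (z j) (2 * s j)) x))"
      unfolding R_def integral_mult_right_zero
      by (subst Bochner_Integration.integral_add, rule integrable_indicator_cball,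
          intro Bochner_Integration.integrable_sum integrable_indicator_cball,
          subst Bochner_Integration.integral_sum, rule integrable_indicator_cball) simp
    then show ?thesis using L s by (simp add: content_cball_vec d V less_imp_le)
  qed
  also have "\<dots> = 2 powr q * A powr (2 * q) * (V * 2 ^ d) * (L powr - q * L ^ d + w powr q * (\<Sum>j\<in>P. s j powr - q * s j ^ d))"
    by (simp add: power_mult_distrib sum_distrib_left distrib_left ac_simps)
  finally show ?thesis .
qed

text \<open>Here \<open>\<sigma>\<close> and \<open>\<tau>\<close> are the energy densities of the
  cutoff for the exponents \<open>q\<close> and 2, relative to the volume \<open>L ^ d\<close>. The
  choice of \<open>L\<close> is still open.\<close>

lemma lower_bounds:
  assumes pq: "1 < p" "1 < q" "1 / p + 1 / q = 1"
    and \<Omega>: "\<Omega> \<in> sets lebesgue"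
    and poincare: "\<And>\<psi>. \<psi> \<in> C0_infinity \<Omega> \<Longrightarrow>
      (LINT x|lebesgue. (\<psi> x)\<^sup>2) \<le> C * (LINT x|lebesgue. (norm (grad \<psi> x))\<^sup>2)"
    and test: "test \<in> C0_infinity \<Omega>"
    and small: "A\<^sup>2 * w * (\<Sum>j\<in>P. (2 * s j) ^ d) \<le> L ^ d / 2"
    and \<sigma>: "w powr q * (\<Sum>j\<in>P. s j powr - q * s j ^ d) \<le> \<sigma> * L ^ d"
    and \<tau>: "w powr 2 * (\<Sum>j\<in>P. s j powr - 2 * s j ^ d) \<le> \<tau> * L ^ d"
  obtains F u g where "F \<in> Lp_space p \<Omega>" "F \<in> Lp_space 2 \<Omega>" "Lp_norm p \<Omega> F = 1" "weak_solution \<Omega> F u g"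
    "ennreal (1 / (4 * A ^ 3 * 2 ^ d) * (L powr - q + \<sigma>) powr (- 1 / q)) \<le> Lp_norm p \<Omega> g"
    "ennreal (1 / (16 * A ^ 6 * 4 ^ d) / (L * (L powr - 2 + \<tau>))) \<le> Lp_norm p \<Omega> g"
proof -
  define W where "W = V * (2 * L) ^ d"
  have W: "0 < W" using V_pos L by (simp add: W_def)
  have sum0: "0 \<le> w powr r * (\<Sum>j\<in>P. s j powr - r * s j ^ d)" for r
    using s w by (intro mult_nonneg_nonneg sum_nonneg) (auto simp: less_imp_le)
  have \<sigma>0: "0 \<le> \<sigma>" "0 \<le> \<tau>"
    using order_trans[OF sum0 \<sigma>] order_trans[OF sum0 \<tau>] zero_less_power[OF L, of d]
    by (auto simp: zero_le_mult_iff)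
  define X where "X = L powr - q + \<sigma>"
  define Y where "Y = L powr - 2 + \<tau>"
  have XY: "0 < X" "0 < Y" using \<sigma>0 L by (auto simp: X_def Y_def add_pos_nonneg)
  have Gb: "(LINT x|lebesgue. norm (grad test x) powr r) \<le> 2 powr r * A powr (2 * r) * W * (L powr - r + \<theta>)"
    if "0 < r" "w powr r * (\<Sum>j\<in>P. s j powr - r * s j ^ d) \<le> \<theta> * L ^ d" for r \<theta>
  proof -
    have "(LINT x|lebesgue. norm (grad test x) powr r)
        \<le> 2 powr r * A powr (2 * r) * (V * 2 ^ d) * (L powr - r * L ^ d + w powr r * (\<Sum>j\<in>P. s j powr - r * s j ^ d))"
      by (rule grad_test_norm[OF that(1)])
    also have "\<dots> \<le> 2 powr r * A powr (2 * r) * (V * 2 ^ d) * (L powr - r * L ^ d + \<theta> * L ^ d)"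
      using that(2) V_pos by (intro mult_left_mono add_left_mono) auto
    also have "\<dots> = 2 powr r * A powr (2 * r) * W * (L powr - r + \<theta>)"
      by (simp add: W_def power_mult_distrib algebra_simps)
    finally show ?thesis .
  qed
  have G: "(LINT x|lebesgue. norm (grad test x) powr q) \<le> 2 powr q * A powr (2 * q) * W * X"
    using Gb[OF _ \<sigma>] pq by (simp add: X_def)
  have "(LINT x|lebesgue. (norm (grad test x))\<^sup>2) = (LINT x|lebesgue. norm (grad test x) powr 2)" by simp
  also have "\<dots> \<le> 4 * A ^ 4 * W * Y"
    using Gb[OF _ \<tau>] A(1) by (simp add: Y_def)
  finally have E: "(LINT x|lebesgue. (norm (grad test x))\<^sup>2) \<le> 4 * A ^ 4 * W * Y" .
  have A0: "0 < A" using A(1) by simp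
  have pos: "0 < V * L ^ d / 2" "0 < 2 powr q * A powr (2 * q) * W * X" "0 < (L * A) powr q * W" "0 < 4 * A ^ 4 * W * Y"
    using V_pos L A0 W XY by simp_all
  obtain F u g where FF: "F \<in> Lp_space p \<Omega>" "F \<in> Lp_space 2 \<Omega>" "Lp_norm p \<Omega> F = 1" "weak_solution \<Omega> F u g"
    and b: "ennreal (V * L ^ d / 2 / ((A powr p * W) powr (1 / p) * (2 powr q * A powr (2 * q) * W * X) powr (1 / q))) \<le> Lp_norm p \<Omega> g"
      "ennreal ((V * L ^ d / 2)\<^sup>2 / ((A powr p * W) powr (1 / p) * ((L * A) powr q * W) powr (1 / q) * (4 * A ^ 4 * W * Y))) \<le> Lp_norm p \<Omega> g"
    by (rule duality_lower_bounds[OF pq \<Omega> poincare datum_C0_infinity test pos(1) _ _ G pos(2) _ pos(3) E pos(4), of i "A powr p * W"])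
      (use pairing_lower_bound[OF small] rhs_norm[of p] datum_norm[of q] pq in \<open>auto simp: partial_datum W_def\<close>)
  \<comment> \<open>Conjugate exponents combine the two roots of the volume into the volume itself,
    which then cancels against the pairing.\<close>
  have Wpq: "W powr (1 / p) * W powr (1 / q) = W"
    using W pq(3) by (simp add: powr_add[symmetric])
  have Fr: "(A powr p * W) powr (1 / p) = A * W powr (1 / p)"
    using A0 W pq by (simp add: powr_mult powr_powr)
  have Hr: "((L * A) powr q * W) powr (1 / q) = L * A * W powr (1 / q)"
    using A0 W L pq by (simp add: powr_mult powr_powr)
  have Gr: "(2 powr q * A powr (2 * q) * W * X) powr (1 / q) = 2 * A\<^sup>2 * W powr (1 / q) * X powr (1 / q)"
    using A0 W XY pq by (simp add: powr_mult powr_powr)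
  have "(A powr p * W) powr (1 / p) * (2 powr q * A powr (2 * q) * W * X) powr (1 / q)
      = 2 * A ^ 3 * (W powr (1 / p) * W powr (1 / q)) * X powr (1 / q)"
    unfolding Fr Gr by (simp add: power2_eq_square power3_eq_cube)
  also have "\<dots> = 2 * A ^ 3 * W * X powr (1 / q)" unfolding Wpq by simp
  finally have "V * L ^ d / 2 / ((A powr p * W) powr (1 / p) * (2 powr q * A powr (2 * q) * W * X) powr (1 / q))
      = V * L ^ d / 2 / (2 * A ^ 3 * W * X powr (1 / q))" by simp
  \<comment> \<open>The pairing \<open>V * L ^ d / 2\<close> over the volume \<open>W\<close> is
    \<open>1 / (2 * 2 ^ d)\<close>; the remaining \<open>2 * A ^ 3\<close> completes the
    constant.\<close>
  also have "\<dots> = 1 / (4 * A ^ 3 * 2 ^ d) * X powr (- 1 / q)"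
    using V_pos L by (simp add: W_def power_mult_distrib powr_minus_divide)
  finally have b1: "ennreal (1 / (4 * A ^ 3 * 2 ^ d) * X powr (- 1 / q)) \<le> Lp_norm p \<Omega> g"
    using b(1) by simp
  have "(A powr p * W) powr (1 / p) * ((L * A) powr q * W) powr (1 / q) * (4 * A ^ 4 * W * Y)
      = 4 * A ^ 6 * L * (W powr (1 / p) * W powr (1 / q)) * W * Y"
    unfolding Fr Hr by (simp add: eval_nat_numeral)
  also have "\<dots> = 4 * A ^ 6 * L * W\<^sup>2 * Y" unfolding Wpq by (simp add: power2_eq_square)
  finally have "(V * L ^ d / 2)\<^sup>2 / ((A powr p * W) powr (1 / p) * ((L * A) powr q * W) powr (1 / q) * (4 * A ^ 4 * W * Y))
      = (V * L ^ d / 2)\<^sup>2 / (4 * A ^ 6 * L * W\<^sup>2 * Y)" by simp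
  also have "W\<^sup>2 = (V * L ^ d)\<^sup>2 * 4 ^ d"
  proof -
    have "(2 ^ d)\<^sup>2 = (4::real) ^ d" by (simp add: power2_eq_square power_mult_distrib[symmetric])
    then show ?thesis by (simp add: W_def power_mult_distrib)
  qed
  also have "(V * L ^ d / 2)\<^sup>2 / (4 * A ^ 6 * L * ((V * L ^ d)\<^sup>2 * 4 ^ d) * Y)
      = 1 / (16 * A ^ 6 * 4 ^ d) / (L * Y)"
    using V_pos L by (simp add: power_divide)
  finally have b2: "ennreal (1 / (16 * A ^ 6 * 4 ^ d) / (L * Y)) \<le> Lp_norm p \<Omega> g"
    using b(2) by simp
  show thesis
    by (rule that[OF FF]) (use b1 b2 in \<open>simp_all only: X_def Y_def\<close>)
qed

end

section \<open>Periodic cutoffs\<close>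

lemma B_const_ge:
  assumes "F \<in> Lp_space p (perforated_domain T \<epsilon> \<eta>)" "F \<in> Lp_space 2 (perforated_domain T \<epsilon> \<eta>)"
    "Lp_norm p (perforated_domain T \<epsilon> \<eta>) F = 1" "weak_solution (perforated_domain T \<epsilon> \<eta>) F u g"
  shows "Lp_norm p (perforated_domain T \<epsilon> \<eta>) g \<le> B_const p T \<epsilon> \<eta>"
  unfolding B_const_def Let_def by (rule Sup_upper) (use assms in blast)

section \<open>Finite portions of the integer lattice\<close>

definition lattice_cube :: "nat \<Rightarrow> (real^'n) set" where
  "lattice_cube N = {k. \<forall>i. k $ i \<in> of_int ` {- int N..int N}}"

lemma lattice_cube_finite: "finite (lattice_cube N :: (real^'n) set)"
  unfolding lattice_cube_def lattice_image by (intro finite_imageI finite_PiE) auto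

lemma card_lattice_cube: "card (lattice_cube N :: (real^'n) set) \<le> (2 * N + 1) ^ CARD('n)"
proof -
  let ?S = "real_of_int ` {- int N..int N}"
  have "card (lattice_cube N :: (real^'n) set) \<le> card (PiE (UNIV :: 'n set) (\<lambda>_. ?S))"
    unfolding lattice_cube_def lattice_image by (intro card_image_le finite_PiE) auto
  also have "\<dots> = card ?S ^ CARD('n)" by (simp add: card_PiE)
  also have "card ?S = 2 * N + 1" by (subst card_image) (auto simp: inj_on_def)
  finally show ?thesis .
qed

lemma lattice_cube_Ints: "k \<in> lattice_cube N \<Longrightarrow> k $ i \<in> \<int>"
  unfolding lattice_cube_def by (metis (mono_tags, lifting) Ints_of_int imageE mem_Collect_eq)

lemma lattice_outside_cube:
  assumes "\<forall>i. k $ i \<in> \<int>" "k \<notin> lattice_cube N"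
  shows "real N < norm k"
proof -
  obtain i where i: "k $ i \<notin> of_int ` {- int N..int N}" using assms(2) by (auto simp: lattice_cube_def)
  obtain m where m: "k $ i = of_int m" using assms(1) Ints_cases by blast
  then have "m \<notin> {- int N..int N}" using i by auto
  then have "int N < \<bar>m\<bar>" by auto
  then have "real N < \<bar>k $ i\<bar>" unfolding m by linarith
  also have "\<dots> \<le> norm k" by (rule component_le_norm_cart)
  finally show ?thesis .
qed

lemma lattice_separated:
  fixes k l :: "real^'n"
  assumes "\<forall>i. k $ i \<in> \<int>" "\<forall>i. l $ i \<in> \<int>" "norm (k - l) < 1"
  shows "k = l"
proof -
  have "k $ i = l $ i" for i
  proof -
    obtain m m' where m: "k $ i = of_int m" "l $ i = of_int m'" using assms Ints_cases by metis
    have "\<bar>(k - l) $ i\<bar> < 1" using component_le_norm_cart[of "k - l" i] assms(3) by linarith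
    then have "\<bar>real_of_int (m - m')\<bar> < 1" using m by simp
    then have "m = m'" by linarith
    then show ?thesis using m by simp
  qed
  then show ?thesis by (simp add: vec_eq_iff)
qed

text \<open>Around each lattice point the cutoff averages the \<open>M\<close> dyadic bumps of radii \<open>\<rho> \<eta> 2\<^sup>j\<close>, \<open>j < M\<close>.
  Taking \<open>M = 1\<close> is optimal except in the critical case of two dimensions and exponent \<open>2\<close>, where averaging
  over the scales gains the logarithm.\<close>

lemma periodic_lower_bounds:
  fixes T :: "(real^'n) set" and i :: 'n
  assumes A: "1 \<le> A" "\<And>x::real^'n. \<bar>profile i x\<bar> \<le> A" "\<And>x::real^'n. \<bar>partial_deriv i (profile i) x\<bar> \<le> A"
    "\<And>x::real^'n. norm (grad (partial_deriv i (profile i)) x) \<le> A" "\<And>x::real^'n. norm (grad bump x) \<le> A"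
    and pq: "1 < p" "1 < q" "1 / p + 1 / q = 1"
    and T: "compact T" "0 < c" "ball 0 c \<subseteq> T" "T \<subseteq> ball 0 \<rho>"
    and pos: "0 < \<epsilon>" "0 < \<eta>" "0 < \<rho>" "0 < M" "0 < N"
    and small: "\<rho> * \<eta> * 2 ^ M \<le> 1 / (14 * A\<^sup>2)"
    and \<kappa>: "real M powr - q * (7 ^ CARD('n) * (\<Sum>j<M. (\<rho> * \<eta> * 2 ^ j) powr (real CARD('n) - q))) \<le> \<kappa>"
    and \<mu>: "real M powr - 2 * (7 ^ CARD('n) * (\<Sum>j<M. (\<rho> * \<eta> * 2 ^ j) powr (real CARD('n) - 2))) \<le> \<mu>"
  shows "ennreal (1 / (4 * A ^ 3 * 2 ^ CARD('n)) * (\<epsilon> * (real N powr - q + \<kappa>) powr (- 1 / q))) \<le> B_const p T \<epsilon> \<eta>"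
    and "ennreal (1 / (16 * A ^ 6 * 4 ^ CARD('n)) * (\<epsilon> / (real N * (real N powr - 2 + \<mu>)))) \<le> B_const p T \<epsilon> \<eta>"
proof -
  let ?\<Omega> = "perforated_domain T \<epsilon> \<eta>"
  \<comment> \<open>The datum lives in the ball of radius \<open>2 * N * \<epsilon>\<close>. Lattice
    points outside this cube lie, after scaling, beyond \<open>3 * N * \<epsilon>\<close>; their
    holes are smaller than \<open>\<epsilon>\<close> and so stay off that ball.\<close>
  define K :: "(real^'n) set" where "K = lattice_cube (3 * N)"
  define P where "P = K \<times> {..<M}"
  define z where "z = (\<lambda>(k :: real^'n, j :: nat). \<epsilon> *\<^sub>R k)"
  \<comment> \<open>The smallest radius is \<open>\<epsilon> * \<eta> * \<rho>\<close>, which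
    exceeds the size of the hole; hence every bump of a cell equals 1 on its hole.\<close>
  define s where "s = (\<lambda>(k :: real^'n, j :: nat). \<epsilon> * (\<rho> * \<eta> * 2 ^ j))"
  define L where "L = real N * \<epsilon>"
  define w where "w = 1 / real M"
  define d where "d = CARD('n)"
  have K: "finite K" "real (card K) \<le> (7 * real N) ^ d"
  proof -
    show "finite K" unfolding K_def by (rule lattice_cube_finite)
    have "card K \<le> (7 * N) ^ d"
      unfolding K_def d_def by (rule order_trans[OF card_lattice_cube power_mono]) (use pos in auto)
    then show "real (card K) \<le> (7 * real N) ^ d"
      by (metis of_nat_le_iff of_nat_mult of_nat_numeral of_nat_power)
  qed
  have L: "0 < L" and \<epsilon>_le_L: "\<epsilon> \<le> L" using pos by (auto simp: L_def)
  have A2: "1 \<le> A\<^sup>2" using A(1) by simp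
  \<comment> \<open>The cube \<open>K\<close> has side \<open>2 * (3 * N) + 1\<close>, at most
    \<open>7 * N\<close>, so \<open>A\<^sup>2\<close> times the bump volume is at most
    \<open>A\<^sup>2 * 7 * \<delta> = 1 / 2\<close> of \<open>L ^ d\<close>, as the pairing
    requires. Moreover \<open>\<delta> \<le> 1 / 14\<close> keeps bumps of different cells
    apart.\<close>
  define \<delta> where "\<delta> = 1 / (14 * A\<^sup>2)"
  have \<delta>: "0 < \<delta>" "\<delta> \<le> 1 / 14" "\<rho> * \<eta> * 2 ^ M \<le> \<delta>" using A2 small by (auto simp: \<delta>_def divide_simps)
  have s_pos: "0 < s a" for a using pos by (simp add: s_def split_beta)
  have two_s: "2 * s (k, j) \<le> \<epsilon> * \<delta>" if "j < M" for k j
  proof -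
    have "2 * s (k, j) = \<epsilon> * (\<rho> * \<eta> * 2 ^ Suc j)" by (simp add: s_def)
    also have "\<dots> \<le> \<epsilon> * (\<rho> * \<eta> * 2 ^ M)"
      using pos that by (intro mult_left_mono power_increasing) auto
    also have "\<dots> \<le> \<epsilon> * \<delta>" using \<delta>(3) pos by (intro mult_left_mono) auto
    finally show ?thesis .
  qed
  have same_cell: "k = l"
    if "k \<in> K" "l \<in> K" "norm (x - \<epsilon> *\<^sub>R k) < \<epsilon> * \<delta>" "norm (x - \<epsilon> *\<^sub>R l) < \<epsilon> * \<delta>" for k l x
  proof (rule lattice_separated)
    show "\<forall>i. k $ i \<in> \<int>" "\<forall>i. l $ i \<in> \<int>" using that lattice_cube_Ints by (auto simp: K_def)
    have "\<epsilon> * norm (k - l) = norm ((x - \<epsilon> *\<^sub>R l) - (x - \<epsilon> *\<^sub>R k))"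
      using pos by (simp add: scaleR_diff_right[symmetric])
    also have "\<dots> \<le> norm (x - \<epsilon> *\<^sub>R l) + norm (x - \<epsilon> *\<^sub>R k)" by (rule norm_triangle_ineq4)
    also have "\<dots> < \<epsilon> * (2 * \<delta>)" using that by simp
    also have "\<dots> \<le> \<epsilon> * 1" using \<delta> pos by (intro mult_left_mono) auto
    finally show "norm (k - l) < 1" using pos by simp
  qed
  have bump_near: "norm (x - \<epsilon> *\<^sub>R k) < \<epsilon> * \<delta>"
    if "bump ((1 / s (k, j)) *\<^sub>R (x - \<epsilon> *\<^sub>R k)) \<noteq> 0" "j < M" for x k j
  proof -
    have "norm ((1 / s (k, j)) *\<^sub>R (x - \<epsilon> *\<^sub>R k)) < 2"
      using that(1) bump_eq_0 not_less by blast
    then have "norm (x - \<epsilon> *\<^sub>R k) < 2 * s (k, j)" using s_pos[of "(k, j)"] by (simp add: pos_divide_less_eq)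
    then show ?thesis using two_s[OF that(2), of k] by simp
  qed
  have inner_le1: "(\<Sum>k\<in>K. bump ((1 / s (k, j)) *\<^sub>R (x - \<epsilon> *\<^sub>R k))) \<le> 1" if j: "j < M" for j x
  proof (cases "\<exists>k\<in>K. bump ((1 / s (k, j)) *\<^sub>R (x - \<epsilon> *\<^sub>R k)) \<noteq> 0")
    case True
    then obtain k where k: "k \<in> K" "bump ((1 / s (k, j)) *\<^sub>R (x - \<epsilon> *\<^sub>R k)) \<noteq> 0" by blast
    have "bump ((1 / s (l, j)) *\<^sub>R (x - \<epsilon> *\<^sub>R l)) = 0" if "l \<in> K - {k}" for l
      using same_cell[OF k(1) _ bump_near[OF k(2) j] bump_near[OF _ j, of l]] that by blast
    then have "(\<Sum>l\<in>K - {k}. bump ((1 / s (l, j)) *\<^sub>R (x - \<epsilon> *\<^sub>R l))) = 0" by simp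
    then show ?thesis
      using sum.remove[OF K(1) k(1), of "\<lambda>k. bump ((1 / s (k, j)) *\<^sub>R (x - \<epsilon> *\<^sub>R k))"]
        bump_le_1[of "(1 / s (k, j)) *\<^sub>R (x - \<epsilon> *\<^sub>R k)"] by simp
  next
    case False
    then show ?thesis by simp
  qed
  have cut_eq: "(\<Sum>a\<in>P. bump ((1 / s a) *\<^sub>R (x - z a))) = (\<Sum>j<M. \<Sum>k\<in>K. bump ((1 / s (k, j)) *\<^sub>R (x - \<epsilon> *\<^sub>R k)))" for x
    unfolding P_def by (subst sum.swap) (simp add: sum.cartesian_product z_def split_beta)
  interpret test_function i A 0 L w P z s d "unit_ball_vol (real CARD('n))"
  proof
    show "finite P" using K(1) by (simp add: P_def)
    show "w * (\<Sum>a\<in>P. bump ((1 / s a) *\<^sub>R (x - z a))) \<le> 1" for x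
    proof -
      have "(\<Sum>a\<in>P. bump ((1 / s a) *\<^sub>R (x - z a))) \<le> (\<Sum>j<M. 1)"
        unfolding cut_eq by (intro sum_mono inner_le1) auto
      then show ?thesis using pos by (simp add: w_def)
    qed
    show "a = b" if ab: "a \<in> P" "b \<in> P" "norm (x - z a) \<in> {s a<..<2 * s a}" "norm (x - z b) \<in> {s b<..<2 * s b}" for a b x
    proof -
      obtain k j l m where kl: "a = (k, j)" "b = (l, m)" "k \<in> K" "l \<in> K" "j < M" "m < M"
        using ab(1,2) by (auto simp: P_def)
      have near: "norm (x - \<epsilon> *\<^sub>R k) < \<epsilon> * \<delta>" "norm (x - \<epsilon> *\<^sub>R l) < \<epsilon> * \<delta>"
        using ab(3,4) two_s[OF kl(5), of k] two_s[OF kl(6), of l] kl(1,2) by (auto simp: z_def)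
      have "k = l" by (rule same_cell[OF kl(3,4) near])
      \<comment> \<open>A common point of two annuli around one centre puts each radius below twice
        the other; for dyadic radii this means equality.\<close>
      have "s (k, j) < 2 * s (k, m)" "s (k, m) < 2 * s (k, j)"
        using ab(3,4) kl(1,2) \<open>k = l\<close> by (auto simp: z_def)
      then have "(2::real) ^ j < 2 ^ Suc m" "(2::real) ^ m < 2 ^ Suc j"
        using pos by (auto simp: s_def mult_less_cancel_left_pos mult.left_commute[of 2])
      then have "j < Suc m" "m < Suc j"
        using power_less_imp_less_exp[of "2::real" j "Suc m"] power_less_imp_less_exp[of "2::real" m "Suc j"]
        by (simp_all del: power_Suc)
      then show ?thesis using kl \<open>k = l\<close> by simp
    qed
  qed (use A L pos s_pos in \<open>auto simp: w_def d_def\<close>)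
  have meas: "?\<Omega> \<in> sets lebesgue" by (rule perforated_domain_measurable[OF T(1)])
  obtain C where C: "\<And>\<psi>. \<psi> \<in> C0_infinity ?\<Omega> \<Longrightarrow>
      (LINT x|lebesgue. (\<psi> x)\<^sup>2) \<le> C * (LINT x|lebesgue. (norm (grad \<psi> x))\<^sup>2)"
    using perforated_domain_poincare[OF T(2,3) pos(1,2)] by blast
  have test: "test \<in> C0_infinity ?\<Omega>"
  proof (rule C0_infinityI_closure[OF smooth_test test_bounded_support], rule subsetI, rule ccontr)
    fix y assume y: "y \<in> closure {x. test x \<noteq> 0}" "y \<notin> ?\<Omega>"
    then obtain k t where k: "\<forall>i. k $ i \<in> \<int>" "t \<in> T" "y = \<epsilon> *\<^sub>R (k + \<eta> *\<^sub>R t)"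
      by (auto simp: perforated_domain_def)
    have "norm (y - \<epsilon> *\<^sub>R k) = \<epsilon> * \<eta> * norm t" using k(3) pos by (simp add: scaleR_add_right)
    also have "\<dots> < \<epsilon> * \<eta> * \<rho>" using k(2) T(4) pos by (intro mult_strict_left_mono) auto
    finally have yU: "y \<in> ball (\<epsilon> *\<^sub>R k) (\<epsilon> * \<eta> * \<rho>)" by (simp add: dist_norm norm_minus_commute)
    \<comment> \<open>The closure of the support must avoid the hole, so \<open>test\<close> has to
      vanish on an open neighbourhood of it; such a ball exists because \<open>T\<close> lies in the
      open ball of radius \<open>\<rho>\<close>. Over \<open>K\<close> the factor
      \<open>1 - cutoff\<close> vanishes there, elsewhere the factor \<open>rhs\<close>.\<close>
    have zero: "test x = 0" if x: "x \<in> ball (\<epsilon> *\<^sub>R k) (\<epsilon> * \<eta> * \<rho>)" for x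
    proof (cases "k \<in> K")
      case True
      have "bump ((1 / s (k, j)) *\<^sub>R (x - \<epsilon> *\<^sub>R k)) = 1" for j
      proof (rule bump_eq_1)
        have "norm (x - \<epsilon> *\<^sub>R k) \<le> \<epsilon> * \<eta> * \<rho> * 1" using x by (simp add: dist_norm norm_minus_commute)
        also have "\<dots> \<le> \<epsilon> * \<eta> * \<rho> * 2 ^ j" using pos by (intro mult_left_mono) auto
        also have "\<dots> = s (k, j)" by (simp add: s_def)
        finally show "norm ((1 / s (k, j)) *\<^sub>R (x - \<epsilon> *\<^sub>R k)) \<le> 1"
          using s_pos[of "(k, j)"] by (simp add: pos_divide_le_eq)
      qed
      then have "1 \<le> (\<Sum>k\<in>K. bump ((1 / s (k, j)) *\<^sub>R (x - \<epsilon> *\<^sub>R k)))" for j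
        using member_le_sum[OF True, of "\<lambda>k. bump ((1 / s (k, j)) *\<^sub>R (x - \<epsilon> *\<^sub>R k))"] K(1) bump_nonneg by auto
      then have "(\<Sum>j<M. 1) \<le> (\<Sum>j<M. \<Sum>k\<in>K. bump ((1 / s (k, j)) *\<^sub>R (x - \<epsilon> *\<^sub>R k)))"
        by (intro sum_mono) auto
      then have "1 \<le> w * (\<Sum>j<M. \<Sum>k\<in>K. bump ((1 / s (k, j)) *\<^sub>R (x - \<epsilon> *\<^sub>R k)))"
        using pos by (simp add: w_def)
      then have "1 \<le> cutoff x" unfolding cutoff_def cut_eq .
      then have "cutoff x = 1" using cutoff_range(2)[of x] by simp
      then show ?thesis by (simp add: test_def)
    next
      case False
      have "3 * real N < norm k" using lattice_outside_cube[OF k(1), of "3 * N"] False by (simp add: K_def)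
      then have "\<epsilon> * (3 * real N) < norm (\<epsilon> *\<^sub>R k)" using pos by simp
      also have "norm (\<epsilon> *\<^sub>R k) \<le> norm x + norm (x - \<epsilon> *\<^sub>R k)"
        using norm_triangle_ineq4[of x "x - \<epsilon> *\<^sub>R k"] by simp
      also have "norm (x - \<epsilon> *\<^sub>R k) \<le> s (k, 0)" using x by (simp add: s_def dist_norm norm_minus_commute ac_simps)
      also have "s (k, 0) \<le> \<epsilon> * \<delta>" using two_s[of 0 k] pos s_pos[of "(k, 0)"] by simp
      also have "\<epsilon> * \<delta> \<le> \<epsilon> * 1" using \<delta> pos by (intro mult_left_mono) auto
      finally have "2 * L < norm x" using \<epsilon>_le_L unfolding L_def by (simp add: algebra_simps)
      then show ?thesis using outside(2)[of x] by (simp add: test_def)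
    qed
    have "ball (\<epsilon> *\<^sub>R k) (\<epsilon> * \<eta> * \<rho>) \<inter> {x. test x \<noteq> 0} \<noteq> {}"
      using y(1) yU open_Int_closure_eq_empty[OF open_ball, of "\<epsilon> *\<^sub>R k" "\<epsilon> * \<eta> * \<rho>" "{x. test x \<noteq> 0}"] by blast
    then show False using zero by blast
  qed
  have small': "A\<^sup>2 * w * (\<Sum>a\<in>P. (2 * s a) ^ d) \<le> L ^ d / 2"
  proof -
    have "(\<Sum>a\<in>P. (2 * s a) ^ d) \<le> (\<Sum>a\<in>P. (\<epsilon> * \<delta>) ^ d)"
      using two_s s_pos by (intro sum_mono power_mono) (auto simp: P_def less_imp_le)
    also have "\<dots> = real M * (real (card K) * (\<epsilon> * \<delta>) ^ d)" by (simp add: P_def card_cartesian_product)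
    finally have "w * (\<Sum>a\<in>P. (2 * s a) ^ d) \<le> real (card K) * (\<epsilon> * \<delta>) ^ d"
      using pos by (simp add: w_def divide_le_eq mult.commute)
    also have "\<dots> \<le> (7 * real N) ^ d * (\<epsilon> * \<delta>) ^ d" using K pos \<delta> by (intro mult_right_mono) auto
    also have "\<dots> = L ^ d * (7 * \<delta>) ^ d" by (simp add: L_def power_mult_distrib)
    also have "\<dots> \<le> L ^ d * (7 * \<delta>) ^ 1"
      using \<delta> L by (intro mult_left_mono power_decreasing) (auto simp: d_def)
    finally have "A\<^sup>2 * (w * (\<Sum>a\<in>P. (2 * s a) ^ d)) \<le> A\<^sup>2 * (L ^ d * (7 * \<delta>) ^ 1)"
      using A2 by (intro mult_left_mono) auto
    also have "\<dots> = L ^ d / 2" using A(1) by (simp add: \<delta>_def)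
    finally show ?thesis by (simp add: mult.assoc)
  qed
  \<comment> \<open>\<open>\<theta>\<close> bounds the energy in units of \<open>\<epsilon>\<close>,
    including the factor \<open>7 ^ d\<close>. The number of cells is at most
    \<open>7 ^ d * L ^ d / \<epsilon> ^ d\<close>, which converts it into a density with respect to
    \<open>L ^ d\<close>.\<close>
  have cap: "w powr r * (\<Sum>a\<in>P. s a powr - r * s a ^ d) \<le> \<epsilon> powr - r * \<theta> * L ^ d"
    if \<theta>: "real M powr - r * (7 ^ CARD('n) * (\<Sum>j<M. (\<rho> * \<eta> * 2 ^ j) powr (real CARD('n) - r))) \<le> \<theta>" for r \<theta>
  proof -
    have t: "s (k, j) powr - r * s (k, j) ^ d = \<epsilon> powr - r * \<epsilon> ^ d * (\<rho> * \<eta> * 2 ^ j) powr (real d - r)" for k j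
    proof -
      have "s (k, j) powr - r * s (k, j) ^ d = s (k, j) powr (real d - r)"
        using s_pos[of "(k, j)"] by (simp add: powr_add[symmetric] powr_realpow[symmetric])
      also have "\<dots> = \<epsilon> powr (real d - r) * (\<rho> * \<eta> * 2 ^ j) powr (real d - r)"
        using pos by (simp add: s_def powr_mult)
      also have "\<epsilon> powr (real d - r) = \<epsilon> powr - r * \<epsilon> ^ d"
        using pos by (simp add: powr_add[symmetric] powr_realpow[symmetric])
      finally show ?thesis .
    qed
    have "(\<Sum>a\<in>P. s a powr - r * s a ^ d) = (\<Sum>k\<in>K. \<Sum>j<M. s (k, j) powr - r * s (k, j) ^ d)"
      unfolding P_def by (simp add: sum.cartesian_product)
    also have "\<dots> = real (card K) * (\<epsilon> powr - r * \<epsilon> ^ d * (\<Sum>j<M. (\<rho> * \<eta> * 2 ^ j) powr (real d - r)))"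
      unfolding t by (simp add: sum_distrib_left)
    also have "\<dots> \<le> (7 * real N) ^ d * (\<epsilon> powr - r * \<epsilon> ^ d * (\<Sum>j<M. (\<rho> * \<eta> * 2 ^ j) powr (real d - r)))"
      using K pos by (intro mult_right_mono mult_nonneg_nonneg sum_nonneg) auto
    finally have "w powr r * (\<Sum>a\<in>P. s a powr - r * s a ^ d)
        \<le> w powr r * ((7 * real N) ^ d * (\<epsilon> powr - r * \<epsilon> ^ d * (\<Sum>j<M. (\<rho> * \<eta> * 2 ^ j) powr (real d - r))))"
      by (intro mult_left_mono) auto
    also have "\<dots> = (\<epsilon> powr - r * L ^ d) * (real M powr - r * (7 ^ d * (\<Sum>j<M. (\<rho> * \<eta> * 2 ^ j) powr (real d - r))))"
      using pos by (simp add: L_def w_def powr_divide powr_minus_divide power_mult_distrib ac_simps)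
    also have "\<dots> \<le> (\<epsilon> powr - r * L ^ d) * \<theta>"
      using \<theta> L pos by (intro mult_left_mono) (auto simp: d_def)
    finally show ?thesis by (simp add: mult.commute mult.left_commute)
  qed
  obtain F u g where F: "F \<in> Lp_space p ?\<Omega>" "F \<in> Lp_space 2 ?\<Omega>" "Lp_norm p ?\<Omega> F = 1" "weak_solution ?\<Omega> F u g"
    and b: "ennreal (1 / (4 * A ^ 3 * 2 ^ d) * (L powr - q + \<epsilon> powr - q * \<kappa>) powr (- 1 / q)) \<le> Lp_norm p ?\<Omega> g"
    "ennreal (1 / (16 * A ^ 6 * 4 ^ d) / (L * (L powr - 2 + \<epsilon> powr - 2 * \<mu>))) \<le> Lp_norm p ?\<Omega> g"
    using lower_bounds[OF pq meas C test small' cap[OF \<kappa>] cap[OF \<mu>]] by blast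
  \<comment> \<open>The datum term and the cutoff term carry the same power of
    \<open>\<epsilon>\<close>, which is why both final bounds are linear in
    \<open>\<epsilon>\<close>.\<close>
  have Lr: "L powr - r + \<epsilon> powr - r * \<theta> = \<epsilon> powr - r * (real N powr - r + \<theta>)" for r \<theta>
    using pos by (simp add: L_def powr_mult algebra_simps)
  have \<kappa>0: "0 \<le> \<kappa>" by (rule order_trans[OF _ \<kappa>]) (intro mult_nonneg_nonneg sum_nonneg, auto)
  have "(L powr - q + \<epsilon> powr - q * \<kappa>) powr (- 1 / q) = \<epsilon> * (real N powr - q + \<kappa>) powr (- 1 / q)"
    unfolding Lr using pos pq \<kappa>0 by (simp add: powr_mult powr_powr)
  then show "ennreal (1 / (4 * A ^ 3 * 2 ^ CARD('n)) * (\<epsilon> * (real N powr - q + \<kappa>) powr (- 1 / q))) \<le> B_const p T \<epsilon> \<eta>"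
    using order_trans[OF b(1) B_const_ge[OF F]] by (simp add: d_def)
  have "L * (L powr - 2 + \<epsilon> powr - 2 * \<mu>) = real N * (real N powr - 2 + \<mu>) / \<epsilon>"
    unfolding Lr using pos by (simp add: L_def powr_minus_divide power2_eq_square)
  then show "ennreal (1 / (16 * A ^ 6 * 4 ^ CARD('n)) * (\<epsilon> / (real N * (real N powr - 2 + \<mu>)))) \<le> B_const p T \<epsilon> \<eta>"
    using order_trans[OF b(2) B_const_ge[OF F]] by (simp add: d_def)
qed

text \<open>With \<open>N\<close> about \<open>1 / \<tau>\<close>, hence \<open>L\<close> about
  \<open>\<epsilon> / \<tau>\<close>, the datum term is of the order of \<open>\<tau>\<close> to the
  same power as the cutoff term. The first bound uses only that \<open>N\<close> is large enough; in
  the second \<open>N\<close> enters through \<open>1 / N + N * \<kappa> * \<tau>\<^sup>2\<close>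
  and is needed from both sides.\<close>

lemma periodic_lower_bounds_scaled:
  fixes T :: "(real^'n) set" and i :: 'n
  assumes A: "1 \<le> A" "\<And>x::real^'n. \<bar>profile i x\<bar> \<le> A" "\<And>x::real^'n. \<bar>partial_deriv i (profile i) x\<bar> \<le> A"
    "\<And>x::real^'n. norm (grad (partial_deriv i (profile i)) x) \<le> A" "\<And>x::real^'n. norm (grad bump x) \<le> A"
    and pq: "1 < p" "1 < q" "1 / p + 1 / q = 1"
    and T: "compact T" "0 < c" "ball 0 c \<subseteq> T" "T \<subseteq> ball 0 \<rho>"
    and pos: "0 < \<epsilon>" "0 < \<eta>" "0 < \<rho>" "0 < M"
    and small: "\<rho> * \<eta> * 2 ^ M \<le> 1 / (14 * A\<^sup>2)"
    and \<tau>: "0 < \<tau>" "\<tau> \<le> 1" and \<kappa>0: "0 \<le> \<kappa>"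
  shows "real M powr - q * (7 ^ CARD('n) * (\<Sum>j<M. (\<rho> * \<eta> * 2 ^ j) powr (real CARD('n) - q))) \<le> \<kappa> * \<tau> powr q \<Longrightarrow>
      ennreal (1 / (4 * A ^ 3 * 2 ^ CARD('n)) * (1 + \<kappa>) powr (- 1 / q) * (\<epsilon> / \<tau>)) \<le> B_const p T \<epsilon> \<eta>"
    and "real M powr - 2 * (7 ^ CARD('n) * (\<Sum>j<M. (\<rho> * \<eta> * 2 ^ j) powr (real CARD('n) - 2))) \<le> \<kappa> * \<tau>\<^sup>2 \<Longrightarrow>
      ennreal (1 / (16 * A ^ 6 * 4 ^ CARD('n)) / (1 + 2 * \<kappa>) * (\<epsilon> / \<tau>)) \<le> B_const p T \<epsilon> \<eta>"
proof -
  \<comment> \<open>As \<open>\<tau> \<le> 1\<close>, rounding up at most doubles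
    \<open>1 / \<tau>\<close>.\<close>
  define N where "N = nat \<lceil>1 / \<tau>\<rceil>"
  have "1 \<le> 1 / \<tau>" using \<tau> by (simp add: divide_simps)
  then have N1: "1 / \<tau> \<le> real N" "real N \<le> 2 / \<tau>"
    by (auto simp: N_def) linarith+
  have N: "0 < N" using N1(1) \<tau> by (metis divide_pos_pos less_le_trans of_nat_0_less_iff zero_less_one)
  note lb = periodic_lower_bounds[OF A pq T pos N small]
  show "ennreal (1 / (4 * A ^ 3 * 2 ^ CARD('n)) * (1 + \<kappa>) powr (- 1 / q) * (\<epsilon> / \<tau>)) \<le> B_const p T \<epsilon> \<eta>"
    if "real M powr - q * (7 ^ CARD('n) * (\<Sum>j<M. (\<rho> * \<eta> * 2 ^ j) powr (real CARD('n) - q))) \<le> \<kappa> * \<tau> powr q"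
  \<comment> \<open>The estimate for the other exponent is supplied by \<open>order_refl\<close>, so
    each conclusion asks only for its own capacity bound.\<close>
  proof (rule order_trans[OF ennreal_leI lb(1)[OF that order_refl]])
    have "real N powr - q \<le> (1 / \<tau>) powr - q" using N1 \<tau> pq by (intro powr_mono2') auto
    also have "\<dots> = \<tau> powr q" using \<tau> by (simp add: powr_divide powr_minus_divide)
    finally have le: "real N powr - q + \<kappa> * \<tau> powr q \<le> (1 + \<kappa>) * \<tau> powr q" by (simp add: algebra_simps)
    have "(1 + \<kappa>) powr (- 1 / q) * (1 / \<tau>) = ((1 + \<kappa>) * \<tau> powr q) powr (- 1 / q)"
      using \<tau> pq \<kappa>0 by (simp add: powr_mult powr_powr powr_minus_divide)
    also have "\<dots> \<le> (real N powr - q + \<kappa> * \<tau> powr q) powr (- 1 / q)"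
      using le N \<tau> \<kappa>0 pq by (intro powr_mono2') (auto intro!: add_pos_nonneg)
    finally have "\<epsilon> * ((1 + \<kappa>) powr (- 1 / q) * (1 / \<tau>)) \<le> \<epsilon> * (real N powr - q + \<kappa> * \<tau> powr q) powr (- 1 / q)"
      using pos by (intro mult_left_mono) auto
    then have "1 / (4 * A ^ 3 * 2 ^ CARD('n)) * (\<epsilon> * ((1 + \<kappa>) powr (- 1 / q) * (1 / \<tau>)))
        \<le> 1 / (4 * A ^ 3 * 2 ^ CARD('n)) * (\<epsilon> * (real N powr - q + \<kappa> * \<tau> powr q) powr (- 1 / q))"
      by (rule mult_left_mono) (use A(1) in auto)
    then show "1 / (4 * A ^ 3 * 2 ^ CARD('n)) * (1 + \<kappa>) powr (- 1 / q) * (\<epsilon> / \<tau>)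
        \<le> 1 / (4 * A ^ 3 * 2 ^ CARD('n)) * (\<epsilon> * (real N powr - q + \<kappa> * \<tau> powr q) powr (- 1 / q))"
      by (simp add: ac_simps)
  qed
  show "ennreal (1 / (16 * A ^ 6 * 4 ^ CARD('n)) / (1 + 2 * \<kappa>) * (\<epsilon> / \<tau>)) \<le> B_const p T \<epsilon> \<eta>"
    if "real M powr - 2 * (7 ^ CARD('n) * (\<Sum>j<M. (\<rho> * \<eta> * 2 ^ j) powr (real CARD('n) - 2))) \<le> \<kappa> * \<tau>\<^sup>2"
  proof (rule order_trans[OF ennreal_leI lb(2)[OF order_refl that]])
    let ?X = "real N * (real N powr - 2 + \<kappa> * \<tau>\<^sup>2)"
    have "?X = 1 / real N + real N * (\<kappa> * \<tau>\<^sup>2)"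
      using N by (simp add: powr_minus_divide power2_eq_square distrib_left)
    also have "\<dots> \<le> \<tau> + (2 / \<tau>) * (\<kappa> * \<tau>\<^sup>2)"
    proof (intro add_mono mult_right_mono N1(2))
      show "1 / real N \<le> \<tau>" using N1(1) N \<tau> by (simp add: divide_simps mult.commute)
    qed (use \<kappa>0 in auto)
    also have "\<dots> = (1 + 2 * \<kappa>) * \<tau>" using \<tau> by (simp add: power2_eq_square algebra_simps)
    finally have le: "?X \<le> (1 + 2 * \<kappa>) * \<tau>" .
    have X: "0 < ?X" using N \<kappa>0 by (intro mult_pos_pos add_pos_nonneg) auto
    then have "\<epsilon> / ((1 + 2 * \<kappa>) * \<tau>) \<le> \<epsilon> / ?X"
      using pos by (intro frac_le[OF _ order_refl X le]) simp
    then have "1 / (16 * A ^ 6 * 4 ^ CARD('n)) * (\<epsilon> / ((1 + 2 * \<kappa>) * \<tau>)) \<le> 1 / (16 * A ^ 6 * 4 ^ CARD('n)) * (\<epsilon> / ?X)"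
      by (rule mult_left_mono) (use A(1) in auto)
    then show "1 / (16 * A ^ 6 * 4 ^ CARD('n)) / (1 + 2 * \<kappa>) * (\<epsilon> / \<tau>) \<le> 1 / (16 * A ^ 6 * 4 ^ CARD('n)) * (\<epsilon> / ?X)"
      by simp
  qed
qed

section \<open>Holes\<close>

text \<open>A point of \<open>T\<close> on the boundary of the cell would also lie on the boundary
  of \<open>T\<close>, contradicting the positive distance of the two boundaries. So
  \<open>T\<close> lies in the open cell, and compactness turns this into a uniform margin
  \<open>r\<close> for each coordinate.\<close>

lemma admissible_hole_bounds:
  fixes T :: "(real^'n) set"
  assumes "admissible_hole T"
  obtains c r \<rho> where "compact T" "0 < c" "ball 0 c \<subseteq> T" "0 < \<rho>" "T \<subseteq> ball 0 \<rho>"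
    "0 < r" "r < 1 / 2" "\<And>y i. y \<in> T \<Longrightarrow> \<bar>y $ i\<bar> \<le> 1 / 2 - r"
proof -
  obtain D c where D: "bounded D" "D \<subseteq> unit_cell" "T = closure D" and c: "0 < c" "ball 0 c \<subseteq> T"
    "c \<le> setdist (frontier T) (frontier (unit_cell :: (real^'n) set))"
    using assms unfolding admissible_hole_def by blast
  have cell: "(unit_cell :: (real^'n) set) = cbox (\<chi> i. - 1 / 2) (\<chi> i. 1 / 2)"
    by (auto simp: unit_cell_def mem_box_cart)
  have T: "compact T" "closed T" using D by (auto simp: compact_closure)
  have sub: "T \<subseteq> unit_cell" unfolding D(3) using D(2) by (intro closure_minimal) (auto simp: cell)
  have int: "T \<subseteq> interior unit_cell"
  proof
    fix y assume y: "y \<in> T"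
    show "y \<in> interior unit_cell"
    proof (rule ccontr)
      assume n: "y \<notin> interior unit_cell"
      then have "y \<in> frontier unit_cell" "y \<in> frontier T"
        using y sub T(2) interior_mono[OF sub] by (auto simp: frontier_def cell)
      then have "setdist (frontier T) (frontier (unit_cell :: (real^'n) set)) \<le> dist y y"
        by (intro setdist_le_dist)
      then show False using c by simp
    qed
  qed
  have lt: "\<bar>y $ i\<bar> < 1 / 2" if "y \<in> T" for y i
  proof -
    have "y \<in> box (\<chi> i. - 1 / 2) (\<chi> i. 1 / 2)"
      using that int by (auto simp: cell interior_cbox)
    then have "- 1 / 2 < y $ i" "y $ i < 1 / 2" by (auto simp: mem_box_cart)
    then show ?thesis by linarith
  qed
  have z: "0 \<in> T" using c by auto
  have "\<exists>s<1 / 2. \<forall>y\<in>T. \<bar>y $ i\<bar> \<le> s" for i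
  proof -
    have "continuous_on T (\<lambda>y. \<bar>y $ i\<bar>)" by (intro continuous_intros)
    then obtain y0 where "y0 \<in> T" "\<forall>y\<in>T. \<bar>y $ i\<bar> \<le> \<bar>y0 $ i\<bar>"
      using continuous_attains_sup[OF T(1)] z by blast
    then show ?thesis using lt by blast
  qed
  then obtain s where s: "\<And>i. s i < 1 / 2" "\<And>i y. y \<in> T \<Longrightarrow> \<bar>y $ i\<bar> \<le> s i" by metis
  define r where "r = Min (range (\<lambda>i. 1 / 2 - s i))"
  have r: "0 < r" unfolding r_def using s(1) by (subst Min_gr_iff) auto
  have rs: "r \<le> 1 / 2 - s i" for i unfolding r_def by (rule Min_le) auto
  obtain \<rho> where \<rho>: "0 < \<rho>" "T \<subseteq> ball 0 \<rho>"
    using compact_imp_bounded[OF T(1)] bounded_subset_ballD by blast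
  show thesis
  proof (rule that[of c \<rho> "min r (1 / 4)"])
    show "\<bar>y $ i\<bar> \<le> 1 / 2 - min r (1 / 4)" if "y \<in> T" for y i
      using s(2)[OF that, of i] rs[of i] by linarith
  qed (use T c \<rho> r in auto)
qed

text \<open>The balls of radius \<open>\<epsilon> r\<close> around the corners of the cells meet no hole, for any \<open>\<eta> \<le> 1\<close>.\<close>

lemma uniform_lower_bound:
  fixes T :: "(real^'n) set"
  assumes "admissible_hole T" and p: "1 < p"
  obtains C where "0 < C" "\<And>\<epsilon> \<eta>. 0 < \<epsilon> \<Longrightarrow> 0 < \<eta> \<Longrightarrow> \<eta> \<le> 1 \<Longrightarrow> ennreal (C * \<epsilon>) \<le> B_const p T \<epsilon> \<eta>"
proof -
  obtain c r where T: "compact T" "0 < c" "ball 0 c \<subseteq> T" "0 < r" "\<And>y i. y \<in> T \<Longrightarrow> \<bar>y $ i\<bar> \<le> 1 / 2 - r"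
    using admissible_hole_bounds[OF assms(1)] by metis
  define i :: 'n where "i = undefined"
  obtain A where A: "1 \<le> A" "\<And>x::real^'n. \<bar>profile i x\<bar> \<le> A" "\<And>x::real^'n. \<bar>partial_deriv i (profile i) x\<bar> \<le> A"
    "\<And>x::real^'n. norm (grad (partial_deriv i (profile i)) x) \<le> A" "\<And>x::real^'n. norm (grad bump x) \<le> A"
    using profile_bounds[of i] by blast
  define q where "q = p / (p - 1)"
  have pq: "1 < p" "1 < q" "1 / p + 1 / q = 1" using p by (auto simp: q_def field_simps)
  define C where "C = 1 / (4 * A ^ 3 * 2 ^ CARD('n)) * (r / 3)"
  have "0 < C" using A(1) T(4) by (simp add: C_def)
  moreover have "ennreal (C * \<epsilon>) \<le> B_const p T \<epsilon> \<eta>" if \<epsilon>: "0 < \<epsilon>" and \<eta>: "0 < \<eta>" "\<eta> \<le> 1" for \<epsilon> \<eta>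
  proof -
    let ?\<Omega> = "perforated_domain T \<epsilon> \<eta>"
    define x0 :: "real^'n" where "x0 = (\<chi> i. \<epsilon> / 2)"
    \<comment> \<open>The test function lives in the ball of radius \<open>2 * L\<close>, which is
      less than \<open>\<epsilon> * r\<close>, the radius of the ball free of holes.\<close>
    define L where "L = \<epsilon> * r / 3"
    have L: "0 < L" using \<epsilon> T by (simp add: L_def)
    \<comment> \<open>Without bumps the cutoff is 0 and \<open>test\<close> equals
      \<open>rhs\<close>. Both energy densities may then be taken to be 0, and the first bound
      reduces to a multiple of \<open>L\<close>, for every \<open>p\<close>.\<close>
    interpret test_function i A x0 L 1 "{} :: nat set" "\<lambda>_. 0" "\<lambda>_. 1" "CARD('n)" "unit_ball_vol (real CARD('n))"
      by unfold_locales (use A L in auto)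
    have free: "ball x0 (\<epsilon> * r) \<subseteq> ?\<Omega>"
    proof (rule subsetI, rule ccontr)
      fix y assume y: "y \<in> ball x0 (\<epsilon> * r)" "y \<notin> ?\<Omega>"
      then obtain k t where k: "\<forall>i. k $ i \<in> \<int>" "t \<in> T" "y = \<epsilon> *\<^sub>R (k + \<eta> *\<^sub>R t)"
        by (auto simp: perforated_domain_def)
      obtain m where m: "k $ i = of_int m" using k(1) Ints_cases by blast
      have "\<bar>\<eta> * t $ i\<bar> \<le> 1 * \<bar>t $ i\<bar>" unfolding abs_mult using \<eta> by (intro mult_right_mono) auto
      also have "\<dots> \<le> 1 / 2 - r" using T(5)[OF k(2)] by simp
      finally have t: "\<bar>\<eta> * t $ i\<bar> \<le> 1 / 2 - r" .
      \<comment> \<open>An integer is at least 1/2 away from 1/2, while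
        \<open>\<eta> * t $ i\<close> stays within \<open>1 / 2 - r\<close> of 0; a single
        coordinate thus keeps the hole at distance \<open>\<epsilon> * r\<close> from the
        corner.\<close>
      have "1 / 2 \<le> \<bar>real_of_int m - 1 / 2\<bar>"
      proof (cases "m \<le> 0")
        case False
        then have "1 \<le> real_of_int m" by simp
        then show ?thesis by simp
      qed simp
      then have "r \<le> \<bar>k $ i + \<eta> * t $ i - 1 / 2\<bar>" using t unfolding m by linarith
      then have "\<epsilon> * r \<le> \<epsilon> * \<bar>k $ i + \<eta> * t $ i - 1 / 2\<bar>" using \<epsilon> by (intro mult_left_mono) auto
      also have "\<dots> = \<bar>\<epsilon> * (k $ i + \<eta> * t $ i - 1 / 2)\<bar>" using \<epsilon> by (simp add: abs_mult)
      also have "\<epsilon> * (k $ i + \<eta> * t $ i - 1 / 2) = (y - x0) $ i"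
        unfolding k(3) by (simp add: x0_def algebra_simps)
      also have "\<bar>(y - x0) $ i\<bar> \<le> norm (y - x0)" by (rule component_le_norm_cart)
      finally show False using y(1) by (simp add: dist_norm norm_minus_commute)
    qed
    have "closure {x. test x \<noteq> 0} \<subseteq> cball x0 (2 * L)"
      using outside(2) by (intro closure_minimal) (force simp: test_def dist_norm norm_minus_commute)+
    also have "\<dots> \<subseteq> ball x0 (\<epsilon> * r)" using \<epsilon> T(4) by (intro cball_subset_ball_iff[THEN iffD2]) (auto simp: L_def)
    finally have test: "test \<in> C0_infinity ?\<Omega>"
      using free by (intro C0_infinityI_closure smooth_test test_bounded_support) auto
    have meas: "?\<Omega> \<in> sets lebesgue" by (rule perforated_domain_measurable[OF T(1)])
    obtain K where K: "\<And>\<psi>. \<psi> \<in> C0_infinity ?\<Omega> \<Longrightarrow>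
        (LINT x|lebesgue. (\<psi> x)\<^sup>2) \<le> K * (LINT x|lebesgue. (norm (grad \<psi> x))\<^sup>2)"
      using perforated_domain_poincare[OF T(2,3) \<epsilon> \<eta>(1)] by blast
    obtain F u g where F: "F \<in> Lp_space p ?\<Omega>" "F \<in> Lp_space 2 ?\<Omega>" "Lp_norm p ?\<Omega> F = 1" "weak_solution ?\<Omega> F u g"
      and b: "ennreal (1 / (4 * A ^ 3 * 2 ^ CARD('n)) * (L powr - q + 0) powr (- 1 / q)) \<le> Lp_norm p ?\<Omega> g"
      by (rule lower_bounds[OF pq meas K test, of 0 0]) (use L in auto)
    have Lq: "(L powr - q + 0) powr (- 1 / q) = L" using L pq by (simp add: powr_powr)
    have "C * \<epsilon> = 1 / (4 * A ^ 3 * 2 ^ CARD('n)) * L" by (simp add: C_def L_def)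
    then have "ennreal (C * \<epsilon>) \<le> Lp_norm p ?\<Omega> g" using b unfolding Lq by simp
    then show ?thesis using B_const_ge[OF F] by (rule order_trans)
  qed
  ultimately show thesis by (rule that)
qed

text \<open>For \<open>\<eta>\<close> above the threshold, \<open>f\<close> is bounded by its value
  at \<open>\<eta>0\<close>, so the bound linear in \<open>\<epsilon>\<close> suffices after
  shrinking the constant.\<close>

lemma lower_bound_all_eta:
  fixes f :: "real \<Rightarrow> real"
  assumes T: "admissible_hole T" and p: "1 < p" and \<eta>0: "0 < \<eta>0"
    and C: "0 < C" "\<And>\<epsilon> \<eta>. 0 < \<epsilon> \<Longrightarrow> 0 < \<eta> \<Longrightarrow> \<eta> \<le> \<eta>0 \<Longrightarrow> ennreal (C * \<epsilon> * f \<eta>) \<le> B_const p T \<epsilon> \<eta>"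
    and f: "\<And>\<eta>. 0 < \<eta> \<Longrightarrow> \<eta> \<le> 1 \<Longrightarrow> 0 \<le> f \<eta>"
      "\<And>\<eta>. \<eta>0 \<le> \<eta> \<Longrightarrow> \<eta> \<le> 1 \<Longrightarrow> f \<eta> \<le> f \<eta>0"
  shows "\<exists>c>0. \<forall>\<epsilon>\<in>{0<..1}. \<forall>\<eta>\<in>{0<..1}. ennreal (c * \<epsilon> * f \<eta>) \<le> B_const p T \<epsilon> \<eta>"
proof -
  obtain C' where C': "0 < C'" "\<And>\<epsilon> \<eta>. 0 < \<epsilon> \<Longrightarrow> 0 < \<eta> \<Longrightarrow> \<eta> \<le> 1 \<Longrightarrow> ennreal (C' * \<epsilon>) \<le> B_const p T \<epsilon> \<eta>"
    using uniform_lower_bound[OF T p] by blast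
  define D where "D = \<bar>f \<eta>0\<bar> + 1"
  have D: "0 < D" by (simp add: D_def)
  define c where "c = min C (C' / D)"
  have c: "0 < c" "c \<le> C" "c * D \<le> C'"
    using C(1) C'(1) D by (auto simp: c_def min_def field_simps)
  have "ennreal (c * \<epsilon> * f \<eta>) \<le> B_const p T \<epsilon> \<eta>" if e: "0 < \<epsilon>" "\<epsilon> \<le> 1" "0 < \<eta>" "\<eta> \<le> 1" for \<epsilon> \<eta>
  proof (cases "\<eta> \<le> \<eta>0")
    case True
    have "c * \<epsilon> * f \<eta> \<le> C * \<epsilon> * f \<eta>"
      using c e f(1) by (intro mult_right_mono) auto
    then show ?thesis using C(2)[OF e(1,3) True] by (meson ennreal_leI order_trans)
  next
    case False
    then have "f \<eta> \<le> D" using f(2)[of \<eta>] e by (simp add: D_def)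
    then have "c * \<epsilon> * f \<eta> \<le> c * \<epsilon> * D" using c e by (intro mult_left_mono) auto
    also have "\<dots> = c * D * \<epsilon>" by simp
    also have "\<dots> \<le> C' * \<epsilon>" using c e by (intro mult_right_mono) auto
    finally show ?thesis using C'(2)[OF e(1,3,4)] by (meson ennreal_leI order_trans)
  qed
  then show ?thesis using c(1) by (intro exI[of _ c]) auto
qed

section \<open>The three regimes\<close>

text \<open>One scale, \<open>M = 1\<close>, and the first bound. Up to the constant
  \<open>\<kappa>\<close> the capacity is \<open>\<eta> powr (d - q) = \<tau> powr q\<close> with
  \<open>\<tau> = \<eta> powr (d / q - 1)\<close>. Since \<open>q < 2 \<le> d\<close>, this
  \<open>\<tau>\<close> is at most 1, and \<open>1 - d / q\<close> is the exponent claimed.\<close>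

lemma lower_bound_large_p:
  fixes T :: "(real^'n) set"
  assumes n: "2 \<le> CARD('n)" and p: "2 < p" and T: "admissible_hole T"
  shows "\<exists>c>0. \<forall>\<epsilon>\<in>{0<..1}. \<forall>\<eta>\<in>{0<..1}.
    ennreal (c * \<epsilon> * \<eta> powr (1 - real CARD('n) + real CARD('n) / p)) \<le> B_const p T \<epsilon> \<eta>"
proof -
  obtain c \<rho> where h: "compact T" "0 < c" "ball 0 c \<subseteq> T" "0 < \<rho>" "T \<subseteq> ball 0 \<rho>"
    using admissible_hole_bounds[OF T] by metis
  define i :: 'n where "i = undefined"
  obtain A where A: "1 \<le> A" "\<And>x::real^'n. \<bar>profile i x\<bar> \<le> A" "\<And>x::real^'n. \<bar>partial_deriv i (profile i) x\<bar> \<le> A"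
    "\<And>x::real^'n. norm (grad (partial_deriv i (profile i)) x) \<le> A" "\<And>x::real^'n. norm (grad bump x) \<le> A"
    using profile_bounds[of i] by blast
  define q where "q = p / (p - 1)"
  have pq: "1 < p" "1 < q" "1 / p + 1 / q = 1" "q < 2" using p by (auto simp: q_def field_simps)
  let ?n = "real CARD('n)"
  let ?e = "1 - ?n + ?n / p"
  have e: "?e = 1 - ?n / q"
  proof -
    have "?n * (1 / p + 1 / q) = ?n" using pq by simp
    then show ?thesis by (simp add: algebra_simps)
  qed
  have "q \<le> ?n" using n pq by simp
  then have "1 \<le> ?n / q" using pq by (simp add: pos_le_divide_eq)
  then have e0: "?e \<le> 0" unfolding e by simp
  \<comment> \<open>Exactly the smallness that a single scale, \<open>2 ^ 1\<close> in place of
    \<open>2 ^ M\<close>, requires.\<close>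
  define \<eta>0 where "\<eta>0 = min 1 (1 / (14 * A\<^sup>2) / (\<rho> * 2))"
  have \<eta>0: "0 < \<eta>0" using A(1) h by (simp add: \<eta>0_def)
  define \<kappa> where "\<kappa> = 7 ^ CARD('n) * \<rho> powr (?n - q)"
  define C where "C = 1 / (4 * A ^ 3 * 2 ^ CARD('n)) * (1 + \<kappa>) powr (- 1 / q)"
  have \<kappa>: "0 \<le> \<kappa>" by (simp add: \<kappa>_def)
  have C: "0 < C" using A(1) \<kappa> by (simp add: C_def)
  show ?thesis
  proof (rule lower_bound_all_eta[OF T pq(1) \<eta>0 C])
    fix \<epsilon> \<eta> :: real assume a: "0 < \<epsilon>" "0 < \<eta>" "\<eta> \<le> \<eta>0"
    have small: "\<rho> * \<eta> * 2 ^ 1 \<le> 1 / (14 * A\<^sup>2)"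
    proof -
      have "\<eta> \<le> 1 / (14 * A\<^sup>2) / (\<rho> * 2)" using a(3) by (simp add: \<eta>0_def)
      then have "\<eta> * (\<rho> * 2) \<le> 1 / (14 * A\<^sup>2)" using h(4) by (simp only: pos_le_divide_eq mult_pos_pos zero_less_numeral)
      then show ?thesis by (simp add: ac_simps)
    qed
    define \<tau> where "\<tau> = \<eta> powr (?n / q - 1)"
    have \<tau>: "0 < \<tau>" "\<tau> \<le> 1"
      using a e0 powr_le1[of "?n / q - 1" \<eta>] by (auto simp: \<tau>_def e \<eta>0_def)
    have \<tau>q: "\<tau> powr q = \<eta> powr (?n - q)" using pq by (simp add: \<tau>_def powr_powr algebra_simps)
    have "ennreal (C * (\<epsilon> / \<tau>)) \<le> B_const p T \<epsilon> \<eta>"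
      unfolding C_def
      by (rule periodic_lower_bounds_scaled(1)[OF A pq(1-3) h(1-3,5) a(1,2) h(4) zero_less_one small \<tau> \<kappa>])
        (use a h in \<open>simp add: \<tau>q \<kappa>_def powr_mult\<close>)
    moreover have "\<epsilon> / \<tau> = \<epsilon> * \<eta> powr ?e"
      unfolding e \<tau>_def by (simp add: divide_inverse powr_minus[symmetric])
    ultimately show "ennreal (C * \<epsilon> * \<eta> powr ?e) \<le> B_const p T \<epsilon> \<eta>" by (simp add: mult.assoc)
  next
    fix \<eta> assume "\<eta>0 \<le> \<eta>"
    then show "\<eta> powr ?e \<le> \<eta>0 powr ?e" using \<eta>0 e0 by (intro powr_mono2') auto
  qed simp
qed

text \<open>One scale and the second bound, in which the capacity has exponent 2 whatever
  \<open>p\<close> is; therefore the power of \<open>\<eta>\<close> does not involve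
  \<open>p\<close>. With \<open>\<tau>\<^sup>2 = \<eta> powr (d - 2)\<close> the length
  \<open>\<epsilon> / \<tau>\<close> is the screening length.\<close>

lemma lower_bound_small_p:
  fixes T :: "(real^'n) set"
  assumes n: "3 \<le> CARD('n)" and p: "1 < p" and T: "admissible_hole T"
  shows "\<exists>c>0. \<forall>\<epsilon>\<in>{0<..1}. \<forall>\<eta>\<in>{0<..1}.
    ennreal (c * \<epsilon> * \<eta> powr (1 - real CARD('n) / 2)) \<le> B_const p T \<epsilon> \<eta>"
proof -
  obtain c \<rho> where h: "compact T" "0 < c" "ball 0 c \<subseteq> T" "0 < \<rho>" "T \<subseteq> ball 0 \<rho>"
    using admissible_hole_bounds[OF T] by metis
  define i :: 'n where "i = undefined"
  obtain A where A: "1 \<le> A" "\<And>x::real^'n. \<bar>profile i x\<bar> \<le> A" "\<And>x::real^'n. \<bar>partial_deriv i (profile i) x\<bar> \<le> A"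
    "\<And>x::real^'n. norm (grad (partial_deriv i (profile i)) x) \<le> A" "\<And>x::real^'n. norm (grad bump x) \<le> A"
    using profile_bounds[of i] by blast
  define q where "q = p / (p - 1)"
  have pq: "1 < p" "1 < q" "1 / p + 1 / q = 1" using p by (auto simp: q_def field_simps)
  let ?n = "real CARD('n)"
  let ?e = "1 - ?n / 2"
  have e0: "?e \<le> 0" using n by simp
  define \<eta>0 where "\<eta>0 = min 1 (1 / (14 * A\<^sup>2) / (\<rho> * 2))"
  have \<eta>0: "0 < \<eta>0" using A(1) h by (simp add: \<eta>0_def)
  define \<kappa> where "\<kappa> = 7 ^ CARD('n) * \<rho> powr (?n - 2)"
  define C where "C = 1 / (16 * A ^ 6 * 4 ^ CARD('n)) / (1 + 2 * \<kappa>)"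
  have \<kappa>: "0 \<le> \<kappa>" by (simp add: \<kappa>_def)
  have C: "0 < C" using A(1) \<kappa> by (simp add: C_def)
  show ?thesis
  proof (rule lower_bound_all_eta[OF T pq(1) \<eta>0 C])
    fix \<epsilon> \<eta> :: real assume a: "0 < \<epsilon>" "0 < \<eta>" "\<eta> \<le> \<eta>0"
    have small: "\<rho> * \<eta> * 2 ^ 1 \<le> 1 / (14 * A\<^sup>2)"
    proof -
      have "\<eta> \<le> 1 / (14 * A\<^sup>2) / (\<rho> * 2)" using a(3) by (simp add: \<eta>0_def)
      then have "\<eta> * (\<rho> * 2) \<le> 1 / (14 * A\<^sup>2)" using h(4) by (simp only: pos_le_divide_eq mult_pos_pos zero_less_numeral)
      then show ?thesis by (simp add: ac_simps)
    qed
    define \<tau> where "\<tau> = \<eta> powr (?n / 2 - 1)"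
    have \<tau>: "0 < \<tau>" "\<tau> \<le> 1"
      using a e0 powr_le1[of "?n / 2 - 1" \<eta>] by (auto simp: \<tau>_def \<eta>0_def)
    have "\<tau>\<^sup>2 = \<tau> powr 2" using \<tau> by simp
    also have "\<dots> = \<eta> powr (?n - 2)" by (simp add: \<tau>_def powr_powr algebra_simps)
    finally have \<tau>2: "\<tau>\<^sup>2 = \<eta> powr (?n - 2)" .
    have "ennreal (C * (\<epsilon> / \<tau>)) \<le> B_const p T \<epsilon> \<eta>"
      unfolding C_def
      by (rule periodic_lower_bounds_scaled(2)[OF A pq(1-3) h(1-3,5) a(1,2) h(4) zero_less_one small \<tau> \<kappa>])
        (use a h in \<open>simp add: \<tau>2 \<kappa>_def powr_mult\<close>)
    moreover have "?e = - (?n / 2 - 1)" by simp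
    then have "\<epsilon> / \<tau> = \<epsilon> * \<eta> powr ?e"
      unfolding \<tau>_def by (simp only: powr_minus divide_inverse)
    ultimately show "ennreal (C * \<epsilon> * \<eta> powr ?e) \<le> B_const p T \<epsilon> \<eta>" by (simp add: mult.assoc)
  next
    fix \<eta> assume "\<eta>0 \<le> \<eta>"
    then show "\<eta> powr ?e \<le> \<eta>0 powr ?e" using \<eta>0 e0 by (intro powr_mono2') auto
  qed simp
qed

text \<open>In the plane a bump has the same 2-energy at every scale. Averaging \<open>M\<close>
  scales divides each gradient by \<open>M\<close>, and the \<open>M\<close> disjoint contributions
  add up to a capacity of order \<open>1 / M\<close>. About \<open>|ln \<eta>|\<close> dyadic scales
  fit between the hole and the cell, which produces the square root of the logarithm.\<close>

lemma lower_bound_two_dim: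
  fixes T :: "(real^'n) set"
  assumes n: "CARD('n) = 2" and p: "1 < p" and T: "admissible_hole T"
  shows "\<exists>c>0. \<forall>\<epsilon>\<in>{0<..1}. \<forall>\<eta>\<in>{0<..1}.
    ennreal (c * \<epsilon> * \<bar>ln (\<eta> / 2)\<bar> powr (1 / 2)) \<le> B_const p T \<epsilon> \<eta>"
proof -
  obtain c \<rho> where h: "compact T" "0 < c" "ball 0 c \<subseteq> T" "0 < \<rho>" "T \<subseteq> ball 0 \<rho>"
    using admissible_hole_bounds[OF T] by metis
  define i :: 'n where "i = undefined"
  obtain A where A: "1 \<le> A" "\<And>x::real^'n. \<bar>profile i x\<bar> \<le> A" "\<And>x::real^'n. \<bar>partial_deriv i (profile i) x\<bar> \<le> A"
    "\<And>x::real^'n. norm (grad (partial_deriv i (profile i)) x) \<le> A" "\<And>x::real^'n. norm (grad bump x) \<le> A"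
    using profile_bounds[of i] by blast
  define q where "q = p / (p - 1)"
  have pq: "1 < p" "1 < q" "1 / p + 1 / q = 1" using p by (auto simp: q_def field_simps)
  define b where "b = 1 / (14 * A\<^sup>2) / \<rho>"
  have b: "0 < b" using A(1) h by (simp add: b_def)
  \<comment> \<open>Three demands: \<open>b / 4\<close> leaves room for at least two dyadic scales,
    \<open>b\<^sup>2\<close> lets the constant \<open>b\<close> cost at most half of the logarithm,
    and \<open>1 / 2\<close> gives \<open>ln 2 \<le> - ln \<eta>\<close>.\<close>
  define \<eta>0 where "\<eta>0 = min (1 / 2) (min (b / 4) (b\<^sup>2))"
  have \<eta>0: "0 < \<eta>0" using b by (simp add: \<eta>0_def)
  define C0 where "C0 = 1 / (16 * A ^ 6 * 4 ^ CARD('n)) / (1 + 2 * 49)"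
  have C0: "0 < C0" using A(1) by (simp add: C0_def)
  \<comment> \<open>The 8 collects three losses of a factor 2: from \<open>b\<close>, from rounding
    \<open>x\<close> down to \<open>M\<close>, and from replacing \<open>ln \<eta>\<close> by
    \<open>ln (\<eta> / 2)\<close>.\<close>
  define C where "C = C0 * (1 / 8) powr (1 / 2)"
  have C: "0 < C" using C0 by (simp add: C_def)
  have lnabs: "\<bar>ln (\<eta> / 2)\<bar> = ln 2 - ln \<eta>" if "0 < \<eta>" "\<eta> \<le> 1" for \<eta> :: real
    using that ln_le_zero_iff[of \<eta>] ln_gt_zero[of "2::real"] by (simp add: ln_div)
  show ?thesis
  proof (rule lower_bound_all_eta[OF T pq(1) \<eta>0 C])
    fix \<epsilon> \<eta> :: real assume a: "0 < \<epsilon>" "0 < \<eta>" "\<eta> \<le> \<eta>0"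
    then have \<eta>: "\<eta> \<le> 1 / 2" "\<eta> \<le> b / 4" "\<eta> \<le> b\<^sup>2" by (auto simp: \<eta>0_def)
    define x where "x = log 2 (b / \<eta>)"
    \<comment> \<open>The largest number of scales for which \<open>\<rho> * \<eta> * 2 ^ M\<close>
      is still admissible. Rounding down keeps at least half of \<open>x\<close>, because
      \<open>x \<ge> 2\<close>.\<close>
    define M where "M = nat \<lfloor>x\<rfloor>"
    have "log 2 4 \<le> x" unfolding x_def using \<eta> a b by (subst log_le_cancel_iff) (auto simp: field_simps)
    moreover have "log 2 4 = (2::real)" using log_pow_cancel[of "2::real" 2] by simp
    ultimately have x2: "2 \<le> x" by simp
    have M: "0 < M" "real M \<le> x" "x / 2 \<le> real M" using x2 by (auto simp: M_def) linarith+
    have "2 ^ M = 2 powr real M" by (simp add: powr_realpow)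
    also have "\<dots> \<le> 2 powr x" using M by (intro powr_mono) auto
    also have "\<dots> = b / \<eta>" unfolding x_def using a b by simp
    finally have "\<rho> * \<eta> * 2 ^ M \<le> \<rho> * \<eta> * (b / \<eta>)" using a h by (intro mult_left_mono) auto
    also have "\<dots> = 1 / (14 * A\<^sup>2)" using a h by (simp add: b_def)
    finally have small: "\<rho> * \<eta> * 2 ^ M \<le> 1 / (14 * A\<^sup>2)" .
    define \<tau> where "\<tau> = 1 / sqrt (real M)"
    have \<tau>: "0 < \<tau>" "\<tau> \<le> 1" using M(1) by (auto simp: \<tau>_def divide_le_eq)
    have "ennreal (C0 * (\<epsilon> / \<tau>)) \<le> B_const p T \<epsilon> \<eta>"
      unfolding C0_def
    proof (rule periodic_lower_bounds_scaled(2)[OF A pq(1-3) h(1-3,5) a(1,2) h(4) M(1) small \<tau>])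
      \<comment> \<open>The exponent is 0, so every scale contributes 1. The hypothesis then reads
        \<open>49 / M \<le> 49 * \<tau>\<^sup>2\<close>, an equality for
        \<open>\<tau> = 1 / sqrt M\<close>.\<close>
      have "(\<Sum>j<M. (\<rho> * \<eta> * 2 ^ j) powr (real CARD('n) - 2)) = real M"
        using a(2) h(4) by (simp add: n)
      then show "real M powr - 2 * (7 ^ CARD('n) * (\<Sum>j<M. (\<rho> * \<eta> * 2 ^ j) powr (real CARD('n) - 2))) \<le> 49 * \<tau>\<^sup>2"
        using M(1) by (simp add: n \<tau>_def power_divide powr_minus_divide power2_eq_square)
    qed simp
    moreover have "C * \<epsilon> * \<bar>ln (\<eta> / 2)\<bar> powr (1 / 2) \<le> C0 * (\<epsilon> / \<tau>)"
    proof -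
      have "ln \<eta> \<le> ln (b\<^sup>2)" using a b \<eta> by (subst ln_le_cancel_iff) auto
      also have "\<dots> = 2 * ln b" using b by (simp add: ln_realpow)
      finally have lnb: "ln \<eta> \<le> 2 * ln b" .
      have "ln \<eta> \<le> ln (1 / 2)" using a \<eta> by (subst ln_le_cancel_iff) auto
      then have ln2: "ln 2 \<le> - ln \<eta>" by (simp add: ln_div)
      have l2: "0 < ln (2::real)" "ln (2::real) \<le> 1" using ln_le_minus_one[of "2::real"] by auto
      have "x = (ln b - ln \<eta>) / ln 2" using a b by (simp add: x_def log_def ln_div)
      also have "\<dots> \<ge> (- ln \<eta> / 2) / ln 2" using lnb l2 by (intro divide_right_mono) auto
      finally have "- ln \<eta> / 2 / ln 2 \<le> x" .
      moreover have "(- ln \<eta> / 2) * ln 2 \<le> (- ln \<eta> / 2) * 1"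
        by (intro mult_left_mono) (use l2 ln2 in linarith)+
      then have "- ln \<eta> / 2 \<le> - ln \<eta> / 2 / ln 2"
        by (subst pos_le_divide_eq[OF l2(1)]) simp
      ultimately have "- ln \<eta> / 4 \<le> real M" using M(3) by linarith
      moreover have "\<bar>ln (\<eta> / 2)\<bar> \<le> - 2 * ln \<eta>" using lnabs[of \<eta>] a \<eta> ln2 by simp
      ultimately have "1 / 8 * \<bar>ln (\<eta> / 2)\<bar> \<le> real M" by linarith
      then have "(1 / 8 * \<bar>ln (\<eta> / 2)\<bar>) powr (1 / 2) \<le> real M powr (1 / 2)" by (intro powr_mono2) auto
      also have "(1 / 8 * \<bar>ln (\<eta> / 2)\<bar>) powr (1 / 2) = (1 / 8) powr (1 / 2) * \<bar>ln (\<eta> / 2)\<bar> powr (1 / 2)"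
        by (subst powr_mult) auto
      also have "real M powr (1 / 2) = sqrt (real M)" by (rule powr_half_sqrt) simp
      finally have "(1 / 8) powr (1 / 2) * \<bar>ln (\<eta> / 2)\<bar> powr (1 / 2) \<le> sqrt (real M)" .
      then have "C0 * \<epsilon> * ((1 / 8) powr (1 / 2) * \<bar>ln (\<eta> / 2)\<bar> powr (1 / 2)) \<le> C0 * \<epsilon> * sqrt (real M)"
        by (rule mult_left_mono) (use C0 a in auto)
      also have "\<dots> = C0 * (\<epsilon> / \<tau>)" by (simp add: \<tau>_def)
      finally show ?thesis unfolding C_def by (simp only: ac_simps)
    qed
    ultimately show "ennreal (C * \<epsilon> * \<bar>ln (\<eta> / 2)\<bar> powr (1 / 2)) \<le> B_const p T \<epsilon> \<eta>"
      by (meson ennreal_leI order_trans)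
  next
    fix \<eta> assume a: "\<eta>0 \<le> \<eta>" "\<eta> \<le> 1"
    have "ln \<eta>0 \<le> ln \<eta>" using a \<eta>0 by (subst ln_le_cancel_iff) auto
    then have "\<bar>ln (\<eta> / 2)\<bar> \<le> \<bar>ln (\<eta>0 / 2)\<bar>" using lnabs[of \<eta>] lnabs[of \<eta>0] a \<eta>0 by simp
    then show "\<bar>ln (\<eta> / 2)\<bar> powr (1 / 2) \<le> \<bar>ln (\<eta>0 / 2)\<bar> powr (1 / 2)" by (intro powr_mono2) auto
  qed simp
qed

theorem theorem5p5:
  fixes T :: "(real^'n) set" and p :: real
  assumes "CARD('n) \<ge> 2" and "1 < p" and "admissible_hole T"
  shows "\<exists>c>0. \<forall>\<epsilon>\<in>{0<..1}. \<forall>\<eta>\<in>{0<..1}.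
     (CARD('n) \<ge> 3 \<and> p \<le> 2 \<longrightarrow> B_const p T \<epsilon> \<eta> \<ge> ennreal (c * \<epsilon> * \<eta> powr (1 - real CARD('n) / 2))) \<and>
     (CARD('n) \<ge> 3 \<and> 2 < p \<longrightarrow> B_const p T \<epsilon> \<eta> \<ge> ennreal (c * \<epsilon> * \<eta> powr (1 - real CARD('n) + real CARD('n) / p))) \<and>
     (CARD('n) = 2 \<and> p \<le> 2 \<longrightarrow> B_const p T \<epsilon> \<eta> \<ge> ennreal (c * \<epsilon> * \<bar>ln (\<eta> / 2)\<bar> powr (1 / 2))) \<and>
     (CARD('n) = 2 \<and> 2 < p \<longrightarrow> B_const p T \<epsilon> \<eta> \<ge> ennreal (c * \<epsilon> * \<eta> powr (- 1 + 2 / p)))"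
proof -
  consider "2 < p" | "CARD('n) \<ge> 3" "p \<le> 2" | "CARD('n) = 2" "p \<le> 2"
    using assms(1) by linarith
  then show ?thesis
  proof cases
    case 1
    \<comment> \<open>For \<open>CARD('n) = 2\<close> the exponent is \<open>- 1 + 2 / p\<close>, so
      this one bound settles \<open>p > 2\<close> in every dimension.\<close>
    obtain c where "0 < c" "\<forall>\<epsilon>\<in>{0<..1}. \<forall>\<eta>\<in>{0<..1}.
        ennreal (c * \<epsilon> * \<eta> powr (1 - real CARD('n) + real CARD('n) / p)) \<le> B_const p T \<epsilon> \<eta>"
      using lower_bound_large_p[OF assms(1) 1 assms(3)] by blast
    then show ?thesis using 1 by (intro exI[of _ c]) auto
  next
    case 2
    then show ?thesis using lower_bound_small_p[OF 2(1) assms(2,3)] by auto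
  next
    case 3
    then show ?thesis using lower_bound_two_dim[OF 3(1) assms(2,3)] by auto
  qed
qed

end
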